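(* Fix $\lambda>0$ and choose $q$ with $0<q<\min\left\{\frac1{\lambda+2},\frac13\right\}$. For every $\varepsilon>0$ there exist finite $K=K(\varepsilon,q,\lambda)$ and $L=L(\varepsilon,q,\lambda)$ such that the root-finding output $\mathcal H_{K,L}(G_n^\circ)$ satisfies $$\liminf_{n\to\infty}\mathbb P\{1\in\mathcal H_{K,L}(G_n^\circ)\}\ge1-\varepsilon.$$ Thus the original unlabeled observation $G_n^\circ$, before the auxiliary percolation, admits a root confidence set whose size is deterministically bounded by $K(\varepsilon,q,\lambda)L(\varepsilon,q,\lambda)$.
   Context: $T_n$ is the random recursive tree on $[n]=\{1,\dots,n\}$ rooted at $1$: for $m=2,\dots,n$, vertex $m$ attaches to a uniformly chosen vertex of $[m-1]$, independently. $H_n$ is an Erdős–Rényi graph on $[n]$, independent of $T_n$, with edge probability $\lambda/n$ (for $n\ge\lambda$). $G_n=T_n\cup H_n$, and $G_n^\circ$ is its unlabeled isomorphism class (no labels, no root mark, no distinction between tree edges and $H_n$-edges). "$1\in\mathcal H$" means that the vertex of the unlabeled graph corresponding to the original vertex $1$ belongs to the output set. Algorithm. Given $G_n^\circ$, retain each edge independently with probability $q$ (auxiliary percolation, independent of everything else). Let $\mathcal C^{(q)}_{n,1},\mathcal C^{(q)}_{n,2},\dots$ be the connected components of the retained graph, ranked in decreasing order of size with deterministic tie-breaking. For a finite connected graph $C$ and a vertex $v\in C$, let $$\psi_C(v)=\max\{|D|:D\text{ a connected component of }C\setminus\{v\}\}$$ (maximum over an empty family is $0$). For $L\ge1$, $\operatorname{TopJ}_L(C)$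 is the set of the $\min\{L,|C|\}$ vertices of $C$ with smallest $\psi_C$-values, ties broken by a fixed deterministic isomorphism-invariant rule (vertices exchangeable by an automorphism may be ordered arbitrarily). The output is $$\mathcal H_{K,L}(G_n^\circ)=\bigcup_{i=1}^K\operatorname{TopJ}_L(\mathcal C^{(q)}_{n,i}),$$ a set of at most $KL$ vertices. The probability is over $T_n$, $H_n$ and the auxiliary percolation. *)

theory Defs
  imports "HOL-Probability.Probability"
begin

section \<open>Finite simple graphs\<close>

type_synonym 'a ugraph = "'a set \<times> 'a set set"

abbreviation verts :: "'a ugraph \<Rightarrow> 'a set" where "verts \<equiv> fst"
abbreviation edges :: "'a ugraph \<Rightarrow> 'a set set" where "edges \<equiv> snd"

definition pairs :: "'a set \<Rightarrow> 'a set set" where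
  "pairs V = {e. e \<subseteq> V \<and> card e = 2}"

definition finite_graph :: "'a ugraph \<Rightarrow> bool" where
  "finite_graph G \<longleftrightarrow> finite (verts G) \<and> edges G \<subseteq> pairs (verts G)"

definition joined :: "'a ugraph \<Rightarrow> ('a \<times> 'a) set" where
  "joined G = {(u, v). u \<in> verts G \<and> v \<in> verts G \<and> (u, v) \<in> {(a, b). {a, b} \<in> edges G}\<^sup>*}"

text \<open>A component is represented by its vertex set.\<close>

definition graph_components :: "'a ugraph \<Rightarrow> 'a set set" where
  "graph_components G = verts G // joined G"

definition induced :: "'a ugraph \<Rightarrow> 'a set \<Rightarrow> 'a ugraph" where
  "induced G W = (W, {e \<in> edges G. e \<subseteq> W})"

definition graph_iso :: "('a \<Rightarrow> 'b) \<Rightarrow> 'a ugraph \<Rightarrow> 'b ugraph \<Rightarrow> bool" where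
  "graph_iso f G G' \<longleftrightarrow> bij_betw f (verts G) (verts G') \<and> edges G' = (`) f ` edges G"

section \<open>The observed graph\<close>

definition random_subset :: "real \<Rightarrow> 'a set \<Rightarrow> 'a set pmf" where
  "random_subset p A = map_pmf (\<lambda>b. {x \<in> A. b x}) (Pi_pmf A False (\<lambda>_. bernoulli_pmf p))"

text \<open>The random parent function of the recursive tree; the value outside \<open>{2..n}\<close> is a dummy.\<close>

definition recursive_tree :: "nat \<Rightarrow> nat set set pmf" where
  "recursive_tree n =
     map_pmf (\<lambda>p. (\<lambda>m. {p m, m}) ` {2..n}) (Pi_pmf {2..n} 0 (\<lambda>m. pmf_of_set {1..<m}))"

text \<open>\<^const>\<open>bernoulli_pmf\<close> truncates its parameter to \<open>[0, 1]\<close>, so the definition below is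
  meaningful only for \<open>n \<ge> lam\<close>, i.e. for all large \<open>n\<close>.\<close>

definition erdos_renyi :: "real \<Rightarrow> nat \<Rightarrow> nat set set pmf" where
  "erdos_renyi lam n = random_subset (lam / real n) (pairs {1..n})"

definition tree_plus_noise :: "real \<Rightarrow> nat \<Rightarrow> nat ugraph pmf" where
  "tree_plus_noise lam n =
     do { T \<leftarrow> recursive_tree n; H \<leftarrow> erdos_renyi lam n; return_pmf ({1..n}, T \<union> H) }"

definition unlabeled :: "nat ugraph \<Rightarrow> nat ugraph set" where
  "unlabeled G = {G'. \<exists>f. graph_iso f G G'}"

text \<open>An algorithm whose input is an isomorphism class and whose output is a set of vertices needs
  concrete vertices to name. A realization picks one representative \<open>rep U\<close> of each class \<open>U\<close> as
  the graph shown to the algorithm; \<open>pos G v\<close> is the vertex of that representative corresponding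
  to the vertex \<open>v\<close> of the labeled graph \<open>G\<close>.\<close>

definition realization ::
    "(nat ugraph set \<Rightarrow> nat ugraph) \<Rightarrow> (nat ugraph \<Rightarrow> nat \<Rightarrow> nat) \<Rightarrow> bool" where
  "realization rep pos \<longleftrightarrow>
     (\<forall>G. finite_graph G \<longrightarrow> graph_iso (pos G) G (rep (unlabeled G)))"

section \<open>The root-finding algorithm\<close>

definition percolate :: "real \<Rightarrow> 'a ugraph \<Rightarrow> 'a ugraph pmf" where
  "percolate q G = map_pmf (\<lambda>F. (verts G, F)) (random_subset q (edges G))"

text \<open>\<open>first_by before k A\<close> consists of the first \<open>k\<close> elements (all, if there are fewer) of the
  finite set \<open>A\<close> listed in the strict linear order \<open>before\<close>.\<close>

definition first_by :: "('a \<Rightarrow> 'a \<Rightarrow> bool) \<Rightarrow> nat \<Rightarrow> 'a set \<Rightarrow> 'a set" where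
  "first_by before k A = {x \<in> A. card {y \<in> A. before y x} < k}"

definition psi :: "'a ugraph \<Rightarrow> 'a \<Rightarrow> nat" where
  "psi C v = Max (insert 0 (card ` graph_components (induced C (verts C - {v}))))"

text \<open>Tie-breaking rules are given by keys, smaller keys coming first. A component rule ranks the
  components of the retained graph.\<close>

definition component_rule :: "('a ugraph \<Rightarrow> 'a set \<Rightarrow> nat) \<Rightarrow> bool" where
  "component_rule \<rho> \<longleftrightarrow> (\<forall>R. finite_graph R \<longrightarrow> inj_on (\<rho> R) (graph_components R))"

text \<open>Isomorphism invariance of a vertex rule: isomorphisms preserve the order of any two vertices
  that are not exchangeable by an automorphism.\<close>

definition vertex_rule :: "('a ugraph \<Rightarrow> 'a \<Rightarrow> nat) \<Rightarrow> bool" where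
  "vertex_rule \<tau> \<longleftrightarrow>
     (\<forall>C. finite_graph C \<longrightarrow> inj_on (\<tau> C) (verts C)) \<and>
     (\<forall>C C' f. finite_graph C \<longrightarrow> finite_graph C' \<longrightarrow> graph_iso f C C' \<longrightarrow>
        (\<forall>v\<in>verts C. \<forall>w\<in>verts C. \<tau> C v < \<tau> C w \<longrightarrow> \<not> (\<exists>g. graph_iso g C C \<and> g v = w) \<longrightarrow>
           \<tau> C' (f v) < \<tau> C' (f w)))"

definition TopJ :: "('a ugraph \<Rightarrow> 'a \<Rightarrow> nat) \<Rightarrow> nat \<Rightarrow> 'a ugraph \<Rightarrow> 'a set" where
  "TopJ \<tau> L C =
     first_by (\<lambda>w v. psi C w < psi C v \<or> psi C w = psi C v \<and> \<tau> C w < \<tau> C v) L (verts C)"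

definition largest_components ::
    "('a ugraph \<Rightarrow> 'a set \<Rightarrow> nat) \<Rightarrow> nat \<Rightarrow> 'a ugraph \<Rightarrow> 'a set set" where
  "largest_components \<rho> K R =
     first_by (\<lambda>D C. card D > card C \<or> card D = card C \<and> \<rho> R D < \<rho> R C) K (graph_components R)"

definition root_set ::
    "('a ugraph \<Rightarrow> 'a set \<Rightarrow> nat) \<Rightarrow> ('a ugraph \<Rightarrow> 'a \<Rightarrow> nat) \<Rightarrow> real \<Rightarrow> nat \<Rightarrow> nat \<Rightarrow>
     'a ugraph \<Rightarrow> 'a set pmf" where
  "root_set \<rho> \<tau> q K L G =
     map_pmf (\<lambda>R. \<Union>C\<in>largest_components \<rho> K R. TopJ \<tau> L (induced R C)) (percolate q G)"

text \<open>The joint law of the labeled graph and the output of the algorithm, which only sees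
  \<^term>\<open>unlabeled G\<close>.\<close>

definition root_experiment ::
    "(nat ugraph set \<Rightarrow> nat ugraph) \<Rightarrow> (nat ugraph \<Rightarrow> nat set \<Rightarrow> nat) \<Rightarrow>
     (nat ugraph \<Rightarrow> nat \<Rightarrow> nat) \<Rightarrow> real \<Rightarrow> real \<Rightarrow> nat \<Rightarrow> nat \<Rightarrow> nat \<Rightarrow>
     (nat ugraph \<times> nat set) pmf" where
  "root_experiment rep \<rho> \<tau> lam q K L n =
     do { G \<leftarrow> tree_plus_noise lam n;
          S \<leftarrow> root_set \<rho> \<tau> q K L (rep (unlabeled G));
          return_pmf (G, S) }"

section \<open>Realizations and tie-breaking rules exist\<close>

lemma graph_iso_refl: "graph_iso id G G"
  by (simp add: graph_iso_def)

lemma graph_iso_comp: "graph_iso f G H \<Longrightarrow> graph_iso g H K \<Longrightarrow> graph_iso (g \<circ> f) G K"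
  unfolding graph_iso_def using bij_betw_trans by (fastforce simp: image_image image_comp)

lemma graph_iso_inv:
  assumes "finite_graph G" "graph_iso f G H"
  shows "graph_iso (inv_into (verts G) f) H G"
proof -
  let ?g = "inv_into (verts G) f"
  have inj: "inj_on f (verts G)" and im: "f ` verts G = verts H" and E: "edges H = (`) f ` edges G"
    using assms(2) by (auto simp: graph_iso_def bij_betw_def)
  have "?g ` f ` e = e" if "e \<in> edges G" for e
    using that assms(1) inj by (intro inv_into_image_cancel) (auto simp: finite_graph_def pairs_def)
  then have "(`) ?g ` edges H = edges G"
    by (simp add: E image_image)
  then show ?thesis
    using assms(2) by (simp add: graph_iso_def bij_betw_inv_into)
qed

lemma unlabeled_eq:
  assumes "finite_graph G" "graph_iso f G H"
  shows "unlabeled G = unlabeled H"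
proof -
  have "\<exists>g. graph_iso g H K" if "graph_iso h G K" for h and K :: "nat ugraph"
    using graph_iso_comp[OF graph_iso_inv[OF assms] that] by (rule exI[where P = "\<lambda>g. graph_iso g H K"])
  moreover have "\<exists>g. graph_iso g G K" if "graph_iso h H K" for h and K :: "nat ugraph"
    using graph_iso_comp[OF assms(2) that] by (rule exI[where P = "\<lambda>g. graph_iso g G K"])
  ultimately show ?thesis unfolding unlabeled_def by blast
qed

lemma ex_realization: "\<exists>rep pos. realization rep pos"
proof -
  let ?rep = "\<lambda>U. SOME G. G \<in> U"
  have "\<exists>f. graph_iso f G (?rep (unlabeled G))" for G
  proof -
    have "?rep (unlabeled G) \<in> unlabeled G"
      by (rule someI[of _ G]) (use graph_iso_refl[of G] in \<open>auto simp: unlabeled_def\<close>)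
    then show ?thesis by (simp add: unlabeled_def)
  qed
  then obtain pos where "\<And>G. graph_iso (pos G) G (?rep (unlabeled G))" by metis
  then have "realization ?rep pos" by (simp add: realization_def)
  then show ?thesis by blast
qed

lemma ex_component_rule: "\<exists>\<rho>. component_rule \<rho>"
proof -
  have "\<exists>k :: 'a set \<Rightarrow> nat. finite_graph R \<longrightarrow> inj_on k (graph_components R)" for R :: "'a ugraph"
    using finite_imp_inj_to_nat_seg[of "graph_components R"]
    by (auto simp: finite_graph_def graph_components_def quotient_def)
  then show ?thesis unfolding component_rule_def by metis
qed

lemma ex_vertex_rule: "\<exists>\<tau> :: nat ugraph \<Rightarrow> nat \<Rightarrow> nat. vertex_rule \<tau>"
proof -
  define c :: "nat ugraph \<Rightarrow> nat ugraph" where "c G = (SOME H. H \<in> unlabeled G)" for G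
  define P where "P G v m \<longleftrightarrow> (\<exists>f. graph_iso f G (c G) \<and> f v = m)" for G v m
  define orb where "orb G v = (LEAST m. P G v m)" for G v
  define before where "before G v w \<longleftrightarrow> orb G v < orb G w \<or> orb G v = orb G w \<and> v < w"
    for G and v w :: nat
  define \<tau> where "\<tau> G v = card {w \<in> verts G. before G w v}" for G v
  have c: "\<exists>f. graph_iso f G (c G)" for G
  proof -
    have "c G \<in> unlabeled G"
      unfolding c_def by (rule someI[of _ G]) (use graph_iso_refl[of G] in \<open>auto simp: unlabeled_def\<close>)
    then show ?thesis by (simp add: unlabeled_def)
  qed
  have orb: "P G v (orb G v)" for G v
  proof -
    have "\<exists>m. P G v m" using c[of G] by (auto simp: P_def)
    then show ?thesis unfolding orb_def by (rule LeastI_ex)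
  qed
  have mono: "\<tau> G v < \<tau> G w" if "finite_graph G" "before G v w" "v \<in> verts G" for G v w
  proof -
    have "{u \<in> verts G. before G u v} \<subseteq> {u \<in> verts G. before G u w}"
      using that(2) by (auto simp: before_def)
    moreover have "v \<in> {u \<in> verts G. before G u w} - {u \<in> verts G. before G u v}"
      using that(2,3) by (simp add: before_def)
    ultimately have "{u \<in> verts G. before G u v} \<subset> {u \<in> verts G. before G u w}" by blast
    then show ?thesis
      unfolding \<tau>_def using that(1) by (intro psubset_card_mono) (simp_all add: finite_graph_def)
  qed
  have lin: "before G v w \<or> v = w \<or> before G w v" for G v w
    by (auto simp: before_def)
  have \<tau>_less: "\<tau> G v < \<tau> G w \<longleftrightarrow> before G v w"
    if "finite_graph G" "v \<in> verts G" "w \<in> verts G" for G v w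
    using mono[OF that(1), of v w] mono[OF that(1), of w v] that lin[of G v w] by auto
  have orb_iso: "orb C' (f v) = orb C v"
    if fin: "finite_graph C" "finite_graph C'" and f: "graph_iso f C C'" and v: "v \<in> verts C" for C C' f v
  proof -
    have cc: "c C' = c C" using unlabeled_eq[OF fin(1) f] by (simp add: c_def)
    have "P C' (f v) m \<longleftrightarrow> P C v m" for m
    proof
      assume "P C' (f v) m"
      then obtain g where "graph_iso g C' (c C)" "g (f v) = m" by (auto simp: P_def cc)
      then show "P C v m"
        unfolding P_def using graph_iso_comp[OF f] by (intro exI[of _ "g \<circ> f"]) simp
    next
      assume "P C v m"
      then obtain g where g: "graph_iso g C (c C)" "g v = m" by (auto simp: P_def)
      have "inv_into (verts C) f (f v) = v"
        using f v by (auto simp: graph_iso_def bij_betw_def)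
      then show "P C' (f v) m"
        unfolding P_def cc using graph_iso_comp[OF graph_iso_inv[OF fin(1) f] g(1)] g(2)
        by (intro exI[of _ "g \<circ> inv_into (verts C) f"]) simp
    qed
    then show ?thesis by (simp add: orb_def)
  qed
  have exch: "\<exists>g. graph_iso g C C \<and> g v = w"
    if fin: "finite_graph C" and vw: "orb C v = orb C w" and w: "w \<in> verts C" for C v w
  proof -
    obtain f g where f: "graph_iso f C (c C)" "f v = orb C w"
      and g: "graph_iso g C (c C)" "g w = orb C w"
      using orb[of C v] orb[of C w] unfolding vw P_def by blast
    have "inv_into (verts C) g (f v) = w"
      using g w unfolding f(2) graph_iso_def bij_betw_def by (metis inv_into_f_f)
    then show ?thesis
      using graph_iso_comp[OF f(1) graph_iso_inv[OF fin g(1)]]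
      by (intro exI[of _ "inv_into (verts C) g \<circ> f"]) simp
  qed
  have "vertex_rule \<tau>"
    unfolding vertex_rule_def
  proof (intro conjI allI impI ballI)
    fix C :: "nat ugraph" assume "finite_graph C"
    then show "inj_on (\<tau> C) (verts C)"
      using mono[of C] lin by (intro inj_onI) (metis nat_neq_iff)
  next
    fix C C' :: "nat ugraph" and f v w
    assume fin: "finite_graph C" "finite_graph C'" and f: "graph_iso f C C'"
      and vw: "v \<in> verts C" "w \<in> verts C" and "\<tau> C v < \<tau> C w"
      and "\<not> (\<exists>g. graph_iso g C C \<and> g v = w)"
    then have "orb C v < orb C w"
      using exch[OF fin(1), of v w] \<tau>_less[OF fin(1) vw] by (auto simp: before_def)
    then have "before C' (f v) (f w)"
      using orb_iso[OF fin f] vw by (simp add: before_def)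
    moreover have "f v \<in> verts C'"
      using f vw by (auto simp: graph_iso_def bij_betw_def)
    ultimately show "\<tau> C' (f v) < \<tau> C' (f w)"
      by (rule mono[OF fin(2)])
  qed
  then show ?thesis by blast
qed

end

(* Percolating the tree cuts it into clusters, whose sizes follow Polya-type growth chains with
   exponent q. Conditionally on the clusters, the retained noise edges form a subcritical random
   graph between them: the mean of |cluster(v)| over v tends to 1 / (1 - 2 q), which times q lam is
   less than 1, and q < 1/3 makes the second moment of |cluster(v)| bounded. An exploration with
   exponential moments then shows that, for M large, no component of the part above M reaches size
   eta n^q, and that distinct clusters of low vertices stay disconnected. The root has two early
   children with eta n^q descendants each. Hence its component is larger than all components
   avoiding {1..M}; deleting the root separates two large pieces, while deleting a vertex v > M
   only detaches v and fewer than eta n^q vertices. So both rankings put at most M - 1 items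
   before the root. *)

theory Submission
  imports Defs "HOL-Real_Asymp.Real_Asymp"
begin

section \<open>Finitely supported distributions\<close>

text \<open>The clusters of early vertices reach order n^q, so an exponential moment of a cluster at
  a constant rate is out of reach. The rate used is of order ln n / n^q, just enough to beat a union
  bound over n vertices. It is affordable because descendant counts beyond M are at most a small
  multiple g of eta n^q, which caps the exponential weight at n^(q/2), while the third-order cluster
  sum is kept below n^(1 + q/4). Hence the lower bound for two early children, the upper bound for
  late vertices and the rate must be calibrated against each other. The third-order sum has a second
  task: it controls the fluctuations of the mean cluster size, which is needed as a constant
  strictly below criticality and not only on average. Percolating the union of tree and noise is
  almost a union of two independent percolations, except that a pair in both gets no second chance;
  requiring the conclusion for all graphs between the forest and the forest with noise absorbs this.
  Success of the algorithm is reduced to a deterministic, isomorphism-invariant certificate, so that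
  all probability is computed on the labeled graph.\<close>

lemma expectation_bind_finite:
  fixes h :: "'b \<Rightarrow> real"
  assumes "finite (set_pmf p)" "\<And>x. x \<in> set_pmf p \<Longrightarrow> finite (set_pmf (f x))"
  shows "measure_pmf.expectation (p \<bind> f) h =
    measure_pmf.expectation p (\<lambda>x. measure_pmf.expectation (f x) h)"
proof -
  \<comment> \<open>\<open>pmf_expectation_bind\<close> asks for a finite support at every argument,
    so off the support of \<open>p\<close> the kernel is replaced by a point mass.\<close>
  define g where "g x = (if x \<in> set_pmf p then f x else return_pmf undefined)" for x
  have "p \<bind> f = p \<bind> g"
    by (intro bind_pmf_cong) (auto simp: g_def)
  moreover have "measure_pmf.expectation (p \<bind> g) h =
      (\<Sum>a\<in>set_pmf p. pmf p a *\<^sub>R measure_pmf.expectation (g a) h)"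
    using assms by (intro pmf_expectation_bind) (auto simp: g_def)
  moreover have "measure_pmf.expectation p (\<lambda>x. measure_pmf.expectation (g x) h) =
      (\<Sum>a\<in>set_pmf p. pmf p a *\<^sub>R measure_pmf.expectation (g a) h)"
    using assms by (intro integral_measure_pmf[OF assms(1)]) auto
  moreover have "measure_pmf.expectation p (\<lambda>x. measure_pmf.expectation (g x) h) =
      measure_pmf.expectation p (\<lambda>x. measure_pmf.expectation (f x) h)"
    by (intro integral_cong_AE) (auto simp: AE_measure_pmf_iff g_def)
  ultimately show ?thesis by simp
qed

lemma expectation_mono_finite:
  fixes f g :: "'a \<Rightarrow> real"
  assumes "finite (set_pmf p)" "\<And>x. x \<in> set_pmf p \<Longrightarrow> f x \<le> g x"
  shows "measure_pmf.expectation p f \<le> measure_pmf.expectation p g"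
  using assms by (intro integral_mono_AE integrable_measure_pmf_finite) (auto simp: AE_measure_pmf_iff)

lemma expectation_add_finite:
  fixes f g :: "'a \<Rightarrow> real"
  assumes "finite (set_pmf p)"
  shows "measure_pmf.expectation p (\<lambda>x. f x + g x) =
    measure_pmf.expectation p f + measure_pmf.expectation p g"
  using assms by (intro Bochner_Integration.integral_add integrable_measure_pmf_finite)

lemma expectation_cong_pmf:
  fixes f g :: "'a \<Rightarrow> real"
  assumes "\<And>x. x \<in> set_pmf p \<Longrightarrow> f x = g x"
  shows "measure_pmf.expectation p f = measure_pmf.expectation p g"
  using assms by (intro integral_cong_AE) (auto simp: AE_measure_pmf_iff)

lemma prob_eq_expectation:
  "measure_pmf.prob p A = measure_pmf.expectation p (indicator A)"
  by simp

lemma prob_le_expectation: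
  fixes g :: "'a \<Rightarrow> real"
  assumes "finite (set_pmf p)" "\<And>x. x \<in> set_pmf p \<Longrightarrow> 0 \<le> g x"
    "\<And>x. x \<in> set_pmf p \<Longrightarrow> x \<in> A \<Longrightarrow> 1 \<le> g x"
  shows "measure_pmf.prob p A \<le> measure_pmf.expectation p g"
  unfolding prob_eq_expectation using assms
  by (intro expectation_mono_finite) (auto simp: indicator_def)

lemma prob_mono_pmf:
  assumes "\<And>x. x \<in> set_pmf p \<Longrightarrow> x \<in> A \<Longrightarrow> x \<in> B"
  shows "measure_pmf.prob p A \<le> measure_pmf.prob p B"
proof -
  have "measure_pmf.prob p A = measure_pmf.prob p (A \<inter> set_pmf p)"
    by (simp add: measure_Int_set_pmf)
  also have "\<dots> \<le> measure_pmf.prob p B"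
    using assms by (intro measure_pmf.finite_measure_mono) auto
  finally show ?thesis .
qed

lemma prob_cong_pmf:
  assumes "\<And>x. x \<in> set_pmf p \<Longrightarrow> x \<in> A \<longleftrightarrow> x \<in> B"
  shows "measure_pmf.prob p A = measure_pmf.prob p B"
  using assms by (intro antisym prob_mono_pmf) auto

section \<open>Random subsets\<close>

lemma random_subset_empty [simp]: "random_subset p {} = return_pmf {}"
  by (simp add: random_subset_def)

lemma random_subset_insert:
  assumes "finite A" "x \<notin> A"
  shows "random_subset p (insert x A) =
    bernoulli_pmf p \<bind> (\<lambda>b. random_subset p A \<bind> (\<lambda>S. return_pmf (if b then insert x S else S)))"
proof -
  have "{y. (y = x \<or> y \<in> A) \<and> (if y = x then b else f y)} =
      (if b then insert x {y \<in> A. f y} else {y \<in> A. f y})" for b f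
    using assms(2) by auto
  then show ?thesis
    using assms
    by (simp add: random_subset_def Pi_pmf_insert' map_bind_pmf bind_map_pmf map_pmf_def
        bind_assoc_pmf bind_return_pmf)
qed

lemma set_random_subset: "finite A \<Longrightarrow> set_pmf (random_subset p A) \<subseteq> Pow A"
  by (auto simp: random_subset_def)

lemma finite_set_random_subset [simp]:
  "finite A \<Longrightarrow> finite (set_pmf (random_subset p A))"
  using set_random_subset finite_Pow_iff finite_subset by metis

lemma expectation_random_subset_insert:
  fixes h :: "'a set \<Rightarrow> real"
  assumes "finite A" "x \<notin> A" "0 \<le> p" "p \<le> 1"
  shows "measure_pmf.expectation (random_subset p (insert x A)) h =
    p * measure_pmf.expectation (random_subset p A) (\<lambda>S. h (insert x S)) +
    (1 - p) * measure_pmf.expectation (random_subset p A) h"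
  using assms
  by (simp add: random_subset_insert expectation_bind_finite mult.commute)

lemma random_subset_inter:
  assumes "finite A" "B \<subseteq> A"
  shows "map_pmf (\<lambda>S. S \<inter> B) (random_subset p A) = random_subset p B"
  using assms unfolding random_subset_def
  by (subst Pi_pmf_subset[OF assms]) (auto simp: map_pmf_comp intro!: map_pmf_cong)

lemma random_subset_image:
  assumes "finite A" "inj_on h A"
  shows "random_subset p (h ` A) = map_pmf ((`) h) (random_subset p A)"
  using assms
proof (induction rule: finite_induct)
  case (insert x A)
  have "random_subset p (h ` insert x A) =
      bernoulli_pmf p \<bind> (\<lambda>b. random_subset p (h ` A) \<bind>
        (\<lambda>S. return_pmf (if b then insert (h x) S else S)))"
    using insert by (subst image_insert, subst random_subset_insert) auto
  also have "random_subset p (h ` A) = map_pmf ((`) h) (random_subset p A)"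
    using insert by auto
  finally show ?case
    using insert
    by (auto simp: random_subset_insert map_bind_pmf bind_map_pmf intro!: bind_pmf_cong)
qed simp

section \<open>Reachability\<close>

definition adj :: "'a set set \<Rightarrow> ('a \<times> 'a) set" where
  "adj E = {(a, b). {a, b} \<in> E}"

text \<open>Connectivity is phrased by edge sets and start sets instead of graphs, so that
  restrictions \<open>E \<inter> Pow X\<close> and unions with random edges need no bookkeeping of
  vertices; \<open>graph_components_reach\<close> leads back to components.\<close>

definition reach :: "'a set set \<Rightarrow> 'a set \<Rightarrow> 'a set" where
  "reach E W = (adj E)\<^sup>* `` W"

lemma adj_mono: "E \<subseteq> E' \<Longrightarrow> adj E \<subseteq> adj E'"
  by (auto simp: adj_def)

lemma reach_mono: "E \<subseteq> E' \<Longrightarrow> W \<subseteq> W' \<Longrightarrow> reach E W \<subseteq> reach E' W'"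
  unfolding reach_def using rtrancl_mono[OF adj_mono[of E E']] by blast

lemma reach_refl: "W \<subseteq> reach E W"
  unfolding reach_def by auto

lemma reach_self [simp]: "x \<in> reach E {x}"
  using reach_refl[of "{x}" E] by auto

lemma reach_step: "a \<in> reach E W \<Longrightarrow> {a, b} \<in> E \<Longrightarrow> b \<in> reach E W"
  unfolding reach_def adj_def by (auto intro: rtrancl_into_rtrancl)

lemma reach_least:
  assumes "W \<subseteq> X" "\<And>a b. a \<in> X \<Longrightarrow> {a, b} \<in> E \<Longrightarrow> b \<in> X"
  shows "reach E W \<subseteq> X"
proof
  fix y assume "y \<in> reach E W"
  then obtain w where "w \<in> W" "(w, y) \<in> (adj E)\<^sup>*" by (auto simp: reach_def)
  from this(2,1) show "y \<in> X"
    by (induction rule: rtrancl_induct) (use assms in \<open>auto simp: adj_def\<close>)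
qed

lemma reach_reach [simp]: "reach E (reach E W) = reach E W"
  by (intro equalityI reach_least reach_refl order_refl) (rule reach_step)

lemma reach_sym: "y \<in> reach E {x} \<Longrightarrow> x \<in> reach E {y}"
proof -
  have "sym (adj E)" by (auto simp: adj_def sym_def insert_commute)
  then show "y \<in> reach E {x} \<Longrightarrow> x \<in> reach E {y}"
    by (auto simp: reach_def dest: sym_rtrancl symD)
qed

lemma reach_trans: "y \<in> reach E {x} \<Longrightarrow> z \<in> reach E {y} \<Longrightarrow> z \<in> reach E {x}"
  by (auto simp: reach_def)

lemma reach_eq: "y \<in> reach E {x} \<Longrightarrow> reach E {y} = reach E {x}"
  using reach_sym reach_trans by (metis subsetI subset_antisym)

lemma reach_Un: "reach E (A \<union> B) = reach E A \<union> reach E B"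
  by (auto simp: reach_def)

lemma reach_UN: "y \<in> reach E W \<longleftrightarrow> (\<exists>w\<in>W. y \<in> reach E {w})"
  by (auto simp: reach_def)

lemma reach_subset:
  assumes "E \<subseteq> pairs V" "W \<subseteq> V"
  shows "reach E W \<subseteq> V"
  using assms by (intro reach_least) (auto simp: pairs_def)

lemma pairs_mono: "V \<subseteq> W \<Longrightarrow> pairs V \<subseteq> pairs W"
  by (auto simp: pairs_def)

lemma finite_pairs [simp]: "finite V \<Longrightarrow> finite (pairs V)"
  by (rule finite_subset[of _ "Pow V"]) (auto simp: pairs_def)

section \<open>Exploration of a forest with added random edges\<close>

text \<open>The exponent is a supermartingale for the exploration that queries one boundary pair at a
  time: an absent edge removes the term of the pair, and a present one trades it for the new
  cluster and its boundary, which the assumption on \<open>h\<close> pays for.\<close>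

lemma exploration_aux:
  fixes A Q :: "'a set set" and th :: "'a \<Rightarrow> real" and p h :: real
  defines "g \<equiv> \<lambda>u. exp (sum th (reach A {u}) + h * real (card (reach A {u}))) - 1"
  assumes V: "finite V" "A \<subseteq> pairs V" and p: "0 \<le> p" "p \<le> 1" and h: "0 \<le> h"
    and th: "\<And>x. 0 \<le> th x"
    and H: "p * (\<Sum>u\<in>V. g u) \<le> h"
    and Q: "Q \<subseteq> pairs V" and W: "W \<subseteq> V" "reach A W = W"
  shows "measure_pmf.expectation (random_subset p Q) (\<lambda>S. exp (sum th (reach (A \<union> S) W)))
    \<le> exp (sum th W + p * (\<Sum>(v, u)\<in>{(v, u). v \<in> W \<and> u \<in> V - W \<and> {v, u} \<in> Q}. g u))"
proof -
  have g0: "0 \<le> g u" for u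
    unfolding g_def using h th by (simp add: sum_nonneg)
  \<comment> \<open>Pairs still to be queried, oriented outwards from the explored set. Each of them
    owes \<open>g u\<close>, the price of absorbing the whole \<open>A\<close>-cluster of
    \<open>u\<close>.\<close>
  define Bd where "Bd W Q = {(v, u). v \<in> W \<and> u \<in> V - W \<and> {v, u} \<in> Q}" for W :: "'a set" and Q
  have finBd: "finite (Bd W Q)" if "W \<subseteq> V" for W Q
    using that V(1) by (intro finite_subset[of "Bd W Q" "V \<times> V"]) (auto simp: Bd_def)
  have "measure_pmf.expectation (random_subset p Q) (\<lambda>S. exp (sum th (reach (A \<union> S) W)))
    \<le> exp (sum th W + p * (\<Sum>(v, u)\<in>Bd W Q. g u))"
    using Q W
  \<comment> \<open>\<open>W\<close> is generalized too: a query always shrinks \<open>Q\<close>,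
    and when the pair is present it also enlarges the explored set.\<close>
  proof (induction "card Q" arbitrary: Q W rule: less_induct)
    case less
    note Q = less.prems(1) and W = less.prems(2,3)
    have finQ: "finite Q" using Q V(1) finite_subset finite_pairs by blast
    have finW: "finite W" using W(1) V(1) finite_subset by blast
    show ?case
    proof (cases "Bd W Q = {}")
      case True
      have "reach (A \<union> S) W \<subseteq> W" if "S \<subseteq> Q" for S
      proof (rule reach_least[OF order_refl])
        fix a b assume ab: "a \<in> W" "{a, b} \<in> A \<union> S"
        show "b \<in> W"
        proof (cases "{a, b} \<in> A")
          case True
          then have "b \<in> reach A W" using ab(1) reach_refl[of W A] by (metis reach_step[of a] subsetD)
          then show ?thesis using W(2) by simp
        next
          case False
          then have "{a, b} \<in> Q" using ab that by auto
          moreover have "b \<in> V" using \<open>{a, b} \<in> Q\<close> Q by (auto simp: pairs_def)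
          ultimately show ?thesis using True ab(1) by (auto simp: Bd_def)
        qed
      qed
      then have "reach (A \<union> S) W = W" if "S \<subseteq> Q" for S
        using that by (intro equalityI reach_refl)
      then have "measure_pmf.expectation (random_subset p Q) (\<lambda>S. exp (sum th (reach (A \<union> S) W)))
        = measure_pmf.expectation (random_subset p Q) (\<lambda>S. exp (sum th W))"
        using set_random_subset[OF finQ, of p] by (intro expectation_cong_pmf) (metis PowD subsetD)
      then show ?thesis using True by simp
    next
      case False
      then obtain v u where vu: "v \<in> W" "u \<in> V" "u \<notin> W" "{v, u} \<in> Q"
        by (auto simp: Bd_def)
      define e where "e = {v, u}"
      define Q' where "Q' = Q - {e}"
      define c where "c = reach A {u}"
      define W' where "W' = W \<union> c"
      have Qe: "Q = insert e Q'" "e \<notin> Q'" using vu by (auto simp: Q'_def e_def)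
      have finQ': "finite Q'" using finQ by (simp add: Q'_def)
      have cV: "c \<subseteq> V" unfolding c_def using V(2) vu by (intro reach_subset) auto
      have finc: "finite c" using cV V(1) finite_subset by blast
      have disj: "W \<inter> c = {}"
      proof (rule ccontr)
        assume "W \<inter> c \<noteq> {}"
        then obtain x where "x \<in> W" "x \<in> reach A {u}" by (auto simp: c_def)
        then have "u \<in> reach A W" using reach_sym[of x A u] reach_UN[of u A W] by auto
        then show False using W(2) vu by simp
      qed
      have cardQ': "card Q' < card Q" using Qe finQ' by simp
      have W': "W' \<subseteq> V" "reach A W' = W'"
        using W cV by (auto simp: W'_def reach_Un c_def)
      have IH1: "measure_pmf.expectation (random_subset p Q') (\<lambda>S. exp (sum th (reach (A \<union> S) W)))
          \<le> exp (sum th W + p * (\<Sum>(v, u)\<in>Bd W Q'. g u))"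
        using less.hyps[OF cardQ'] Q Qe W by auto
      have IH2: "measure_pmf.expectation (random_subset p Q') (\<lambda>S. exp (sum th (reach (A \<union> S) W')))
          \<le> exp (sum th W' + p * (\<Sum>(v, u)\<in>Bd W' Q'. g u))"
        using less.hyps[OF cardQ'] Q Qe W' by auto
      have re: "reach (A \<union> insert e S) W = reach (A \<union> S) W'" for S
      proof (intro equalityI)
        show "reach (A \<union> insert e S) W \<subseteq> reach (A \<union> S) W'"
        proof (rule reach_least)
          show "W \<subseteq> reach (A \<union> S) W'" using reach_refl[of W' "A \<union> S"] by (auto simp: W'_def)
          fix a b assume ab: "a \<in> reach (A \<union> S) W'" "{a, b} \<in> A \<union> insert e S"
          show "b \<in> reach (A \<union> S) W'"
          proof (cases "{a, b} = e")
            case True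
            then have "b \<in> {v, u}" unfolding e_def by blast
            then have "b \<in> W'" using vu by (auto simp: W'_def c_def)
            then show ?thesis using reach_refl[of W' "A \<union> S"] by blast
          next
            case False
            then have "{a, b} \<in> A \<union> S" using ab(2) by auto
            then show ?thesis by (rule reach_step[OF ab(1)])
          qed
        qed
        have u: "u \<in> reach (A \<union> insert e S) W"
        proof (rule reach_step)
          show "v \<in> reach (A \<union> insert e S) W" using vu(1) reach_refl[of W] by (rule subsetD[rotated])
        qed (simp add: e_def)
        have "c \<subseteq> reach (A \<union> insert e S) (reach (A \<union> insert e S) W)"
          unfolding c_def using u by (intro reach_mono) auto
        then have "W' \<subseteq> reach (A \<union> insert e S) W"
          using reach_refl[of W] unfolding W'_def by auto
        then have "reach (A \<union> S) W' \<subseteq> reach (A \<union> insert e S) (reach (A \<union> insert e S) W)"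
          by (intro reach_mono) auto
        then show "reach (A \<union> S) W' \<subseteq> reach (A \<union> insert e S) W" by simp
      qed
      have BdW: "Bd W Q = insert (v, u) (Bd W Q')"
        using vu Qe by (auto simp: Bd_def e_def doubleton_eq_iff)
      have notin: "(v, u) \<notin> Bd W Q'" using Qe by (auto simp: Bd_def e_def)
      let ?b = "\<Sum>(v, u)\<in>Bd W Q'. g u"
      have bW: "(\<Sum>(v, u)\<in>Bd W Q. g u) = g u + ?b"
        using notin finBd[OF W(1)] by (simp add: BdW)
      \<comment> \<open>New boundary pairs start in the absorbed cluster \<open>c\<close>. Counting
        all of \<open>c \<times> V\<close> turns their debt into \<open>card c\<close> times the sum
        in \<open>H\<close>, that is, at most \<open>h\<close> per new vertex; \<open>g u\<close>
        contains exactly this term.\<close>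
      have "(\<Sum>(v, u)\<in>Bd W' Q'. g u) \<le> (\<Sum>(v, u)\<in>Bd W Q' \<union> c \<times> V. g u)"
        using finBd[OF W(1)] finc V(1) g0
        by (intro sum_mono2) (auto simp: Bd_def W'_def)
      also have "\<dots> \<le> ?b + (\<Sum>(v, u)\<in>c \<times> V. g u)"
        using finBd[OF W(1)] finc V(1) g0 by (subst sum.union_inter[symmetric])
          (auto intro!: sum_nonneg)
      also have "(\<Sum>(v, u)\<in>c \<times> V. g u) = real (card c) * (\<Sum>u\<in>V. g u)"
        by (simp add: sum.cartesian_product[symmetric])
      finally have "p * (\<Sum>(v, u)\<in>Bd W' Q'. g u) \<le> p * (?b + real (card c) * (\<Sum>u\<in>V. g u))"
        using p(1) by (intro mult_left_mono)
      also have "\<dots> = p * ?b + real (card c) * (p * (\<Sum>u\<in>V. g u))"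
        by (simp add: algebra_simps)
      also have "\<dots> \<le> p * ?b + real (card c) * h"
        using H by (intro add_left_mono mult_left_mono) auto
      finally have b': "p * (\<Sum>(v, u)\<in>Bd W' Q'. g u) \<le> p * ?b + real (card c) * h" .
      have thW': "sum th W' = sum th W + sum th c"
        unfolding W'_def using finW finc disj by (rule sum.union_disjoint)
      have gu: "exp (sum th c + h * real (card c)) = 1 + g u"
        by (simp add: g_def c_def)
      have "exp (sum th W' + p * (\<Sum>(v, u)\<in>Bd W' Q'. g u))
          \<le> exp ((sum th W + p * ?b) + (sum th c + h * real (card c)))"
        using b' by (simp add: thW' mult.commute)
      also have "\<dots> = exp (sum th W + p * ?b) * (1 + g u)"
        by (simp add: exp_add[of "sum th W + p * ?b"] gu)
      finally have e2: "exp (sum th W' + p * (\<Sum>(v, u)\<in>Bd W' Q'. g u))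
        \<le> exp (sum th W + p * ?b) * (1 + g u)" .
      have "measure_pmf.expectation (random_subset p Q) (\<lambda>S. exp (sum th (reach (A \<union> S) W)))
        = p * measure_pmf.expectation (random_subset p Q') (\<lambda>S. exp (sum th (reach (A \<union> S) W')))
        + (1 - p) * measure_pmf.expectation (random_subset p Q') (\<lambda>S. exp (sum th (reach (A \<union> S) W)))"
        unfolding Qe(1) using expectation_random_subset_insert[OF finQ' Qe(2) p] re by simp
      also have "\<dots> \<le> p * (exp (sum th W + p * ?b) * (1 + g u)) + (1 - p) * exp (sum th W + p * ?b)"
        using p IH1 IH2 e2 by (intro add_mono mult_left_mono) auto
      also have "\<dots> = exp (sum th W + p * ?b) * (1 + p * g u)"
        by (simp add: algebra_simps)
      also have "\<dots> \<le> exp (sum th W + p * ?b) * exp (p * g u)"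
        by (intro mult_left_mono exp_ge_add_one_self) auto
      also have "\<dots> = exp (sum th W + p * (\<Sum>(v, u)\<in>Bd W Q. g u))"
        unfolding bW by (simp add: exp_add[symmetric] algebra_simps)
      finally show ?thesis .
    qed
  qed
  then show ?thesis by (simp add: Bd_def)
qed

text \<open>The exploration starts from the whole cluster of \<open>x\<close>, whose initial
  boundary is charged \<open>h\<close> per vertex like that of every later cluster. The hypothesis
  \<open>H\<close> expresses subcriticality: the budget \<open>h\<close> pays for all offspring of a
  vertex, including the budgets of the offspring.\<close>

lemma exploration:
  fixes A Q :: "'a set set" and th :: "'a \<Rightarrow> real" and p h :: real
  assumes V: "finite V" "A \<subseteq> pairs V" and p: "0 \<le> p" "p \<le> 1" and h: "0 \<le> h"
    and th: "\<And>x. 0 \<le> th x"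
    and H: "p * (\<Sum>u\<in>V. exp (sum th (reach A {u}) + h * real (card (reach A {u}))) - 1) \<le> h"
    and Q: "Q \<subseteq> pairs V" and x: "x \<in> V"
  shows "measure_pmf.expectation (random_subset p Q) (\<lambda>S. exp (sum th (reach (A \<union> S) {x})))
    \<le> exp (sum th (reach A {x}) + h * real (card (reach A {x})))"
proof -
  define g where "g u = exp (sum th (reach A {u}) + h * real (card (reach A {u}))) - 1" for u
  let ?W = "reach A {x}"
  let ?B = "{(v, u). v \<in> ?W \<and> u \<in> V - ?W \<and> {v, u} \<in> Q}"
  have g0: "0 \<le> g u" for u
    unfolding g_def using h th by (simp add: sum_nonneg)
  have WV: "?W \<subseteq> V" using V(2) x by (intro reach_subset) auto
  have "reach (A \<union> S) ?W = reach (A \<union> S) {x}" for S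
  proof (intro equalityI)
    have "reach (A \<union> S) ?W \<subseteq> reach (A \<union> S) (reach (A \<union> S) {x})"
      by (intro reach_mono) auto
    then show "reach (A \<union> S) ?W \<subseteq> reach (A \<union> S) {x}" by simp
  qed (intro reach_mono, auto)
  then have E: "measure_pmf.expectation (random_subset p Q) (\<lambda>S. exp (sum th (reach (A \<union> S) {x})))
    \<le> exp (sum th ?W + p * (\<Sum>(v, u)\<in>?B. g u))"
    using exploration_aux[OF V p h th H Q WV] by (simp add: g_def)
  have "(\<Sum>(v, u)\<in>?B. g u) \<le> (\<Sum>(v, u)\<in>?W \<times> V. g u)"
    using V(1) finite_subset[OF WV] g0 by (intro sum_mono2) auto
  also have "\<dots> = real (card ?W) * (\<Sum>u\<in>V. g u)"
    by (simp add: sum.cartesian_product[symmetric])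
  finally have "p * (\<Sum>(v, u)\<in>?B. g u) \<le> p * (real (card ?W) * (\<Sum>u\<in>V. g u))"
    using p(1) by (rule mult_left_mono)
  also have "\<dots> = (p * (\<Sum>u\<in>V. g u)) * real (card ?W)"
    by simp
  also have "\<dots> \<le> h * real (card ?W)"
    using H by (intro mult_right_mono) (auto simp: g_def)
  finally have "exp (sum th ?W + p * (\<Sum>(v, u)\<in>?B. g u)) \<le> exp (sum th ?W + h * real (card ?W))"
    by simp
  with E show ?thesis by (rule order_trans)
qed

section \<open>Retained forests\<close>

text \<open>A retained forest is encoded by its parent function: \<open>f m = 0\<close> means that \<open>m\<close> has no
  retained edge to an earlier vertex.\<close>

definition forest :: "real \<Rightarrow> nat \<Rightarrow> (nat \<Rightarrow> nat) pmf" where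
  "forest q n = Pi_pmf {2..n} 0
     (\<lambda>m. bernoulli_pmf q \<bind> (\<lambda>b. if b then pmf_of_set {1..<m} else return_pmf 0))"

text \<open>The subtraction is truncated, so \<open>f 0 = 0\<close> and \<open>f 1 = 0\<close> are
  included; vertex 1 is always a root.\<close>

definition forest_fun :: "nat \<Rightarrow> (nat \<Rightarrow> nat) \<Rightarrow> bool" where
  "forest_fun n f \<longleftrightarrow> (\<forall>m. f m \<le> m - 1) \<and> (\<forall>m>n. f m = 0)"

lemma forest_fun_less: "forest_fun n f \<Longrightarrow> 0 < f m \<Longrightarrow> f m < m"
  unfolding forest_fun_def by (metis diff_le_self le_0_eq le_neq_implies_less less_numeral_extra(3)
      diff_less less_le_trans zero_less_one not_gr_zero le_less_trans)

lemma set_forest: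
  assumes "f \<in> set_pmf (forest q n)"
  shows "forest_fun n f"
proof -
  have f: "f \<in> PiE_dflt {2..n} 0
      (set_pmf \<circ> (\<lambda>m. bernoulli_pmf q \<bind> (\<lambda>b. if b then pmf_of_set {1..<m} else return_pmf 0)))"
    using assms by (simp add: forest_def set_Pi_pmf)
  have "f m \<le> m - 1" for m
  proof (cases "m \<in> {2..n}")
    case True
    then have "f m \<in> insert 0 {1..<m}"
      using f by (auto simp: PiE_dflt_def split: if_splits)
    then show ?thesis by auto
  next
    case False
    then show ?thesis using f by (simp add: PiE_dflt_def)
  qed
  then show ?thesis using f by (auto simp: forest_fun_def PiE_dflt_def)
qed

lemma finite_set_forest [simp]: "finite (set_pmf (forest q n))"
proof (rule finite_subset)
  show "set_pmf (forest q n) \<subseteq> PiE_dflt {2..n} 0 (\<lambda>m. {..m})"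
    using set_forest[of _ q n] unfolding forest_fun_def PiE_dflt_def
    by (auto simp: forest_def set_Pi_pmf PiE_dflt_def intro: le_trans)
qed (intro finite_PiE_dflt, auto)

lemma forest_1: "forest q (Suc 0) = return_pmf (\<lambda>_. 0)"
  by (simp add: forest_def)

lemma forest_fun_Suc0: "forest_fun n f \<Longrightarrow> f (Suc n) = 0"
  by (simp add: forest_fun_def)

text \<open>The one-step recursion behind all moment computations. The default value 0 coincides
  with the code for an unretained edge, so in that case \<open>f\<close> itself is
  unchanged.\<close>

lemma expectation_forest_Suc:
  fixes \<phi> :: "(nat \<Rightarrow> nat) \<Rightarrow> real"
  assumes "1 \<le> n" "0 \<le> q" "q \<le> 1"
  shows "measure_pmf.expectation (forest q (Suc n)) \<phi> =
    measure_pmf.expectation (forest q n)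
      (\<lambda>f. (1 - q) * \<phi> f + q / n * (\<Sum>i\<in>{1..n}. \<phi> (f(Suc n := i))))"
proof -
  let ?K = "\<lambda>m. bernoulli_pmf q \<bind> (\<lambda>b. if b then pmf_of_set {1..<m} else return_pmf (0::nat))"
  have ins: "{2..Suc n} = insert (Suc n) {2..n}" using assms(1) by auto
  have "forest q (Suc n) = forest q n \<bind> (\<lambda>f. ?K (Suc n) \<bind> (\<lambda>y. return_pmf (f(Suc n := y))))"
    unfolding forest_def ins
    by (subst Pi_pmf_insert') (auto intro: bind_commute_pmf)
  also have "measure_pmf.expectation \<dots> \<phi> =
    measure_pmf.expectation (forest q n)
      (\<lambda>f. measure_pmf.expectation (?K (Suc n) \<bind> (\<lambda>y. return_pmf (f(Suc n := y)))) \<phi>)"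
    using assms(1) by (intro expectation_bind_finite) auto
  also have "\<dots> = measure_pmf.expectation (forest q n)
      (\<lambda>f. (1 - q) * \<phi> f + q / n * (\<Sum>i\<in>{1..n}. \<phi> (f(Suc n := i))))"
  proof (intro expectation_cong_pmf)
    fix f assume "f \<in> set_pmf (forest q n)"
    then have f0: "f(Suc n := 0) = f" using set_forest forest_fun_Suc0 by fastforce
    have "measure_pmf.expectation (?K (Suc n) \<bind> (\<lambda>y. return_pmf (f(Suc n := y)))) \<phi>
      = measure_pmf.expectation (?K (Suc n)) (\<lambda>y. \<phi> (f(Suc n := y)))"
      using assms(1) by (subst expectation_bind_finite) auto
    also have "\<dots> = q * measure_pmf.expectation (pmf_of_set {1..<Suc n}) (\<lambda>y. \<phi> (f(Suc n := y)))
        + (1 - q) * \<phi> f"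
      using assms f0 by (subst expectation_bind_finite) (auto simp: mult.commute)
    also have "measure_pmf.expectation (pmf_of_set {1..<Suc n}) (\<lambda>y. \<phi> (f(Suc n := y))) =
        (\<Sum>i\<in>{1..n}. \<phi> (f(Suc n := i))) / n"
      using assms(1) by (subst integral_pmf_of_set) (auto simp: atLeastLessThanSuc_atLeastAtMost)
    finally have E: "measure_pmf.expectation (?K (Suc n) \<bind> (\<lambda>y. return_pmf (f(Suc n := y)))) \<phi>
      = q * ((\<Sum>i\<in>{1..n}. \<phi> (f(Suc n := i))) / n) + (1 - q) * \<phi> f" .
    show "measure_pmf.expectation (?K (Suc n) \<bind> (\<lambda>y. return_pmf (f(Suc n := y)))) \<phi>
      = (1 - q) * \<phi> f + q / n * (\<Sum>i\<in>{1..n}. \<phi> (f(Suc n := i)))"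
      unfolding E by simp
  qed
  finally show ?thesis .
qed

text \<open>Consistency of the growth process: events decided by time \<open>b\<close> may be
  evaluated at time \<open>b\<close>.\<close>

lemma expectation_forest_stable:
  fixes \<phi> :: "(nat \<Rightarrow> nat) \<Rightarrow> real"
  assumes "1 \<le> b" "b \<le> n" "0 \<le> q" "q \<le> 1"
    and st: "\<And>f j i. b \<le> j \<Longrightarrow> \<phi> (f(Suc j := i)) = \<phi> f"
  shows "measure_pmf.expectation (forest q n) \<phi> = measure_pmf.expectation (forest q b) \<phi>"
  using assms(2)
proof (induction n rule: dec_induct)
  case (step n)
  have "(1 - q) * \<phi> f + q / n * (\<Sum>i\<in>{1..n}. \<phi> (f(Suc n := i))) = \<phi> f" for f
    using st[of n f] step assms(1) by (simp add: algebra_simps)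
  then show ?case
    using expectation_forest_Suc[of n q \<phi>] step assms by simp
qed simp

section \<open>Ancestors and descendants\<close>

text \<open>The guard \<open>f x < x\<close> makes the recursion terminate for arbitrary
  \<open>f\<close>; on a \<open>forest_fun\<close> it follows from \<open>0 < f x\<close>.\<close>

function anc :: "(nat \<Rightarrow> nat) \<Rightarrow> nat \<Rightarrow> nat set" where
  "anc f x = (if 0 < f x \<and> f x < x then insert x (anc f (f x)) else {x})"
  by auto
termination by (relation "Wellfounded.measure snd") auto

declare anc.simps [simp del]

definition desc :: "(nat \<Rightarrow> nat) \<Rightarrow> nat \<Rightarrow> nat \<Rightarrow> nat set" where
  "desc f n m = {x \<in> {1..n}. m \<in> anc f x}"

definition descs :: "(nat \<Rightarrow> nat) \<Rightarrow> nat \<Rightarrow> nat \<Rightarrow> nat" where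
  "descs f n m = card (desc f n m)"

lemma anc_self [simp]: "x \<in> anc f x"
  by (subst anc.simps) auto

lemma anc_le: "m \<in> anc f x \<Longrightarrow> m \<le> x"
  by (induction f x rule: anc.induct) (subst (asm) (2) anc.simps, force split: if_splits)

lemma finite_anc [simp]: "finite (anc f x)"
  by (rule finite_subset[of _ "{..x}"]) (auto dest: anc_le)

lemma anc_cong: "(\<And>y. y \<le> x \<Longrightarrow> f y = g y) \<Longrightarrow> anc f x = anc g x"
proof (induction f x rule: anc.induct)
  case (1 f x)
  show ?case
  proof (cases "0 < f x \<and> f x < x")
    case True
    then have "anc f (f x) = anc g (f x)" using 1 by auto
    then show ?thesis using 1(2)[of x] True by (simp add: anc.simps[of f x] anc.simps[of g x])
  next
    case False
    then have "anc f x = {x}" by (subst anc.simps) (rule if_not_P)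
    moreover have "\<not> (0 < g x \<and> g x < x)" using False 1(2)[of x] by simp
    then have "anc g x = {x}" by (subst anc.simps) (rule if_not_P)
    ultimately show ?thesis by simp
  qed
qed

lemma anc_upd_le: "x \<le> n \<Longrightarrow> anc (f(Suc n := i)) x = anc f x"
  by (rule anc_cong) auto

lemma anc_upd_Suc:
  "1 \<le> i \<Longrightarrow> i \<le> n \<Longrightarrow> anc (f(Suc n := i)) (Suc n) = insert (Suc n) (anc f i)"
  by (subst anc.simps) (simp add: anc_upd_le)

lemma anc_root: "f x = 0 \<Longrightarrow> anc f x = {x}"
  by (subst anc.simps) simp

lemma anc_step: "0 < f x \<Longrightarrow> f x < x \<Longrightarrow> anc f x = insert x (anc f (f x))"
  by (subst anc.simps) simp

lemma finite_desc [simp]: "finite (desc f n m)"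
  by (simp add: desc_def)

lemma descs_upd:
  assumes "1 \<le> m" "m \<le> n" "1 \<le> i" "i \<le> n"
  shows "descs (f(Suc n := i)) (Suc n) m = descs f n m + (if i \<in> desc f n m then 1 else 0)"
proof -
  have "desc (f(Suc n := i)) (Suc n) m =
      (if i \<in> desc f n m then insert (Suc n) (desc f n m) else desc f n m)"
    using assms by (auto simp: desc_def anc_upd_Suc anc_upd_le le_Suc_eq)
  moreover have "Suc n \<notin> desc f n m" by (simp add: desc_def)
  ultimately show ?thesis by (simp add: descs_def)
qed

lemma descs_Suc_same:
  assumes "m \<le> n" "f (Suc n) = 0"
  shows "descs f (Suc n) m = descs f n m"
proof -
  have "desc f (Suc n) m = desc f n m"
    using assms by (auto simp: desc_def anc_root le_Suc_eq)
  then show ?thesis by (simp add: descs_def)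
qed

lemma descs_self: "1 \<le> m \<Longrightarrow> descs f m m = 1"
proof -
  assume "1 \<le> m"
  then have "desc f m m = {m}" by (auto simp: desc_def dest: anc_le)
  then show ?thesis by (simp add: descs_def)
qed

lemma descs_pos: "1 \<le> m \<Longrightarrow> m \<le> n \<Longrightarrow> 1 \<le> descs f n m"
  unfolding descs_def using card_gt_0_iff[of "desc f n m"] by (auto simp: desc_def Suc_le_eq)

lemma descs_upd_stable: "b \<le> j \<Longrightarrow> descs (f(Suc j := i)) b m = descs f b m"
  unfolding descs_def desc_def by (rule arg_cong[of _ _ card]) (auto simp: anc_upd_le)

section \<open>Growth of the number of descendants\<close>

text \<open>The generator of the growth chain: from \<open>D\<close> to \<open>D + 1\<close> with
  conditional probability \<open>q * D / n\<close>. The factor \<open>\<zeta>\<close> carries an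
  event of the past, which \<open>expectation_inverse_descs\<close> needs.\<close>

lemma expectation_descs_Suc:
  fixes \<phi> :: "nat \<Rightarrow> real" and \<zeta> :: "(nat \<Rightarrow> nat) \<Rightarrow> real"
  assumes m: "1 \<le> m" "m \<le> n" and q: "0 \<le> q" "q \<le> 1"
    and st: "\<And>f i. \<zeta> (f(Suc n := i)) = \<zeta> f"
  shows "measure_pmf.expectation (forest q (Suc n)) (\<lambda>f. \<zeta> f * \<phi> (descs f (Suc n) m)) =
    measure_pmf.expectation (forest q n) (\<lambda>f. \<zeta> f *
      (\<phi> (descs f n m) + q * descs f n m / n * (\<phi> (descs f n m + 1) - \<phi> (descs f n m))))"
proof -
  have "(1 - q) * (\<zeta> f * \<phi> (descs f (Suc n) m)) + q / n *
      (\<Sum>i\<in>{1..n}. \<zeta> (f(Suc n := i)) * \<phi> (descs (f(Suc n := i)) (Suc n) m)) =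
      \<zeta> f * (\<phi> (descs f n m) + q * descs f n m / n * (\<phi> (descs f n m + 1) - \<phi> (descs f n m)))"
    if "f \<in> set_pmf (forest q n)" for f
  proof -
    let ?D = "descs f n m"
    have 0: "descs f (Suc n) m = ?D"
      using descs_Suc_same[OF m(2)] forest_fun_Suc0 set_forest that by blast
    have "(\<Sum>i\<in>{1..n}. \<phi> (descs (f(Suc n := i)) (Suc n) m)) =
        (\<Sum>i\<in>{1..n}. \<phi> ?D + (if i \<in> desc f n m then \<phi> (?D + 1) - \<phi> ?D else 0))"
      using m by (intro sum.cong) (auto simp: descs_upd)
    also have "\<dots> = n * \<phi> ?D + (\<Sum>i\<in>{1..n} \<inter> desc f n m. \<phi> (?D + 1) - \<phi> ?D)"
      by (simp add: sum.distrib sum.If_cases)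
    also have "{1..n} \<inter> desc f n m = desc f n m" by (auto simp: desc_def)
    also have "(\<Sum>i\<in>desc f n m. \<phi> (?D + 1) - \<phi> ?D) = ?D * (\<phi> (?D + 1) - \<phi> ?D)"
      by (simp add: descs_def)
    finally have S: "(\<Sum>i\<in>{1..n}. \<phi> (descs (f(Suc n := i)) (Suc n) m)) =
        n * \<phi> ?D + ?D * (\<phi> (?D + 1) - \<phi> ?D)" .
    have "q / n * (n * \<phi> ?D + ?D * (\<phi> (?D + 1) - \<phi> ?D)) =
        q * \<phi> ?D + q * ?D / n * (\<phi> (?D + 1) - \<phi> ?D)"
      using m by (simp add: field_simps)
    then show ?thesis
      unfolding st 0 sum_distrib_left[symmetric] S using m by (simp add: algebra_simps)
  qed
  then show ?thesis
    using m q by (subst expectation_forest_Suc) (auto intro!: expectation_cong_pmf)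
qed

text \<open>Compares a recursion with factor \<open>1 + a / n\<close> to the growth of
  \<open>n powr a\<close>. This direction relies on \<open>1 \<le> a\<close>, the origin of the
  condition \<open>1 \<le> q * real k\<close> in the moment bounds.\<close>

lemma powr_step_ge:
  fixes a :: real
  assumes "1 \<le> a" "1 \<le> n" and c: "0 < c"
  shows "(1 + a / real n) * (real n / c) powr a \<le> (real (Suc n) / c) powr a"
proof -
  \<comment> \<open>Weighted AM-GM with weights \<open>1 / a\<close> and \<open>1 - 1 / a\<close>;
    raised to the power \<open>a\<close> it is Bernoulli's inequality for a real exponent.\<close>
  have "(1 + a / real n) powr (1 / a) * 1 powr (1 - 1 / a) \<le> 1 / a * (1 + a / real n) + (1 - 1 / a) * 1"
    using assms by (intro Youngs_inequality_0) (auto simp: add_pos_nonneg)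
  also have "\<dots> = 1 + 1 / real n" using assms by (simp add: field_simps)
  finally have "((1 + a / real n) powr (1 / a)) powr a \<le> (1 + 1 / real n) powr a"
    using assms by (intro powr_mono2) auto
  then have "1 + a / real n \<le> (1 + 1 / real n) powr a"
    using assms by (simp add: powr_powr add_pos_nonneg)
  then have "(1 + a / real n) * (real n / c) powr a \<le> (1 + 1 / real n) powr a * (real n / c) powr a"
    by (intro mult_right_mono) auto
  also have "\<dots> = ((1 + 1 / real n) * (real n / c)) powr a"
    using c by (subst powr_mult) auto
  also have "(1 + 1 / real n) * (real n / c) = real (Suc n) / c"
    using assms by (simp add: field_simps)
  finally show ?thesis .
qed

text \<open>The counterpart for decay with factor \<open>1 - q / n\<close>: the product with
  \<open>(1 + 1 / n) powr q\<close> is at most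
  \<open>exp (- q / n) * exp (q / n) = 1\<close>.\<close>

lemma powr_step_le:
  fixes q :: real
  assumes "0 \<le> q" "q \<le> 1" "1 \<le> n" and c: "0 < c"
  shows "(1 - q / real n) * (c / real n) powr q \<le> (c / real (Suc n)) powr q"
proof -
  have "(1 + 1 / real n) powr q \<le> exp (1 / real n) powr q"
    using assms exp_ge_add_one_self[of "1 / real n"] by (intro powr_mono2) auto
  also have "\<dots> = exp (q / real n)" by (simp add: powr_def)
  finally have 1: "(1 + 1 / real n) powr q \<le> exp (q / real n)" .
  have 2: "1 - q / real n \<le> exp (- (q / real n))"
    using exp_ge_add_one_self[of "- (q / real n)"] by simp
  have "(1 - q / real n) * (1 + 1 / real n) powr q \<le> exp (- (q / real n)) * exp (q / real n)"
    using 1 2 by (intro mult_mono) auto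
  then have 3: "(1 - q / real n) * (1 + 1 / real n) powr q \<le> 1"
    by (simp add: exp_add[symmetric])
  have "1 + 1 / real n = real (Suc n) / real n"
    using assms by (simp add: field_simps)
  then have "c / real n = (c / real (Suc n)) * (1 + 1 / real n)"
    using assms by simp
  then have "(c / real n) powr q = (c / real (Suc n)) powr q * (1 + 1 / real n) powr q"
    using c by (simp only:) (subst powr_mult, auto)
  then have "(1 - q / real n) * (c / real n) powr q =
      (c / real (Suc n)) powr q * ((1 - q / real n) * (1 + 1 / real n) powr q)"
    by simp
  also have "\<dots> \<le> (c / real (Suc n)) powr q * 1"
    using 3 by (intro mult_left_mono) auto
  finally show ?thesis by simp
qed

text \<open>Rising factorials of the number of descendants are eigenfunctions of the growth chain.\<close>

lemma pochhammer_diff: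
  fixes D :: nat
  assumes "1 \<le> D"
  shows "real D * (pochhammer (real (D + 1)) k - pochhammer (real D) k) = real k * pochhammer (real D) k"
proof -
  have "pochhammer (real D) (Suc k) = real D * pochhammer (real (D + 1)) k"
    by (simp add: pochhammer_rec add.commute)
  moreover have "pochhammer (real D) (Suc k) = pochhammer (real D) k * (real D + real k)"
    by (simp add: pochhammer_Suc)
  ultimately show ?thesis by (simp add: algebra_simps)
qed

text \<open>The rising moment is multiplied by exactly \<open>1 + q * k / n\<close> in each step; it
  starts from \<open>fact k\<close> because \<open>m\<close> is its only descendant at time
  \<open>m\<close>.\<close>

lemma expectation_pochhammer_descs:
  assumes m: "1 \<le> m" "m \<le> n" and q: "0 \<le> q" "q \<le> 1" and k: "1 \<le> q * real k"
  shows "measure_pmf.expectation (forest q n) (\<lambda>f. pochhammer (real (descs f n m)) k)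
    \<le> fact k * (real n / real m) powr (q * k)"
  using m(2)
proof (induction n rule: dec_induct)
  case base
  then show ?case
    using m by (simp add: descs_self pochhammer_fact[symmetric])
next
  case (step n)
  let ?E = "measure_pmf.expectation (forest q n) (\<lambda>f. pochhammer (real (descs f n m)) k)"
  have "measure_pmf.expectation (forest q (Suc n)) (\<lambda>f. pochhammer (real (descs f (Suc n) m)) k) =
    measure_pmf.expectation (forest q n) (\<lambda>f. pochhammer (real (descs f n m)) k +
      q * descs f n m / n * (pochhammer (real (descs f n m + 1)) k - pochhammer (real (descs f n m)) k))"
    using expectation_descs_Suc[of m n q "\<lambda>_. 1" "\<lambda>D. pochhammer (real D) k"] m step q by simp
  also have "\<dots> = measure_pmf.expectation (forest q n)
      (\<lambda>f. (1 + q * k / n) * pochhammer (real (descs f n m)) k)"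
  proof (intro expectation_cong_pmf)
    fix f
    let ?D = "descs f n m"
    have "q * ?D / n * (pochhammer (real (?D + 1)) k - pochhammer (real ?D) k) =
        q / n * (real ?D * (pochhammer (real (?D + 1)) k - pochhammer (real ?D) k))"
      by simp
    also have "\<dots> = q / n * (real k * pochhammer (real ?D) k)"
      using descs_pos[of m n f] m step by (subst pochhammer_diff) auto
    finally show "pochhammer (real ?D) k +
      q * ?D / n * (pochhammer (real (?D + 1)) k - pochhammer (real ?D) k) =
      (1 + q * k / n) * pochhammer (real ?D) k"
      by (simp add: algebra_simps)
  qed
  also have "\<dots> = (1 + q * k / n) * ?E" by simp
  also have "\<dots> \<le> (1 + q * k / n) * (fact k * (real n / real m) powr (q * k))"
    using step q by (intro mult_left_mono) auto
  also have "\<dots> = fact k * ((1 + q * k / n) * (real n / real m) powr (q * k))" by simp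
  also have "\<dots> \<le> fact k * (real (Suc n) / real m) powr (q * k)"
    using k m step powr_step_ge[of "q * k" n "real m"] by (intro mult_left_mono) auto
  finally show ?case .
qed

text \<open>Markov's inequality for a rising moment. The point is the decay in \<open>m\<close>,
  uniform in \<open>n\<close>: for \<open>q * k \<ge> 2\<close> it is summable over all late
  vertices.\<close>

lemma prob_descs_ge:
  assumes m: "1 \<le> m" "m \<le> n" and q: "0 \<le> q" "q \<le> 1" and k: "1 \<le> q * real k" and b: "0 < b"
  shows "measure_pmf.prob (forest q n) {f. b * real n powr q < real (descs f n m)}
    \<le> fact k / b ^ k * real m powr (- (q * k))"
proof -
  define s where "s = b * real n powr q"
  have s: "0 < s" using b m by (simp add: s_def)
  have "measure_pmf.prob (forest q n) {f. s < real (descs f n m)}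
    \<le> measure_pmf.expectation (forest q n) (\<lambda>f. pochhammer (real (descs f n m)) k / s ^ k)"
  proof (rule prob_le_expectation)
    fix f assume "f \<in> {f. s < real (descs f n m)}"
    then have "s ^ k \<le> real (descs f n m) ^ k" using s by (intro power_mono) auto
    also have "\<dots> = (\<Prod>i = 0..<k. real (descs f n m))" by simp
    also have "\<dots> \<le> pochhammer (real (descs f n m)) k"
      unfolding pochhammer_prod by (intro prod_mono) auto
    finally show "1 \<le> pochhammer (real (descs f n m)) k / s ^ k" using s by simp
  qed (use s descs_pos[OF m] in \<open>auto intro!: divide_nonneg_nonneg pochhammer_nonneg simp: Suc_le_eq\<close>)
  also have "\<dots> = measure_pmf.expectation (forest q n) (\<lambda>f. pochhammer (real (descs f n m)) k) / s ^ k"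
    by simp
  also have "\<dots> \<le> fact k * (real n / real m) powr (q * k) / s ^ k"
    using expectation_pochhammer_descs[OF m q k] s by (intro divide_right_mono) auto
  also have "\<dots> = fact k / b ^ k * real m powr (- (q * k))"
  proof -
    have "s ^ k = b ^ k * real n powr (q * k)"
      using m by (simp add: s_def power_mult_distrib powr_power mult.commute)
    then show ?thesis
      using m b by (simp add: powr_divide powr_minus field_simps)
  qed
  finally show ?thesis by (simp add: s_def)
qed

text \<open>A vertex without children stays so with conditional probability
  \<open>1 - q / n\<close>.\<close>

lemma prob_descs_1:
  assumes m: "1 \<le> m" "m \<le> n" and q: "0 \<le> q" "q \<le> 1"
  shows "measure_pmf.expectation (forest q n) (\<lambda>f. if descs f n m = 1 then 1 else 0 :: real)
    \<le> (real m / real n) powr q"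
  using m(2)
proof (induction n rule: dec_induct)
  case base
  then show ?case using m by (simp add: descs_self)
next
  case (step n)
  let ?I = "\<lambda>D::nat. if D = 1 then 1 else 0 :: real"
  have "measure_pmf.expectation (forest q (Suc n)) (\<lambda>f. ?I (descs f (Suc n) m)) =
    measure_pmf.expectation (forest q n) (\<lambda>f. ?I (descs f n m) +
      q * descs f n m / n * (?I (descs f n m + 1) - ?I (descs f n m)))"
    using expectation_descs_Suc[of m n q "\<lambda>_. 1" ?I] m step q by simp
  also have "\<dots> = measure_pmf.expectation (forest q n) (\<lambda>f. (1 - q / n) * ?I (descs f n m))"
    using m step descs_pos[of m n] by (intro expectation_cong_pmf) auto
  also have "\<dots> = (1 - q / n) * measure_pmf.expectation (forest q n) (\<lambda>f. ?I (descs f n m))" by simp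
  also have "\<dots> \<le> (1 - q / n) * (real m / real n) powr q"
    using step q m by (intro mult_left_mono) (auto simp: field_simps)
  also have "\<dots> \<le> (real m / real (Suc n)) powr q"
    using powr_step_le[of q n "real m"] q m step by auto
  finally show ?case .
qed

text \<open>\<open>1 / (D - 1)\<close> is an eigenfunction as well, but only once \<open>D \<ge> 2\<close>; hence the waiting time
  \<open>b\<close>.\<close>

lemma expectation_inverse_descs:
  assumes m: "1 \<le> m" "m \<le> b" "b \<le> n" and q: "0 \<le> q" "q \<le> 1"
  shows "measure_pmf.expectation (forest q n)
      (\<lambda>f. (if 2 \<le> descs f b m then 1 else 0) * (1 / (real (descs f n m) - 1)))
    \<le> (real b / real n) powr q"
  using m(3)
proof (induction n rule: dec_induct)
  case base
  have "measure_pmf.expectation (forest q b)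
      (\<lambda>f. (if 2 \<le> descs f b m then 1 else 0) * (1 / (real (descs f b m) - 1)))
    \<le> measure_pmf.expectation (forest q b) (\<lambda>f. 1)"
    by (intro expectation_mono_finite) auto
  then show ?case using m by simp
next
  case (step n)
  let ?z = "\<lambda>f. if 2 \<le> descs f b m then 1 else 0 :: real"
  let ?p = "\<lambda>D::nat. 1 / (real D - 1)"
  have "measure_pmf.expectation (forest q (Suc n)) (\<lambda>f. ?z f * ?p (descs f (Suc n) m)) =
    measure_pmf.expectation (forest q n) (\<lambda>f. ?z f * (?p (descs f n m) +
      q * descs f n m / n * (?p (descs f n m + 1) - ?p (descs f n m))))"
    using m step q by (intro expectation_descs_Suc) (auto simp: descs_upd_stable)
  also have "\<dots> = measure_pmf.expectation (forest q n) (\<lambda>f. (1 - q / n) * (?z f * ?p (descs f n m)))"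
  proof (intro expectation_cong_pmf)
    fix f
    let ?D = "descs f n m"
    have "desc f b m \<subseteq> desc f n m" using step by (auto simp: desc_def)
    then have le: "descs f b m \<le> ?D" unfolding descs_def by (intro card_mono) auto
    have "q * ?D / n * (?p (?D + 1) - ?p ?D) = - (q / n) * ?p ?D" if "2 \<le> ?D"
    proof -
      have "real ?D * (?p (?D + 1) - ?p ?D) = - ?p ?D"
        using that by (simp add: field_simps)
      then have "q / n * (real ?D * (?p (?D + 1) - ?p ?D)) = q / n * (- ?p ?D)" by simp
      then show ?thesis by simp
    qed
    then have "?p ?D + q * ?D / n * (?p (?D + 1) - ?p ?D) = (1 - q / n) * ?p ?D" if "2 \<le> ?D"
      using that by (simp only: left_diff_distrib)
    then show "?z f * (?p ?D + q * ?D / n * (?p (?D + 1) - ?p ?D)) = (1 - q / n) * (?z f * ?p ?D)"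
      using le by (cases "2 \<le> descs f b m") auto
  qed
  also have "\<dots> = (1 - q / n) * measure_pmf.expectation (forest q n) (\<lambda>f. ?z f * ?p (descs f n m))"
    by (rule integral_mult_right_zero)
  also have "\<dots> \<le> (1 - q / n) * (real b / real n) powr q"
    using step q m by (intro mult_left_mono) (auto simp: field_simps)
  also have "\<dots> \<le> (real b / real (Suc n)) powr q"
    using powr_step_le[of q n "real b"] q m step by auto
  finally show ?case .
qed

text \<open>The first term bounds the chance that \<open>m\<close> has no child by time
  \<open>b\<close>; otherwise Markov's inequality applies to \<open>1 / (descs f n m - 1)\<close>.
  Taking \<open>b\<close> large and then \<open>e\<close> small makes the bound small uniformly in
  \<open>n\<close>.\<close>

lemma prob_descs_small:
  assumes m: "1 \<le> m" "m \<le> b" "b \<le> n" and q: "0 \<le> q" "q \<le> 1" and e: "0 < e"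
  shows "measure_pmf.prob (forest q n) {f. real (descs f n m) < e * real n powr q}
    \<le> (real m / real b) powr q + e * real b powr q"
proof -
  let ?z = "\<lambda>f. if 2 \<le> descs f b m then 1 else 0 :: real"
  let ?p = "\<lambda>f. 1 / (real (descs f n m) - 1)"
  define s where "s = e * real n powr q"
  have s: "0 < s" using e m by (simp add: s_def)
  have le: "descs f b m \<le> descs f n m" for f
  proof -
    have "desc f b m \<subseteq> desc f n m" using m by (auto simp: desc_def)
    then show ?thesis unfolding descs_def by (intro card_mono) auto
  qed
  have "measure_pmf.prob (forest q n) {f. real (descs f n m) < s}
    \<le> measure_pmf.expectation (forest q n)
      (\<lambda>f. (if descs f b m = 1 then 1 else 0) + s * (?z f * ?p f))"
  proof (rule prob_le_expectation)
    fix f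
    have D: "1 \<le> descs f b m" using descs_pos m by auto
    show "0 \<le> (if descs f b m = 1 then 1 else 0) + s * (?z f * ?p f)"
      using s le[of f] by (auto intro!: mult_nonneg_nonneg)
    assume "f \<in> {f. real (descs f n m) < s}"
    then show "1 \<le> (if descs f b m = 1 then 1 else 0) + s * (?z f * ?p f)"
      using D s le[of f] by (auto simp: field_simps)
  qed auto
  also have "\<dots> = measure_pmf.expectation (forest q n) (\<lambda>f. if descs f b m = 1 then 1 else 0)
      + s * measure_pmf.expectation (forest q n) (\<lambda>f. ?z f * ?p f)"
    by (simp only: expectation_add_finite[OF finite_set_forest] integral_mult_right_zero)
  also have "measure_pmf.expectation (forest q n) (\<lambda>f. if descs f b m = 1 then 1 else 0 :: real) =
      measure_pmf.expectation (forest q b) (\<lambda>f. if descs f b m = 1 then 1 else 0)"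
    using m q by (intro expectation_forest_stable) (auto simp: descs_upd_stable)
  also have "\<dots> + s * measure_pmf.expectation (forest q n) (\<lambda>f. ?z f * ?p f) \<le>
      (real m / real b) powr q + s * (real b / real n) powr q"
    using prob_descs_1[of m b q] expectation_inverse_descs[of m b n q] m q s
    by (intro add_mono mult_left_mono) auto
  also have "s * (real b / real n) powr q = e * real b powr q"
    using m by (simp add: s_def powr_divide)
  finally show ?thesis by (simp add: s_def)
qed

text \<open>Vertex \<open>Suc b\<close> becomes a retained child of 1 with probability
  \<open>q / b\<close>, so avoidance has the same factors \<open>1 - q / b\<close> as in
  \<open>prob_descs_1\<close>.\<close>

lemma prob_no_child:
  assumes a: "1 \<le> a" "a \<le> b" "b \<le> n" and q: "0 \<le> q" "q \<le> 1"
  shows "measure_pmf.prob (forest q n) {f. \<forall>m\<in>{a<..b}. f m \<noteq> 1} \<le> (real a / real b) powr q"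
proof -
  let ?I = "\<lambda>b f. if \<forall>m\<in>{a<..b}. f m \<noteq> 1 then 1 else 0 :: real"
  have *: "measure_pmf.expectation (forest q b) (?I b) \<le> (real a / real b) powr q"
    using a(2)
  proof (induction b rule: dec_induct)
    case base
    then show ?case using a by simp
  next
    case (step b)
    have "measure_pmf.expectation (forest q (Suc b)) (?I (Suc b)) =
      measure_pmf.expectation (forest q b) (\<lambda>f. (1 - q / b) * ?I b f)"
    proof (subst expectation_forest_Suc)
      show "measure_pmf.expectation (forest q b)
          (\<lambda>f. (1 - q) * ?I (Suc b) f + q / b * (\<Sum>i\<in>{1..b}. ?I (Suc b) (f(Suc b := i)))) =
        measure_pmf.expectation (forest q b) (\<lambda>f. (1 - q / b) * ?I b f)"
      proof (intro expectation_cong_pmf)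
        fix f assume "f \<in> set_pmf (forest q b)"
        then have f0: "f (Suc b) = 0" using set_forest forest_fun_Suc0 by blast
        have "{a<..Suc b} = insert (Suc b) {a<..b}" using step by auto
        then have I: "?I (Suc b) f = ?I b f"
          "?I (Suc b) (f(Suc b := i)) = (if i = 1 then 0 else ?I b f)" for i
          using f0 by auto
        have "(\<Sum>i\<in>{1..b}. ?I (Suc b) (f(Suc b := i))) = (\<Sum>i\<in>{1..b}. ?I b f - (if i = 1 then ?I b f else 0))"
          unfolding I by (intro sum.cong) auto
        also have "\<dots> = b * ?I b f - ?I b f"
          using step a by (subst sum_subtractf) (simp add: sum.delta)
        finally show "(1 - q) * ?I (Suc b) f + q / b * (\<Sum>i\<in>{1..b}. ?I (Suc b) (f(Suc b := i))) =
            (1 - q / b) * ?I b f"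
          using step a by (simp only: I(1)) (simp add: field_simps)
      qed
    qed (use step a q in auto)
    also have "\<dots> = (1 - q / b) * measure_pmf.expectation (forest q b) (?I b)" by simp
    also have "\<dots> \<le> (1 - q / b) * (real a / real b) powr q"
      using step q a by (intro mult_left_mono) (auto simp: field_simps)
    also have "\<dots> \<le> (real a / real (Suc b)) powr q"
      using powr_step_le[of q b "real a"] q a step by auto
    finally show ?case .
  qed
  have "measure_pmf.prob (forest q n) {f. \<forall>m\<in>{a<..b}. f m \<noteq> 1} \<le>
      measure_pmf.expectation (forest q n) (?I b)"
    by (rule prob_le_expectation) auto
  also have "\<dots> = measure_pmf.expectation (forest q b) (?I b)"
    using a q by (intro expectation_forest_stable) auto
  finally show ?thesis using * by linarith
qed

section \<open>Tree clusters\<close>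

text \<open>\<open>top_anc f M x\<close> labels the cluster of \<open>x\<close> in the forest restricted to \<open>{M<..}\<close>.\<close>

definition top_anc :: "(nat \<Rightarrow> nat) \<Rightarrow> nat \<Rightarrow> nat \<Rightarrow> nat" where
  "top_anc f M x = Min (anc f x \<inter> {M<..})"

definition roots :: "(nat \<Rightarrow> nat) \<Rightarrow> nat \<Rightarrow> nat set" where
  "roots f n = {r \<in> {1..n}. f r = 0}"

text \<open>Rising factorials instead of powers keep the recursion closed. A cluster of size
  \<open>D\<close> is seen by \<open>D\<close> vertices, so \<open>cluster_sum 2 f n - n\<close> is
  the sum of the cluster size over all vertices, and \<open>cluster_sum 3\<close> dominates the sum
  of its square as well as the cube of each single size.\<close>

definition cluster_sum :: "nat \<Rightarrow> (nat \<Rightarrow> nat) \<Rightarrow> nat \<Rightarrow> real" where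
  "cluster_sum k f n = (\<Sum>r\<in>roots f n. pochhammer (real (descs f n r)) k)"

lemma top_anc_in: "M < x \<Longrightarrow> top_anc f M x \<in> anc f x \<inter> {M<..}"
  unfolding top_anc_def by (intro Min_in) (auto intro: anc_self)

lemma top_anc_step:
  assumes "M < f x" "f x < x"
  shows "top_anc f M x = top_anc f M (f x)"
proof -
  have A: "anc f x = insert x (anc f (f x))" using assms by (intro anc_step) auto
  have ne: "anc f (f x) \<inter> {M<..} \<noteq> {}" using assms(1) anc_self by blast
  have "Min (anc f (f x) \<inter> {M<..}) \<le> f x"
    using assms(1) by (intro Min_le) auto
  then have "min x (Min (anc f (f x) \<inter> {M<..})) = Min (anc f (f x) \<inter> {M<..})"
    using assms(2) by simp
  moreover have "anc f x \<inter> {M<..} = insert x (anc f (f x) \<inter> {M<..})"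
    using A assms by auto
  ultimately show ?thesis
    unfolding top_anc_def using ne by (simp add: Min_insert)
qed

lemma top_anc_below:
  assumes "f x \<le> M" "M < x"
  shows "top_anc f M x = x"
proof -
  have "anc f x \<inter> {M<..} = {x}"
  proof (cases "0 < f x")
    case True
    then have "anc f x = insert x (anc f (f x))" using assms by (intro anc_step) auto
    then show ?thesis using assms by (auto dest: anc_le)
  qed (use assms in \<open>simp add: anc_root\<close>)
  then show ?thesis by (simp add: top_anc_def)
qed

lemma top_anc_root:
  assumes "forest_fun n f" "1 \<le> x"
  shows "f (top_anc f 0 x) = 0"
  using assms(2)
proof (induction x rule: less_induct)
  case (less x)
  show ?case
  proof (cases "0 < f x")
    case True
    then have "f x < x" using assms(1) by (rule forest_fun_less[rotated])
    then show ?thesis using less.IH[of "f x"] True top_anc_step[of 0 f x] by simp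
  next
    case False
    then show ?thesis using top_anc_below[of f x 0] less.prems by simp
  qed
qed

lemma top_anc_eq:
  assumes "forest_fun n f" "1 \<le> x" "r \<in> anc f x" "f r = 0"
  shows "top_anc f 0 x = r"
  using assms(2,3)
proof (induction x rule: less_induct)
  case (less x)
  show ?case
  proof (cases "0 < f x")
    case True
    then have lt: "f x < x" using assms(1) by (rule forest_fun_less[rotated])
    then have "r \<in> insert x (anc f (f x))" using anc_step[of f x] True lt less.prems by simp
    then have "r \<in> anc f (f x)" using assms(4) True by auto
    then show ?thesis using less.IH[OF lt] True lt top_anc_step[of 0 f x] by simp
  next
    case False
    then have "r = x" using less.prems anc_root[of f x] by simp
    then show ?thesis using False top_anc_below[of f x 0] less.prems by simp
  qed
qed

lemma finite_roots [simp]: "finite (roots f n)"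
  by (simp add: roots_def)

lemma top_anc_mem_roots:
  assumes "forest_fun n f" "x \<in> {1..n}"
  shows "top_anc f 0 x \<in> roots f n"
  using top_anc_root[OF assms(1), of x] top_anc_in[of 0 x f] anc_le[of "top_anc f 0 x" f x] assms(2)
  by (auto simp: roots_def)

lemma desc_root:
  assumes "forest_fun n f" "r \<in> roots f n"
  shows "desc f n r = {x \<in> {1..n}. top_anc f 0 x = r}"
  using top_anc_eq[OF assms(1)] top_anc_in[of 0 _ f] assms(2)
  by (fastforce simp: desc_def roots_def)

lemma sum_top_anc:
  fixes G :: "nat \<Rightarrow> real"
  assumes "forest_fun n f"
  shows "(\<Sum>x\<in>{1..n}. G (top_anc f 0 x)) = (\<Sum>r\<in>roots f n. real (descs f n r) * G r)"
proof -
  have "(\<Sum>r\<in>roots f n. \<Sum>x\<in>{x \<in> {1..n}. top_anc f 0 x = r}. G (top_anc f 0 x)) =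
      (\<Sum>x\<in>{1..n}. G (top_anc f 0 x))"
    using top_anc_mem_roots[OF assms] by (intro sum.group) auto
  moreover have "(\<Sum>x\<in>{x \<in> {1..n}. top_anc f 0 x = r}. G (top_anc f 0 x)) = real (descs f n r) * G r"
    if "r \<in> roots f n" for r
    using desc_root[OF assms that] by (simp add: descs_def)
  then have "(\<Sum>r\<in>roots f n. \<Sum>x\<in>{x \<in> {1..n}. top_anc f 0 x = r}. G (top_anc f 0 x)) =
      (\<Sum>r\<in>roots f n. real (descs f n r) * G r)"
    by (intro sum.cong) auto
  ultimately show ?thesis by simp
qed

lemma sum_descs_roots:
  assumes "forest_fun n f"
  shows "(\<Sum>r\<in>roots f n. real (descs f n r)) = real n"
  using sum_top_anc[OF assms, of "\<lambda>_. 1"] by simp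

section \<open>Recursion and moments of the cluster sums\<close>

lemma cluster_sum_nonneg: "0 \<le> cluster_sum k f n"
  unfolding cluster_sum_def pochhammer_prod by (intro sum_nonneg prod_nonneg) auto

lemma cluster_sum_Suc_root:
  assumes "f (Suc n) = 0"
  shows "cluster_sum k f (Suc n) = cluster_sum k f n + fact k"
proof -
  have "roots f (Suc n) = insert (Suc n) (roots f n)"
    using assms by (auto simp: roots_def le_Suc_eq)
  moreover have "Suc n \<notin> roots f n" by (simp add: roots_def)
  moreover have "descs f (Suc n) r = descs f n r" if "r \<in> roots f n" for r
    using that assms descs_Suc_same[of r n f] by (simp add: roots_def)
  moreover have "descs f (Suc n) (Suc n) = 1" by (rule descs_self) simp
  ultimately show ?thesis
    by (simp add: cluster_sum_def pochhammer_fact[symmetric])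
qed

lemma cluster_sum_Suc_child:
  assumes f: "forest_fun n f" and i: "i \<in> {1..n}"
  defines "t \<equiv> top_anc f 0 i"
  shows "cluster_sum k (f(Suc n := i)) (Suc n) = cluster_sum k f n +
    (pochhammer (real (descs f n t + 1)) k - pochhammer (real (descs f n t)) k)"
proof -
  define P where "P D = pochhammer (real D) k" for D :: nat
  have t: "t \<in> roots f n" unfolding t_def by (rule top_anc_mem_roots[OF f i])
  have "roots (f(Suc n := i)) (Suc n) = roots f n"
    using i by (auto simp: roots_def le_Suc_eq)
  moreover have "descs (f(Suc n := i)) (Suc n) r = descs f n r + (if r = t then 1 else 0)"
    if "r \<in> roots f n" for r
    using that i desc_root[OF f that] descs_upd[of r n i f] by (auto simp: roots_def t_def)
  ultimately have "cluster_sum k (f(Suc n := i)) (Suc n) =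
      (\<Sum>r\<in>roots f n. P (descs f n r + (if r = t then 1 else 0)))"
    by (simp add: cluster_sum_def P_def)
  also have "\<dots> = (\<Sum>r\<in>roots f n. P (descs f n r) +
      (if r = t then P (descs f n t + 1) - P (descs f n t) else 0))"
    by (intro sum.cong) auto
  also have "\<dots> = cluster_sum k f n + (P (descs f n t + 1) - P (descs f n t))"
    using t by (simp add: sum.distrib cluster_sum_def P_def[symmetric])
  finally show ?thesis by (simp only: P_def)
qed

text \<open>A new vertex founds a singleton cluster, worth \<open>fact k\<close>, or joins the
  cluster of a uniform vertex, which is a size-biased choice. \<open>\<Psi>\<close> is general
  because squared deviations are needed besides means.\<close>

lemma expectation_cluster_sum_Suc:
  fixes \<Psi> :: "real \<Rightarrow> real"
  assumes n: "1 \<le> n" and q: "0 \<le> q" "q \<le> 1"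
  shows "measure_pmf.expectation (forest q (Suc n)) (\<lambda>f. \<Psi> (cluster_sum k f (Suc n))) =
    measure_pmf.expectation (forest q n) (\<lambda>f. (1 - q) * \<Psi> (cluster_sum k f n + fact k) +
      q / n * (\<Sum>r\<in>roots f n. real (descs f n r) * \<Psi> (cluster_sum k f n +
        (pochhammer (real (descs f n r + 1)) k - pochhammer (real (descs f n r)) k))))"
proof (subst expectation_forest_Suc[OF n q], rule expectation_cong_pmf)
  fix f assume "f \<in> set_pmf (forest q n)"
  then have f: "forest_fun n f" by (rule set_forest)
  let ?G = "\<lambda>r. \<Psi> (cluster_sum k f n +
        (pochhammer (real (descs f n r + 1)) k - pochhammer (real (descs f n r)) k))"
  have "(\<Sum>i\<in>{1..n}. \<Psi> (cluster_sum k (f(Suc n := i)) (Suc n))) = (\<Sum>i\<in>{1..n}. ?G (top_anc f 0 i))"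
    using cluster_sum_Suc_child[OF f] by (intro sum.cong) auto
  also have "\<dots> = (\<Sum>r\<in>roots f n. real (descs f n r) * ?G r)"
    by (rule sum_top_anc[OF f])
  finally show "(1 - q) * \<Psi> (cluster_sum k f (Suc n)) +
      q / n * (\<Sum>i\<in>{1..n}. \<Psi> (cluster_sum k (f(Suc n := i)) (Suc n))) =
    (1 - q) * \<Psi> (cluster_sum k f n + fact k) + q / n * (\<Sum>r\<in>roots f n. real (descs f n r) * ?G r)"
    using cluster_sum_Suc_root[of f n k] forest_fun_Suc0[OF f] by simp
qed

lemma cluster_sum_1: "f \<in> set_pmf (forest q (Suc 0)) \<Longrightarrow> cluster_sum k f (Suc 0) = fact k"
proof -
  assume "f \<in> set_pmf (forest q (Suc 0))"
  then have "f = (\<lambda>_. 0)" by (simp add: forest_1)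
  then have "roots f (Suc 0) = {1}" by (auto simp: roots_def)
  then show ?thesis
    using descs_self[of 1 f] by (simp add: cluster_sum_def pochhammer_fact[symmetric])
qed


lemma measure_pmf_const: "measure_pmf.expectation p (\<lambda>_. c :: real) = c"
  by simp

text \<open>The mean obeys \<open>x' = (1 + 3 * q / n) * x + 6 * (1 - q)\<close>. A linear bound
  \<open>c * n\<close> reproduces itself once \<open>c * (1 - 3 * q)\<close> reaches the
  inhomogeneous term, which is where \<open>q < 1 / 3\<close> enters.\<close>

lemma expectation_cluster_sum_3:
  assumes n: "1 \<le> n" and q: "0 \<le> q" "q < 1 / 3"
  shows "measure_pmf.expectation (forest q n) (\<lambda>f. cluster_sum 3 f n) \<le> 6 / (1 - 3 * q) * n"
  using n
proof (induction n rule: dec_induct)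
  case base
  have "measure_pmf.expectation (forest q (Suc 0)) (\<lambda>f. cluster_sum 3 f (Suc 0)) =
    measure_pmf.expectation (forest q (Suc 0)) (\<lambda>f. 6)"
    by (intro expectation_cong_pmf) (simp add: cluster_sum_1 fact_numeral)
  then show ?case using q by (simp add: field_simps)
next
  case (step n)
  let ?X = "\<lambda>f. cluster_sum 3 f n"
  have "measure_pmf.expectation (forest q (Suc n)) (\<lambda>f. cluster_sum 3 f (Suc n)) =
    measure_pmf.expectation (forest q n) (\<lambda>f. (1 - q) * (?X f + fact 3) +
      q / n * (\<Sum>r\<in>roots f n. real (descs f n r) * (?X f +
        (pochhammer (real (descs f n r + 1)) 3 - pochhammer (real (descs f n r)) 3))))"
    using step q by (intro expectation_cluster_sum_Suc) auto
  also have "\<dots> = measure_pmf.expectation (forest q n) (\<lambda>f. (1 + 3 * q / n) * ?X f + 6 * (1 - q))"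
  proof (intro expectation_cong_pmf)
    fix f assume "f \<in> set_pmf (forest q n)"
    then have f: "forest_fun n f" by (rule set_forest)
    have "(\<Sum>r\<in>roots f n. real (descs f n r) * (?X f +
        (pochhammer (real (descs f n r + 1)) 3 - pochhammer (real (descs f n r)) 3))) =
      (\<Sum>r\<in>roots f n. real (descs f n r) * ?X f + 3 * pochhammer (real (descs f n r)) 3)"
    proof (intro sum.cong refl)
      fix r assume "r \<in> roots f n"
      then have "1 \<le> descs f n r" by (intro descs_pos) (auto simp: roots_def)
      then show "real (descs f n r) * (?X f +
        (pochhammer (real (descs f n r + 1)) 3 - pochhammer (real (descs f n r)) 3)) =
        real (descs f n r) * ?X f + 3 * pochhammer (real (descs f n r)) 3"
        using pochhammer_diff[of "descs f n r" 3] by (simp only: distrib_left of_nat_numeral)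
    qed
    also have "\<dots> = real n * ?X f + 3 * ?X f"
      using sum_descs_roots[OF f]
      by (simp add: sum.distrib sum_distrib_right[symmetric] sum_distrib_left[symmetric] cluster_sum_def)
    finally have S: "(\<Sum>r\<in>roots f n. real (descs f n r) * (?X f +
        (pochhammer (real (descs f n r + 1)) 3 - pochhammer (real (descs f n r)) 3))) =
      real n * ?X f + 3 * ?X f" .
    show "(1 - q) * (?X f + fact 3) + q / n * (\<Sum>r\<in>roots f n. real (descs f n r) * (?X f +
        (pochhammer (real (descs f n r + 1)) 3 - pochhammer (real (descs f n r)) 3))) =
      (1 + 3 * q / n) * ?X f + 6 * (1 - q)"
      unfolding S using step by (simp add: fact_numeral field_simps)
  qed
  also have "\<dots> = (1 + 3 * q / n) * measure_pmf.expectation (forest q n) ?X + 6 * (1 - q)"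
    by (subst expectation_add_finite) auto
  also have "\<dots> \<le> (1 + 3 * q / n) * (6 / (1 - 3 * q) * n) + 6 * (1 - q)"
    using step q by (intro add_mono mult_left_mono) auto
  also have "\<dots> = 6 / (1 - 3 * q) * n + 3 * q * (6 / (1 - 3 * q)) + 6 * (1 - q)"
  proof -
    have "(1 + 3 * q / n) * (c * n) = c * n + 3 * q * c" for c :: real
      using step by (simp add: field_simps)
    then show ?thesis by (simp only:)
  qed
  also have "\<dots> \<le> 6 / (1 - 3 * q) * n + 3 * q * (6 / (1 - 3 * q)) + 6"
    using q by simp
  also have "\<dots> = 6 / (1 - 3 * q) * Suc n"
  proof -
    have "c * n + 3 * q * c + 6 = c * Suc n" if "c * (1 - 3 * q) = 6" for c
      using that by (simp add: algebra_simps)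
    then show ?thesis by this (use q in \<open>simp add: divide_simps\<close>)
  qed
  finally show ?case .
qed

lemma pochhammer_2_3:
  fixes x :: real
  shows "pochhammer x 2 = x * (x + 1)" "pochhammer x 3 = x * (x + 1) * (x + 2)"
  by (simp_all add: pochhammer_prod numeral_eq_Suc)

text \<open>The mean recursion \<open>x' = (1 + 2 * q / n) * x + 2 * (1 - q)\<close> has the linear
  solution \<open>C * n\<close>. Squared deviations gain the factor \<open>1 + 4 * q / n\<close>
  plus an increment with bounded mean. As \<open>4 * q < 4 / 3\<close>, an exponent between
  \<open>4 / 3\<close> and 2 closes the induction and still yields concentration;
  \<open>3 / 2\<close> leaves a gap of at least \<open>1 / 6\<close>, hence the factor 6 in
  \<open>B\<close>.\<close>

lemma expectation_cluster_sum_2_deviation: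
  fixes q :: real
  assumes n: "1 \<le> n" and q: "0 \<le> q" "q < 1 / 3"
  defines "C \<equiv> 2 * (1 - q) / (1 - 2 * q)"
  defines "B \<equiv> 6 * (2 * C\<^sup>2 + 24 / (1 - 3 * q))"
  shows "measure_pmf.expectation (forest q n) (\<lambda>f. (cluster_sum 2 f n - C * n)\<^sup>2) \<le> B * n powr (3 / 2)"
proof -
  have Cq: "C * (1 - 2 * q) = 2 * (1 - q)" using q by (simp add: C_def)
  have C2: "2 \<le> C" using q by (simp add: C_def field_simps)
  have sqC: "(2 - C)\<^sup>2 \<le> C\<^sup>2" using C2 by (simp add: power2_eq_square algebra_simps)
  define B0 where "B0 = 2 * C\<^sup>2 + 24 / (1 - 3 * q)"
  have B0: "0 \<le> B0" "B = 6 * B0" "C\<^sup>2 \<le> B0"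
    using q by (auto simp: B0_def B_def)
  show ?thesis
    using n
  proof (induction n rule: dec_induct)
    case base
    have "measure_pmf.expectation (forest q (Suc 0)) (\<lambda>f. (cluster_sum 2 f (Suc 0) - C * real (Suc 0))\<^sup>2) =
      measure_pmf.expectation (forest q (Suc 0)) (\<lambda>f. (2 - C)\<^sup>2)"
      by (intro expectation_cong_pmf) (simp add: cluster_sum_1 fact_numeral)
    then show ?case using sqC B0 by simp
  next
    case (step n)
    let ?X = "\<lambda>f. cluster_sum 2 f n"
    let ?Y = "\<lambda>f. cluster_sum 2 f n - C * n"
    have "measure_pmf.expectation (forest q (Suc n)) (\<lambda>f. (cluster_sum 2 f (Suc n) - C * real (Suc n))\<^sup>2) =
      measure_pmf.expectation (forest q n) (\<lambda>f. (1 - q) * (?X f + fact 2 - C * real (Suc n))\<^sup>2 +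
        q / n * (\<Sum>r\<in>roots f n. real (descs f n r) * (?X f +
          (pochhammer (real (descs f n r + 1)) 2 - pochhammer (real (descs f n r)) 2)
            - C * real (Suc n))\<^sup>2))"
      using step q by (intro expectation_cluster_sum_Suc[where \<Psi> = "\<lambda>x. (x - C * real (Suc n))\<^sup>2"]) auto
    also have "\<dots> \<le> measure_pmf.expectation (forest q n) (\<lambda>f. (1 + 4 * q / n) * (?Y f)\<^sup>2 +
        (2 * C\<^sup>2 + 4 / n * cluster_sum 3 f n))"
    proof (intro expectation_mono_finite)
      fix f assume "f \<in> set_pmf (forest q n)"
      then have f: "forest_fun n f" by (rule set_forest)
      let ?D = "\<lambda>r. real (descs f n r)"
      let ?y = "?Y f"
      have D: "1 \<le> ?D r" if "r \<in> roots f n" for r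
        using that descs_pos[of r n f] by (auto simp: roots_def)
      have "(\<Sum>r\<in>roots f n. ?D r * (?X f +
          (pochhammer (real (descs f n r + 1)) 2 - pochhammer (?D r) 2) - C * real (Suc n))\<^sup>2) =
        (\<Sum>r\<in>roots f n. ?D r * (?y\<^sup>2 + 2 * (2 - C) * ?y) + 4 * ?y * (?D r * ?D r)
          + ?D r * (2 * ?D r + 2 - C)\<^sup>2)"
        by (intro sum.cong refl) (simp add: pochhammer_2_3 power2_eq_square algebra_simps)
      also have "\<dots> = n * (?y\<^sup>2 + 2 * (2 - C) * ?y) + 4 * ?y * (\<Sum>r\<in>roots f n. ?D r * ?D r)
          + (\<Sum>r\<in>roots f n. ?D r * (2 * ?D r + 2 - C)\<^sup>2)"
        using sum_descs_roots[OF f]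
        by (simp add: sum.distrib sum_distrib_right[symmetric] sum_distrib_left[symmetric])
      also have "(\<Sum>r\<in>roots f n. ?D r * ?D r) = ?X f - n"
        using sum_descs_roots[OF f]
        by (simp add: cluster_sum_def pochhammer_2_3 distrib_left sum.distrib)
      finally have S: "(\<Sum>r\<in>roots f n. ?D r * (?X f +
          (pochhammer (real (descs f n r + 1)) 2 - pochhammer (?D r) 2) - C * real (Suc n))\<^sup>2) =
        n * (?y\<^sup>2 + 2 * (2 - C) * ?y) + 4 * ?y * (?X f - n)
          + (\<Sum>r\<in>roots f n. ?D r * (2 * ?D r + 2 - C)\<^sup>2)" .
      \<comment> \<open>Joining a cluster of size \<open>D\<close> raises the sum by
        \<open>2 * D + 2\<close>. The size-biased square of this jump is of third order in
        \<open>D\<close>, whence \<open>cluster_sum 3\<close>.\<close>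
      have "(\<Sum>r\<in>roots f n. ?D r * (2 * ?D r + 2 - C)\<^sup>2) \<le>
        (\<Sum>r\<in>roots f n. 4 * pochhammer (?D r) 3 + C\<^sup>2 * ?D r)"
      proof (intro sum_mono)
        fix r assume r: "r \<in> roots f n"
        have "(2 * ?D r + 2 - C)\<^sup>2 \<le> (2 * ?D r)\<^sup>2 + C\<^sup>2"
        proof (cases "2 * ?D r + 2 - C \<ge> 0")
          case True
          then have "(2 * ?D r + 2 - C)\<^sup>2 \<le> (2 * ?D r)\<^sup>2" using C2 by (intro power_mono) auto
          then show ?thesis by (simp add: add_increasing2)
        next
          case False
          then have "(- (2 * ?D r + 2 - C))\<^sup>2 \<le> C\<^sup>2" using D[OF r] by (intro power_mono) auto
          then have "(2 * ?D r + 2 - C)\<^sup>2 \<le> C\<^sup>2" by (simp only: power2_minus)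
          then show ?thesis by (simp add: add_increasing)
        qed
        then have "?D r * (2 * ?D r + 2 - C)\<^sup>2 \<le> ?D r * ((2 * ?D r)\<^sup>2 + C\<^sup>2)"
          by (intro mult_left_mono) auto
        also have "\<dots> = 4 * (?D r * ?D r * ?D r) + C\<^sup>2 * ?D r"
          by (simp add: power2_eq_square algebra_simps)
        also have "?D r * ?D r * ?D r \<le> pochhammer (?D r) 3"
          unfolding pochhammer_2_3 by (intro mult_mono) auto
        finally show "?D r * (2 * ?D r + 2 - C)\<^sup>2 \<le> 4 * pochhammer (?D r) 3 + C\<^sup>2 * ?D r" by simp
      qed
      also have "\<dots> = 4 * cluster_sum 3 f n + C\<^sup>2 * n"
        using sum_descs_roots[OF f]
        by (simp add: sum.distrib sum_distrib_left[symmetric] cluster_sum_def)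
      finally have T: "(\<Sum>r\<in>roots f n. ?D r * (2 * ?D r + 2 - C)\<^sup>2) \<le> 4 * cluster_sum 3 f n + C\<^sup>2 * n" .
      have n0: "0 < real n" using step by simp
      have "q / n * (n * (?y\<^sup>2 + 2 * (2 - C) * ?y) + 4 * ?y * (?X f - n)
          + (\<Sum>r\<in>roots f n. ?D r * (2 * ?D r + 2 - C)\<^sup>2)) \<le>
        q / n * (n * (?y\<^sup>2 + 2 * (2 - C) * ?y) + 4 * ?y * (?X f - n) + (4 * cluster_sum 3 f n + C\<^sup>2 * n))"
        using T q by (intro mult_left_mono add_left_mono) auto
      also have "\<dots> = q * (?y\<^sup>2 + 2 * (2 - C) * ?y) + 4 * q / n * ?y * (?X f - n)
          + (q * (4 / n * cluster_sum 3 f n) + q * C\<^sup>2)"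
      proof -
        have "q / n * (n * a + 4 * y * b + (4 * c + d * n)) =
          q * a + 4 * q / n * y * b + (q * (4 / n * c) + q * d)" for a b c d y :: real
          using n0 by (simp add: field_simps)
        then show ?thesis by (simp only:)
      qed
      also have "4 * q / n * ?y * (?X f - n) = 4 * q / n * ?y\<^sup>2 + 4 * q * (C - 1) * ?y"
      proof -
        have "?X f - n = ?y + (C - 1) * n" by (simp add: algebra_simps)
        then have "4 * q / n * ?y * (?X f - n) = 4 * q / n * ?y * (?y + (C - 1) * n)" by simp
        also have "\<dots> = 4 * q / n * ?y\<^sup>2 + 4 * q * (C - 1) * ?y"
          using n0 by (simp add: power2_eq_square distrib_left)
        finally show ?thesis .
      qed
      finally have R: "q / n * (n * (?y\<^sup>2 + 2 * (2 - C) * ?y) + 4 * ?y * (?X f - n)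
          + (\<Sum>r\<in>roots f n. ?D r * (2 * ?D r + 2 - C)\<^sup>2)) \<le>
        q * (?y\<^sup>2 + 2 * (2 - C) * ?y) + (4 * q / n * ?y\<^sup>2 + 4 * q * (C - 1) * ?y)
          + (q * (4 / n * cluster_sum 3 f n) + q * C\<^sup>2)" .
      have L: "(1 - q) * (?X f + fact 2 - C * real (Suc n))\<^sup>2 =
          (1 - q) * ?y\<^sup>2 + (1 - q) * (2 * (2 - C) * ?y) + (1 - q) * (2 - C)\<^sup>2"
        by (simp add: fact_numeral power2_eq_square algebra_simps)
      \<comment> \<open>The terms linear in the deviation cancel by the equation \<open>Cq\<close>
        for \<open>C\<close>: this is the compensation of the drift.\<close>
      have lin: "(1 - q) * (2 * (2 - C) * ?y) + q * (2 * (2 - C) * ?y) + 4 * q * (C - 1) * ?y = 0"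
      proof -
        have "(1 - q) * (2 * (2 - C) * ?y) + q * (2 * (2 - C) * ?y) + 4 * q * (C - 1) * ?y =
          2 * ?y * (2 * (1 - q) - C * (1 - 2 * q))"
          by (simp add: algebra_simps)
        then show ?thesis using Cq by simp
      qed
      have "(1 - q) * (2 - C)\<^sup>2 \<le> 1 * C\<^sup>2" using q sqC by (intro mult_mono) auto
      moreover have "q * (4 / n * cluster_sum 3 f n) \<le> 1 * (4 / n * cluster_sum 3 f n)"
        using q cluster_sum_nonneg[of 3 f n] by (intro mult_right_mono) auto
      moreover have "q * C\<^sup>2 \<le> 1 * C\<^sup>2" using q by (intro mult_right_mono) auto
      moreover have "(1 - q) * ?y\<^sup>2 + q * (?y\<^sup>2 + 2 * (2 - C) * ?y) + 4 * q / n * ?y\<^sup>2 =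
          (1 + 4 * q / n) * ?y\<^sup>2 + q * (2 * (2 - C) * ?y)"
        by (simp add: algebra_simps)
      ultimately show "(1 - q) * (?X f + fact 2 - C * real (Suc n))\<^sup>2 +
        q / n * (\<Sum>r\<in>roots f n. ?D r * (?X f +
          (pochhammer (real (descs f n r + 1)) 2 - pochhammer (?D r) 2) - C * real (Suc n))\<^sup>2)
        \<le> (1 + 4 * q / n) * (?Y f)\<^sup>2 + (2 * C\<^sup>2 + 4 / n * cluster_sum 3 f n)"
        unfolding S L using R lin by linarith
    qed auto
    also have "\<dots> = (1 + 4 * q / n) * measure_pmf.expectation (forest q n) (\<lambda>f. (?Y f)\<^sup>2) +
        (2 * C\<^sup>2 + 4 / n * measure_pmf.expectation (forest q n) (\<lambda>f. cluster_sum 3 f n))"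
      by (simp only: expectation_add_finite[OF finite_set_forest] integral_mult_right_zero
          measure_pmf_const)
    also have "\<dots> \<le> (1 + 4 * q / n) * (B * n powr (3 / 2)) + (2 * C\<^sup>2 + 4 / n * (6 / (1 - 3 * q) * n))"
      using step q expectation_cluster_sum_3[of n q] by (intro add_mono mult_left_mono) auto
    also have "2 * C\<^sup>2 + 4 / n * (6 / (1 - 3 * q) * n) = B0"
      using step by (simp add: B0_def)
    \<comment> \<open>The gain \<open>(3 / 2 - 4 * q) * B * n powr (1 / 2)\<close> covers
      \<open>B0\<close>, because \<open>3 / 2 - 4 * q \<ge> 1 / 6\<close>, \<open>B = 6 * B0\<close>
      and \<open>n \<ge> 1\<close>.\<close>
    also have "(1 + 4 * q / n) * (B * n powr (3 / 2)) + B0 \<le> (1 + (3 / 2) / n) * (B * n powr (3 / 2))"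
    proof -
      have np: "real n powr (3 / 2) = n * n powr (1 / 2)"
        using step powr_add[of "real n" 1 "1 / 2"] by simp
      have "B0 * 1 \<le> B0 * n powr (1 / 2)"
        using B0 step by (intro mult_left_mono ge_one_powr_ge_zero) auto
      also have "\<dots> \<le> (3 / 2 - 4 * q) * (6 * (B0 * n powr (1 / 2)))"
      proof -
        have "1 * (B0 * n powr (1 / 2)) \<le> ((3 / 2 - 4 * q) * 6) * (B0 * n powr (1 / 2))"
          using q B0 by (intro mult_right_mono) auto
        then show ?thesis by (simp add: algebra_simps)
      qed
      finally have "B0 \<le> (3 / 2 - 4 * q) * (6 * (B0 * n powr (1 / 2)))" by simp
      moreover have e: "(1 + a / n) * (6 * B0 * (n * w)) = 6 * B0 * (n * w) + a * (6 * (B0 * w))" for a w :: real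
        using step by (simp add: field_simps)
      ultimately show ?thesis
        unfolding np B0(2) e by (simp add: left_diff_distrib)
    qed
    also have "\<dots> = B * ((1 + (3 / 2) / n) * (real n / 1) powr (3 / 2))" by simp
    also have "\<dots> \<le> B * (real (Suc n) / 1) powr (3 / 2)"
      using step B0 by (intro mult_left_mono powr_step_ge) auto
    finally show ?case by simp
  qed
qed

section \<open>Adding sparse random edges to a forest\<close>

definition forest_edges :: "(nat \<Rightarrow> nat) \<Rightarrow> nat set set" where
  "forest_edges f = (\<lambda>m. {f m, m}) ` {m. 0 < f m}"

lemma forest_edges_subset:
  assumes "forest_fun n f"
  shows "forest_edges f \<subseteq> pairs {1..n}"
proof
  fix e assume "e \<in> forest_edges f"
  then obtain m where m: "e = {f m, m}" "0 < f m" by (auto simp: forest_edges_def)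
  have "f m < m" using assms m(2) by (rule forest_fun_less)
  moreover have "m \<le> n" using assms m(2) unfolding forest_fun_def by (metis less_numeral_extra(3) not_le)
  ultimately show "e \<in> pairs {1..n}" using m by (auto simp: pairs_def)
qed

text \<open>An edge above \<open>M\<close> joins a vertex to its parent and does not change
  \<open>top_anc\<close>; so different labels certify different clusters.\<close>

lemma reach_forest_top:
  assumes f: "forest_fun n f" and x: "M < x" and y: "y \<in> reach (forest_edges f \<inter> Pow {M<..n}) {x}"
  shows "M < y \<and> top_anc f M y = top_anc f M x"
proof -
  have "reach (forest_edges f \<inter> Pow {M<..n}) {x} \<subseteq> {y. M < y \<and> top_anc f M y = top_anc f M x}"
  proof (rule reach_least)
    fix a b assume a: "a \<in> {y. M < y \<and> top_anc f M y = top_anc f M x}"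
      and e: "{a, b} \<in> forest_edges f \<inter> Pow {M<..n}"
    then obtain m where m: "{a, b} = {f m, m}" "0 < f m" by (auto simp: forest_edges_def)
    have lt: "f m < m" using f m(2) by (rule forest_fun_less)
    have ab: "M < a" "M < b" using e by auto
    have "M < f m" using m ab by (metis doubleton_eq_iff)
    then have "top_anc f M m = top_anc f M (f m)" using lt by (rule top_anc_step)
    then have "top_anc f M a = top_anc f M b" using m(1) by (auto simp: doubleton_eq_iff)
    then show "b \<in> {y. M < y \<and> top_anc f M y = top_anc f M x}" using a ab by simp
  qed (use x in simp)
  then show ?thesis using y by auto
qed

lemma forest_edges_restrict:
  assumes "forest_fun n f"
  shows "forest_edges f \<inter> Pow {M<..n} \<subseteq> pairs {M<..n}"
  using forest_edges_subset[OF assms] by (auto simp: pairs_def)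

text \<open>A cluster above \<open>M\<close> consists of descendants of its first vertex, which
  itself exceeds \<open>M\<close>. Hence a bound on the descendants of late vertices controls all
  these clusters, also those cut out of the tree of an early vertex.\<close>

lemma card_reach_forest:
  assumes f: "forest_fun n f" and x: "x \<in> {M<..n}"
  shows "card (reach (forest_edges f \<inter> Pow {M<..n}) {x}) \<le> descs f n (top_anc f M x)"
proof -
  let ?c = "reach (forest_edges f \<inter> Pow {M<..n}) {x}"
  have "?c \<subseteq> {M<..n}" using forest_edges_restrict[OF f] x by (intro reach_subset) auto
  moreover have "top_anc f M x \<in> anc f y" if "y \<in> ?c" for y
    using reach_forest_top[OF f _ that] top_anc_in[of M y f] x by auto
  ultimately have "?c \<subseteq> desc f n (top_anc f M x)"
    by (auto simp: desc_def)
  then show ?thesis unfolding descs_def by (intro card_mono) auto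
qed

text \<open>Dropping the vertices up to \<open>M\<close> only breaks clusters up, so monotonicity of
  \<open>g\<close> reduces to the full forest, where a sum over vertices is a size-biased sum over
  roots.\<close>

lemma sum_reach_forest:
  fixes g :: "nat \<Rightarrow> real"
  assumes f: "forest_fun n f" and g: "mono g" "\<And>x. 0 \<le> g x"
  shows "(\<Sum>x\<in>{M<..n}. g (card (reach (forest_edges f \<inter> Pow {M<..n}) {x}))) \<le>
    (\<Sum>r\<in>roots f n. real (descs f n r) * g (descs f n r))"
proof -
  have "(\<Sum>x\<in>{M<..n}. g (card (reach (forest_edges f \<inter> Pow {M<..n}) {x}))) \<le>
      (\<Sum>x\<in>{M<..n}. g (descs f n (top_anc f 0 x)))"
  proof (rule sum_mono)
    fix x assume x: "x \<in> {M<..n}"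
    have "reach (forest_edges f \<inter> Pow {0<..n}) {x} \<subseteq> {0<..n}"
      using forest_edges_restrict[OF f] x by (intro reach_subset) auto
    then have "card (reach (forest_edges f \<inter> Pow {M<..n}) {x}) \<le> card (reach (forest_edges f \<inter> Pow {0<..n}) {x})"
      by (intro card_mono reach_mono) (auto intro: finite_subset)
    also have "\<dots> \<le> descs f n (top_anc f 0 x)" using x by (intro card_reach_forest[OF f]) auto
    finally show "g (card (reach (forest_edges f \<inter> Pow {M<..n}) {x})) \<le> g (descs f n (top_anc f 0 x))"
      using g(1) by (rule monoD[rotated])
  qed
  also have "\<dots> \<le> (\<Sum>x\<in>{1..n}. g (descs f n (top_anc f 0 x)))"
    using g(2) by (intro sum_mono2) auto
  also have "\<dots> = (\<Sum>r\<in>roots f n. real (descs f n r) * g (descs f n r))"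
    by (rule sum_top_anc[OF f])
  finally show ?thesis .
qed

lemma sum_reach_forest_1:
  assumes f: "forest_fun n f"
  shows "(\<Sum>x\<in>{M<..n}. real (card (reach (forest_edges f \<inter> Pow {M<..n}) {x}))) \<le> cluster_sum 2 f n - n"
proof -
  have "(\<Sum>x\<in>{M<..n}. real (card (reach (forest_edges f \<inter> Pow {M<..n}) {x}))) \<le>
      (\<Sum>r\<in>roots f n. real (descs f n r) * real (descs f n r))"
    by (rule sum_reach_forest[OF f]) (auto simp: mono_def)
  also have "\<dots> = cluster_sum 2 f n - n"
    using sum_descs_roots[OF f]
    by (simp add: cluster_sum_def pochhammer_2_3 distrib_left sum.distrib)
  finally show ?thesis .
qed

lemma sum_reach_forest_2:
  assumes f: "forest_fun n f"
  shows "(\<Sum>x\<in>{M<..n}. (real (card (reach (forest_edges f \<inter> Pow {M<..n}) {x})))\<^sup>2) \<le> cluster_sum 3 f n"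
proof -
  have "(\<Sum>x\<in>{M<..n}. (real (card (reach (forest_edges f \<inter> Pow {M<..n}) {x})))\<^sup>2) \<le>
      (\<Sum>r\<in>roots f n. real (descs f n r) * (real (descs f n r))\<^sup>2)"
    by (rule sum_reach_forest[OF f]) (auto simp: mono_def power_mono)
  also have "\<dots> \<le> cluster_sum 3 f n"
    unfolding cluster_sum_def pochhammer_2_3 power2_eq_square mult.assoc[symmetric]
    by (intro sum_mono mult_mono) auto
  finally show ?thesis .
qed

lemma descs_root_cube:
  assumes "r \<in> roots f n"
  shows "real (descs f n r) ^ 3 \<le> cluster_sum 3 f n"
proof -
  have "real (descs f n r) ^ 3 \<le> pochhammer (real (descs f n r)) 3"
    unfolding pochhammer_2_3 power3_eq_cube by (intro mult_mono) auto
  also have "\<dots> \<le> cluster_sum 3 f n"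
    unfolding cluster_sum_def using assms
    by (intro member_le_sum) (auto simp: pochhammer_2_3)
  finally show ?thesis .
qed

lemma card_reach_forest_cube:
  assumes f: "forest_fun n f" and x: "x \<in> {M<..n}"
  shows "real (card (reach (forest_edges f \<inter> Pow {M<..n}) {x})) ^ 3 \<le> cluster_sum 3 f n"
proof -
  have "reach (forest_edges f \<inter> Pow {0<..n}) {x} \<subseteq> {0<..n}"
    using forest_edges_restrict[OF f] x by (intro reach_subset) auto
  then have "card (reach (forest_edges f \<inter> Pow {M<..n}) {x}) \<le> card (reach (forest_edges f \<inter> Pow {0<..n}) {x})"
    by (intro card_mono reach_mono) (auto intro: finite_subset)
  also have "\<dots> \<le> descs f n (top_anc f 0 x)" using x by (intro card_reach_forest[OF f]) auto
  finally have "real (card (reach (forest_edges f \<inter> Pow {M<..n}) {x})) ^ 3 \<le> real (descs f n (top_anc f 0 x)) ^ 3"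
    by (intro power_mono) auto
  also have "\<dots> \<le> cluster_sum 3 f n"
    using x by (intro descs_root_cube top_anc_mem_roots[OF f]) auto
  finally show ?thesis .
qed

text \<open>The linear coefficient is exactly 1, so no part of the strict inequality
  \<open>rho < 1\<close> is lost; the whole excess sits in the quadratic term, which the third-order
  sum controls.\<close>

lemma exp_minus_one_le:
  fixes t :: real
  assumes "0 \<le> t"
  shows "exp t - 1 \<le> t + t\<^sup>2 * exp t"
proof -
  have "(1 - t) * exp t \<le> exp (- t) * exp t"
    using exp_ge_add_one_self[of "- t"] by (intro mult_right_mono) auto
  then have *: "exp t - 1 \<le> t * exp t" by (simp add: exp_minus algebra_simps)
  then have "t * (exp t - 1) \<le> t * (t * exp t)" using assms by (rule mult_left_mono)
  then show ?thesis using * by (simp add: algebra_simps power2_eq_square)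
qed

lemma prob_random_subset_restrict:
  assumes "forest_fun n f"
  shows "measure_pmf.prob (random_subset p (pairs {1..n})) {S. P (reach ((forest_edges f \<union> S) \<inter> Pow {M<..n}) {x})} =
    measure_pmf.prob (random_subset p (pairs {M<..n})) {S. P (reach ((forest_edges f \<inter> Pow {M<..n}) \<union> S) {x})}"
proof -
  have sub: "pairs {M<..n} \<subseteq> pairs {1..n}" by (intro pairs_mono) auto
  have *: "(forest_edges f \<union> S) \<inter> Pow {M<..n} = (forest_edges f \<inter> Pow {M<..n}) \<union> (S \<inter> pairs {M<..n})"
    if "S \<subseteq> pairs {1..n}" for S
    using that by (auto simp: pairs_def)
  have "measure_pmf.prob (random_subset p (pairs {1..n})) {S. P (reach ((forest_edges f \<union> S) \<inter> Pow {M<..n}) {x})} =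
    measure_pmf.prob (random_subset p (pairs {1..n})) {S. P (reach ((forest_edges f \<inter> Pow {M<..n}) \<union> (S \<inter> pairs {M<..n})) {x})}"
  proof (intro prob_cong_pmf)
    fix S assume "S \<in> set_pmf (random_subset p (pairs {1..n}))"
    then have "S \<subseteq> pairs {1..n}" using set_random_subset[of "pairs {1..n}" p] by auto
    then show "S \<in> {S. P (reach ((forest_edges f \<union> S) \<inter> Pow {M<..n}) {x})} \<longleftrightarrow>
      S \<in> {S. P (reach ((forest_edges f \<inter> Pow {M<..n}) \<union> (S \<inter> pairs {M<..n})) {x})}"
      using * by simp
  qed
  also have "\<dots> = measure_pmf.prob (map_pmf (\<lambda>S. S \<inter> pairs {M<..n}) (random_subset p (pairs {1..n})))
      {S. P (reach ((forest_edges f \<inter> Pow {M<..n}) \<union> S) {x})}"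
    by simp
  also have "map_pmf (\<lambda>S. S \<inter> pairs {M<..n}) (random_subset p (pairs {1..n})) = random_subset p (pairs {M<..n})"
    using sub by (intro random_subset_inter) auto
  finally show ?thesis .
qed

text \<open>Exponential moments are taken at rate \<open>a\<close>, of which a constant fraction \<open>th\<close> survives because
  the clusters are subcritical, \<open>p S\<^sub>2 \<le> rho < 1\<close>.\<close>

lemma prob_reach_large:
  fixes p rho a z s :: real
  assumes f: "forest_fun n f" and p: "0 \<le> p" "p \<le> 1" and rho: "0 \<le> rho" "rho < 1" and a: "0 < a"
    and S2: "p * (cluster_sum 2 f n - n) \<le> rho"
    and S3: "p * a * cluster_sum 3 f n * exp (a * z) \<le> (1 - rho) / 2"
    and z: "\<And>m. m \<in> {M<..n} \<Longrightarrow> real (descs f n m) \<le> z"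
    and x: "x \<in> {M<..n}"
  shows "measure_pmf.prob (random_subset p (pairs {1..n}))
      {S. s \<le> real (card (reach ((forest_edges f \<union> S) \<inter> Pow {M<..n}) {x}))}
    \<le> exp (a * z - (1 - rho) / 2 * a * s)"
proof -
  define V where "V = {M<..n}"
  define A where "A = forest_edges f \<inter> Pow V"
  \<comment> \<open>In the exploration condition \<open>H\<close> the linear terms cost
    \<open>rho * a\<close> and the quadratic ones at most \<open>(1 - rho) / 2 * a\<close>, together
    exactly \<open>h\<close>. What remains of the rate \<open>a\<close> is
    \<open>th\<close>.\<close>
  define th where "th = (1 - rho) / 2 * a"
  define h where "h = (1 + rho) / 2 * a"
  have th: "0 < th" and h: "0 \<le> h" and tha: "th + h = a"
    using rho a by (auto simp: th_def h_def field_simps)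
  have AV: "A \<subseteq> pairs V" unfolding A_def V_def by (rule forest_edges_restrict[OF f])
  let ?k = "\<lambda>u. real (card (reach A {u}))"
  have kz: "?k u \<le> z" if "u \<in> V" for u
  proof -
    have "top_anc f M u \<in> {M<..n}"
      using top_anc_in[of M u f] anc_le[of "top_anc f M u" f u] that by (auto simp: V_def)
    then have "real (descs f n (top_anc f M u)) \<le> z" by (rule z)
    then show ?thesis
      using card_reach_forest[OF f, of u M] that by (simp add: A_def V_def)
  qed
  have 1: "exp (sum (\<lambda>_. th) (reach A {u}) + h * ?k u) - 1 \<le> a * ?k u + (a * exp (a * z)) * (a * (?k u)\<^sup>2)"
    if "u \<in> V" for u
  proof -
    have "sum (\<lambda>_. th) (reach A {u}) + h * ?k u = a * ?k u"
      by (simp add: tha[symmetric] algebra_simps)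
    then have "exp (sum (\<lambda>_. th) (reach A {u}) + h * ?k u) - 1 \<le> a * ?k u + (a * ?k u)\<^sup>2 * exp (a * ?k u)"
      using a exp_minus_one_le[of "a * ?k u"] by simp
    also have "(a * ?k u)\<^sup>2 * exp (a * ?k u) \<le> (a * ?k u)\<^sup>2 * exp (a * z)"
      using kz[OF that] a by (intro mult_left_mono) auto
    finally show ?thesis by (simp add: power2_eq_square mult_ac)
  qed
  have "(\<Sum>u\<in>V. exp (sum (\<lambda>_. th) (reach A {u}) + h * ?k u) - 1) \<le>
      (\<Sum>u\<in>V. a * ?k u + (a * exp (a * z)) * (a * (?k u)\<^sup>2))"
    using 1 by (rule sum_mono)
  also have "\<dots> = a * (\<Sum>u\<in>V. ?k u) + (a * exp (a * z)) * (a * (\<Sum>u\<in>V. (?k u)\<^sup>2))"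
    by (simp only: sum.distrib sum_distrib_left)
  also have "\<dots> \<le> a * (cluster_sum 2 f n - n) + (a * exp (a * z)) * (a * cluster_sum 3 f n)"
    unfolding A_def V_def using a sum_reach_forest_1[OF f, of M] sum_reach_forest_2[OF f, of M]
    by (intro add_mono mult_left_mono) auto
  finally have "p * (\<Sum>u\<in>V. exp (sum (\<lambda>_. th) (reach A {u}) + h * ?k u) - 1) \<le>
      p * (a * (cluster_sum 2 f n - n) + (a * exp (a * z)) * (a * cluster_sum 3 f n))"
    using p(1) by (rule mult_left_mono)
  also have "\<dots> = a * (p * (cluster_sum 2 f n - n) + p * a * cluster_sum 3 f n * exp (a * z))"
    by (simp add: algebra_simps)
  also have "\<dots> \<le> a * (rho + (1 - rho) / 2)"
    using a S2 S3 by (intro mult_left_mono add_mono) auto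
  also have "\<dots> = h" by (simp add: h_def field_simps)
  finally have H: "p * (\<Sum>u\<in>V. exp (sum (\<lambda>_. th) (reach A {u}) + h * ?k u) - 1) \<le> h" .
  have E: "measure_pmf.expectation (random_subset p (pairs V)) (\<lambda>S. exp (sum (\<lambda>_. th) (reach (A \<union> S) {x})))
      \<le> exp (sum (\<lambda>_. th) (reach A {x}) + h * ?k x)"
    using AV p h th H x by (intro exploration) (auto simp: V_def)
  have "measure_pmf.prob (random_subset p (pairs {1..n}))
      {S. s \<le> real (card (reach ((forest_edges f \<union> S) \<inter> Pow V) {x}))} =
    measure_pmf.prob (random_subset p (pairs V)) {S. s \<le> real (card (reach (A \<union> S) {x}))}"
    unfolding V_def A_def by (rule prob_random_subset_restrict[OF f])
  also have "\<dots> \<le> measure_pmf.expectation (random_subset p (pairs V))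
      (\<lambda>S. exp (- th * s) * exp (sum (\<lambda>_. th) (reach (A \<union> S) {x})))"
    using th by (intro prob_le_expectation) (auto simp: V_def mult_exp_exp)
  also have "\<dots> = exp (- th * s) * measure_pmf.expectation (random_subset p (pairs V))
      (\<lambda>S. exp (sum (\<lambda>_. th) (reach (A \<union> S) {x})))"
    by (rule integral_mult_right_zero)
  also have "\<dots> \<le> exp (- th * s) * exp (sum (\<lambda>_. th) (reach A {x}) + h * ?k x)"
    using E by (intro mult_left_mono) auto
  also have "\<dots> = exp (- th * s) * exp (a * ?k x)"
    by (simp add: tha[symmetric] algebra_simps)
  also have "\<dots> \<le> exp (- th * s) * exp (a * z)"
    using kz[of x] x a by (intro mult_left_mono) (auto simp: V_def)
  also have "\<dots> = exp (a * z - (1 - rho) / 2 * a * s)"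
    by (simp add: mult_exp_exp th_def)
  finally show ?thesis by (simp add: V_def)
qed

text \<open>Giving the target cluster total weight \<open>ln 2\<close> turns the exponential moment into
  \<open>1 + \<close> the connection probability.\<close>

lemma prob_reach_other:
  fixes p rho h z :: real
  assumes f: "forest_fun n f" and p: "0 \<le> p" "p \<le> 1" and rho: "rho < 1" and h: "0 < h" "h * z \<le> 1"
    and S2: "p * (cluster_sum 2 f n - n) \<le> rho"
    and S3: "p * (3 * h) * cluster_sum 3 f n \<le> (1 - rho) / 2"
    and z: "cluster_sum 3 f n \<le> z ^ 3" "0 \<le> z" "p * (3 * z) \<le> (1 - rho) / 2 * h"
    and x: "x \<in> {M<..n}" and y: "y \<in> {M<..n}" and top: "top_anc f M x \<noteq> top_anc f M y"
  shows "measure_pmf.prob (random_subset p (pairs {1..n}))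
      {S. y \<in> reach ((forest_edges f \<union> S) \<inter> Pow {M<..n}) {x}} \<le> exp (h * z) - 1"
proof -
  define V where "V = {M<..n}"
  define A where "A = forest_edges f \<inter> Pow V"
  define Y where "Y = reach A {y}"
  \<comment> \<open>A cluster of \<open>A\<close> is \<open>Y\<close> or disjoint from
    \<open>Y\<close>, so on each of them the weight is exactly \<open>ln 2\<close> or 0.\<close>
  define th where "th v = (if v \<in> Y then ln 2 / card Y else 0)" for v
  have AV: "A \<subseteq> pairs V" unfolding A_def V_def by (rule forest_edges_restrict[OF f])
  have YV: "Y \<subseteq> V" unfolding Y_def using AV y by (intro reach_subset) (auto simp: V_def)
  have finY: "finite Y" by (rule finite_subset[OF YV]) (simp add: V_def)
  have yY: "y \<in> Y" by (simp add: Y_def)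
  have cY: "0 < card Y" using finY yY card_gt_0_iff by blast
  have thY: "sum th B = real (card (B \<inter> Y)) / card Y * ln 2" if "finite B" for B
    using that by (simp add: th_def sum.If_cases)
  have fin: "finite (reach (A \<union> S) {u})" if "S \<subseteq> pairs V" "u \<in> V" for S u
    using AV that by (intro finite_subset[OF reach_subset[of _ V]]) (auto simp: V_def)
  let ?k = "\<lambda>u. real (card (reach A {u}))"
  have kz: "?k u \<le> z" if "u \<in> V" for u
  proof (rule power_le_imp_le_base[of _ 2])
    have "?k u ^ 3 \<le> z ^ 3"
      using card_reach_forest_cube[OF f, of u M] z(1) that by (simp add: A_def V_def)
    then show "?k u ^ Suc 2 \<le> z ^ Suc 2" by (simp add: numeral_eq_Suc)
  qed (rule z)
  have in_Y: "sum th (reach A {u}) = (if u \<in> Y then ln 2 else 0)" if "u \<in> V" for u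
  proof (cases "u \<in> Y")
    case True
    then have "reach A {u} = Y" unfolding Y_def by (rule reach_eq)
    then show ?thesis using thY[OF finY] cY True by simp
  next
    case False
    have "reach A {u} \<inter> Y = {}"
    proof (rule ccontr)
      assume "reach A {u} \<inter> Y \<noteq> {}"
      then obtain w where "w \<in> reach A {u}" "w \<in> reach A {y}" by (auto simp: Y_def)
      then have "u \<in> Y" unfolding Y_def using reach_sym reach_trans by metis
      then show False using False by simp
    qed
    then show ?thesis using thY[of "reach A {u}"] fin[of "{}" u] that False by simp
  qed
  \<comment> \<open>\<open>h * z \<le> 1\<close> bounds the exponential by
    \<open>exp 1 \<le> 3\<close>. On \<open>Y\<close> the value doubles, and the surplus
    \<open>exp (h * ?k u)\<close> is the 3 of the last summand.\<close>
  have 1: "exp (sum th (reach A {u}) + h * ?k u) - 1 \<le> (h * ?k u + 3 * h * h * (?k u)\<^sup>2) + (if u \<in> Y then 3 else 0)"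
    if u: "u \<in> V" for u
  proof -
    have "h * ?k u \<le> h * z" using kz[OF u] h by (intro mult_left_mono) auto
    then have "h * ?k u \<le> 1" using h by linarith
    then have "exp (h * ?k u) \<le> exp 1" by simp
    then have e3: "exp (h * ?k u) \<le> 3" using exp_le by linarith
    have "exp (h * ?k u) - 1 \<le> h * ?k u + (h * ?k u)\<^sup>2 * exp (h * ?k u)"
      using h by (intro exp_minus_one_le) auto
    also have "\<dots> \<le> h * ?k u + (h * ?k u)\<^sup>2 * 3"
      using e3 by (intro add_left_mono mult_left_mono) auto
    finally have "exp (h * ?k u) - 1 \<le> h * ?k u + 3 * h * h * (?k u)\<^sup>2"
      by (simp add: power2_eq_square mult_ac)
    moreover have "exp (sum th (reach A {u}) + h * ?k u) = (if u \<in> Y then 2 else 1) * exp (h * ?k u)"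
      using in_Y[OF u] by (simp add: exp_add)
    ultimately show ?thesis using e3 by auto
  qed
  have "(\<Sum>u\<in>V. exp (sum th (reach A {u}) + h * ?k u) - 1) \<le>
      (\<Sum>u\<in>V. (h * ?k u + 3 * h * h * (?k u)\<^sup>2) + (if u \<in> Y then 3 else 0))"
    using 1 by (rule sum_mono)
  also have "\<dots> = h * (\<Sum>u\<in>V. ?k u) + 3 * h * h * (\<Sum>u\<in>V. (?k u)\<^sup>2) + (\<Sum>u\<in>V. if u \<in> Y then 3 else 0)"
    by (simp only: sum.distrib sum_distrib_left)
  also have "(\<Sum>u\<in>V. if u \<in> Y then 3 else 0 :: real) = 3 * ?k y"
    using YV by (simp add: V_def sum.If_cases Y_def Int_absorb1)
  also have "h * (\<Sum>u\<in>V. ?k u) + 3 * h * h * (\<Sum>u\<in>V. (?k u)\<^sup>2) + 3 * ?k y \<le>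
      h * (cluster_sum 2 f n - n) + 3 * h * h * cluster_sum 3 f n + 3 * z"
    using sum_reach_forest_1[OF f, of M] sum_reach_forest_2[OF f, of M] h kz[of y] y
    by (intro add_mono mult_left_mono) (auto simp: A_def V_def)
  finally have "p * (\<Sum>u\<in>V. exp (sum th (reach A {u}) + h * ?k u) - 1) \<le>
      p * (h * (cluster_sum 2 f n - n) + 3 * h * h * cluster_sum 3 f n + 3 * z)"
    using p(1) by (rule mult_left_mono)
  also have "\<dots> = h * (p * (cluster_sum 2 f n - n) + p * (3 * h) * cluster_sum 3 f n) + p * (3 * z)"
    by (simp add: algebra_simps)
  \<comment> \<open>The budget \<open>h\<close> is used up exactly: the share \<open>rho\<close> for
    the mean cluster size, one half of \<open>1 - rho\<close> for the quadratic error and the other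
    half for the surplus on \<open>Y\<close>.\<close>
  also have "\<dots> \<le> h * (rho + (1 - rho) / 2) + (1 - rho) / 2 * h"
    using h S2 S3 z by (intro add_mono mult_left_mono) auto
  also have "\<dots> = h" by (simp add: field_simps)
  finally have H: "p * (\<Sum>u\<in>V. exp (sum th (reach A {u}) + h * ?k u) - 1) \<le> h" .
  have xY: "x \<notin> Y"
    using reach_forest_top[OF f, of M y x] y top by (auto simp: Y_def A_def V_def)
  have "measure_pmf.expectation (random_subset p (pairs V)) (\<lambda>S. exp (sum th (reach (A \<union> S) {x})))
      \<le> exp (sum th (reach A {x}) + h * ?k x)"
    using AV p h H x by (intro exploration) (auto simp: V_def th_def)
  also have "\<dots> \<le> exp (h * z)"
    using in_Y[of x] xY x kz[of x] h by (simp add: V_def)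
  finally have E: "measure_pmf.expectation (random_subset p (pairs V)) (\<lambda>S. exp (sum th (reach (A \<union> S) {x}))) \<le> exp (h * z)" .
  have "measure_pmf.prob (random_subset p (pairs {1..n})) {S. y \<in> reach ((forest_edges f \<union> S) \<inter> Pow V) {x}} =
    measure_pmf.prob (random_subset p (pairs V)) {S. y \<in> reach (A \<union> S) {x}}"
    unfolding V_def A_def by (rule prob_random_subset_restrict[OF f])
  also have "\<dots> \<le> measure_pmf.expectation (random_subset p (pairs V))
      (\<lambda>S. exp (sum th (reach (A \<union> S) {x})) + (- 1))"
  proof (rule prob_le_expectation)
    fix S assume "S \<in> set_pmf (random_subset p (pairs V))"
    then have S: "S \<subseteq> pairs V" using set_random_subset[of "pairs V" p] by (auto simp: V_def)
    have "0 \<le> sum th (reach (A \<union> S) {x})" by (intro sum_nonneg) (simp add: th_def)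
    then show "0 \<le> exp (sum th (reach (A \<union> S) {x})) + (- 1)" by simp
    assume "S \<in> {S. y \<in> reach (A \<union> S) {x}}"
    then have yx: "reach (A \<union> S) {x} = reach (A \<union> S) {y}" using reach_eq by fastforce
    have "Y \<subseteq> reach (A \<union> S) {x}" unfolding yx Y_def by (rule reach_mono) auto
    then have "sum th (reach (A \<union> S) {x}) = ln 2"
      using thY[of "reach (A \<union> S) {x}"] fin[OF S, of x] x cY by (simp add: V_def Int_absorb1)
    then show "1 \<le> exp (sum th (reach (A \<union> S) {x})) + (- 1)" by simp
  qed (simp add: V_def)
  also have "\<dots> = measure_pmf.expectation (random_subset p (pairs V))
      (\<lambda>S. exp (sum th (reach (A \<union> S) {x}))) + (- 1)"
    by (subst expectation_add_finite) (auto simp: V_def)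
  finally show ?thesis using E by (simp add: V_def)
qed

section \<open>Components and centrality\<close>

lemma graph_components_reach:
  assumes "finite_graph G"
  shows "graph_components G = (\<lambda>x. reach (edges G) {x}) ` verts G"
proof -
  have "joined G `` {x} = reach (edges G) {x}" if "x \<in> verts G" for x
  proof -
    have "reach (edges G) {x} \<subseteq> verts G"
      using assms that by (intro reach_subset) (auto simp: finite_graph_def)
    then show ?thesis using that by (auto simp: joined_def reach_def adj_def)
  qed
  then show ?thesis by (auto simp: graph_components_def quotient_def)
qed

lemma finite_graph_induced:
  "finite_graph G \<Longrightarrow> W \<subseteq> verts G \<Longrightarrow> finite_graph (induced G W)"
  by (auto simp: finite_graph_def induced_def pairs_def intro: finite_subset)

lemma reach_within:
  assumes "reach E W \<subseteq> X"
  shows "reach E W = reach (E \<inter> Pow X) W"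
proof (rule antisym)
  show "reach E W \<subseteq> reach (E \<inter> Pow X) W"
  proof (rule reach_least)
    fix a b assume a: "a \<in> reach (E \<inter> Pow X) W" and e: "{a, b} \<in> E"
    have "a \<in> reach E W" using a reach_mono[of "E \<inter> Pow X" E W W] by auto
    then have "a \<in> X" "b \<in> X" using assms reach_step[OF _ e] by auto
    then show "b \<in> reach (E \<inter> Pow X) W" using e by (intro reach_step[OF a]) auto
  qed (rule reach_refl)
qed (rule reach_mono, auto)

lemma graph_components_subset:
  assumes "finite_graph G" "C \<in> graph_components G"
  shows "C \<subseteq> verts G"
proof -
  obtain x where "C = reach (edges G) {x}" "x \<in> verts G"
    using assms by (auto simp: graph_components_reach)
  then show ?thesis
    using reach_subset[of "edges G" "verts G" "{x}"] assms(1) by (simp add: finite_graph_def)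
qed

lemma card_psi_ge:
  assumes "finite_graph R" "C \<subseteq> verts R" "u \<in> C - {v}"
  shows "card (reach (edges R \<inter> Pow (C - {v})) {u}) \<le> psi (induced R C) v"
proof -
  let ?G = "induced (induced R C) (verts (induced R C) - {v})"
  have G: "?G = (C - {v}, edges R \<inter> Pow (C - {v}))"
    by (auto simp: induced_def)
  have "finite_graph ?G" using assms by (intro finite_graph_induced) (auto simp: induced_def)
  then have comps: "graph_components ?G = (\<lambda>u. reach (edges R \<inter> Pow (C - {v})) {u}) ` (C - {v})"
    by (simp add: graph_components_reach G)
  have "finite C" using assms by (auto simp: finite_graph_def intro: finite_subset)
  then show ?thesis
    unfolding psi_def comps using assms(3) by (intro Max_ge) auto
qed

lemma psi_le:
  assumes "finite_graph R" "C \<subseteq> verts R"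
    and "\<And>u. u \<in> C - {v} \<Longrightarrow> real (card (reach (edges R \<inter> Pow (C - {v})) {u})) \<le> b" "0 \<le> b"
  shows "real (psi (induced R C) v) \<le> b"
proof -
  let ?G = "induced (induced R C) (verts (induced R C) - {v})"
  have G: "?G = (C - {v}, edges R \<inter> Pow (C - {v}))"
    by (auto simp: induced_def)
  have "finite_graph ?G" using assms by (intro finite_graph_induced) (auto simp: induced_def)
  then have comps: "graph_components ?G = (\<lambda>u. reach (edges R \<inter> Pow (C - {v})) {u}) ` (C - {v})"
    by (simp add: graph_components_reach G)
  have "finite C" using assms by (auto simp: finite_graph_def intro: finite_subset)
  then have "psi (induced R C) v \<in> insert 0 (card ` graph_components ?G)"
    unfolding psi_def comps by (intro Max_in) auto
  then have "psi (induced R C) v = 0 \<or>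
      (\<exists>u\<in>C - {v}. psi (induced R C) v = card (reach (edges R \<inter> Pow (C - {v})) {u}))"
    unfolding comps by blast
  then show ?thesis
  proof
    assume "\<exists>u\<in>C - {v}. psi (induced R C) v = card (reach (edges R \<inter> Pow (C - {v})) {u})"
    then obtain u where "u \<in> C - {v}" "psi (induced R C) v = card (reach (edges R \<inter> Pow (C - {v})) {u})"
      by blast
    then show ?thesis using assms(3)[of u] by simp
  qed (use assms(4) in simp)
qed

text \<open>A deterministic reason for the algorithm to list \<open>x\<close> among the first
  \<open>card S\<close> in both rankings. Components tied with that of \<open>x\<close> must meet
  \<open>S\<close> as well and the comparison of \<open>psi\<close> is strict, so every way of
  breaking ties is covered.\<close>

definition root_certificate :: "'a ugraph \<Rightarrow> 'a \<Rightarrow> 'a set \<Rightarrow> bool" where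
  "root_certificate R x S \<longleftrightarrow> x \<in> S \<and> S \<subseteq> verts R \<and>
    (\<forall>D\<in>graph_components R. card (reach (edges R) {x}) \<le> card D \<longrightarrow> D \<inter> S \<noteq> {}) \<and>
    (\<forall>v\<in>reach (edges R) {x} - S.
      psi (induced R (reach (edges R) {x})) x < psi (induced R (reach (edges R) {x})) v)"

lemma graph_components_disjoint:
  assumes "finite_graph G" "C \<in> graph_components G" "D \<in> graph_components G" "z \<in> C" "z \<in> D"
  shows "C = D"
proof -
  obtain a b where "C = reach (edges G) {a}" "D = reach (edges G) {b}"
    using assms(2,3) by (auto simp: graph_components_reach[OF assms(1)])
  then show ?thesis using assms(4,5) reach_eq by metis
qed

text \<open>Components ranked before that of \<open>x\<close> are disjoint, avoid \<open>x\<close>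
  and meet \<open>S\<close>, so choosing a point of \<open>S\<close> in each injects them into
  \<open>S - {x}\<close>. Vertices ranked before \<open>x\<close> inside its component lie in
  \<open>S - {x}\<close> directly. Both counts are below \<open>M\<close>.\<close>

lemma root_certificate_found:
  assumes R: "finite_graph R" and S: "card S \<le> M" "root_certificate R x S"
  shows "x \<in> (\<Union>C\<in>largest_components \<rho> M R. TopJ \<tau> M (induced R C))"
proof -
  define C where "C = reach (edges R) {x}"
  have x: "x \<in> S" "x \<in> verts R" and SV: "S \<subseteq> verts R"
    and big: "\<And>D. D \<in> graph_components R \<Longrightarrow> card C \<le> card D \<Longrightarrow> D \<inter> S \<noteq> {}"
    and ps: "\<And>v. v \<in> C - S \<Longrightarrow> psi (induced R C) x < psi (induced R C) v"
    using S(2) by (auto simp: root_certificate_def C_def)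
  have finS: "finite S" using SV R by (auto simp: finite_graph_def intro: finite_subset)
  then have less: "card (S - {x}) < M"
    using x S(1) card_Diff1_less[of S x] by linarith
  have C: "C \<in> graph_components R" unfolding graph_components_reach[OF R] C_def using x by auto
  have xC: "x \<in> C" by (simp add: C_def)
  let ?Ds = "{D \<in> graph_components R. card D > card C \<or> card D = card C \<and> \<rho> R D < \<rho> R C}"
  define r where "r D = (SOME s. s \<in> D \<inter> S)" for D
  have r: "r D \<in> D \<inter> S" if "D \<in> ?Ds" for D
  proof -
    have "card C \<le> card D" using that by auto
    then have "\<exists>s. s \<in> D \<inter> S" using big[of D] that by blast
    then show ?thesis unfolding r_def by (rule someI_ex)
  qed
  have "card ?Ds \<le> card (S - {x})"
  proof (rule card_inj_on_le)
    show "inj_on r ?Ds"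
    proof (rule inj_onI)
      fix D D' assume D: "D \<in> ?Ds" and D': "D' \<in> ?Ds" and eq: "r D = r D'"
      have "r D \<in> D" "r D \<in> D'" using r[OF D] r[OF D'] eq by auto
      then show "D = D'" using D D' graph_components_disjoint[OF R, of D D' "r D"] by auto
    qed
    show "r ` ?Ds \<subseteq> S - {x}"
    proof
      fix s assume "s \<in> r ` ?Ds"
      then obtain D where D: "D \<in> ?Ds" "s = r D" by auto
      have "x \<notin> D" using D(1) graph_components_disjoint[OF R C, of D x] xC by auto
      then show "s \<in> S - {x}" using r[OF D(1)] D(2) by auto
    qed
  qed (use finS in simp)
  then have "C \<in> largest_components \<rho> M R"
    using C less by (auto simp: largest_components_def first_by_def)
  moreover have "card {w \<in> C. psi (induced R C) w < psi (induced R C) x \<or>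
      psi (induced R C) w = psi (induced R C) x \<and> \<tau> (induced R C) w < \<tau> (induced R C) x} \<le> card (S - {x})"
  proof (intro card_mono subsetI)
    fix w assume w: "w \<in> {w \<in> C. psi (induced R C) w < psi (induced R C) x \<or>
      psi (induced R C) w = psi (induced R C) x \<and> \<tau> (induced R C) w < \<tau> (induced R C) x}"
    then have "w \<in> S" using ps[of w] by (cases "w \<in> S") auto
    then show "w \<in> S - {x}" using w by auto
  qed (use finS in simp)
  then have "x \<in> TopJ \<tau> M (induced R C)"
    using less xC by (auto simp: TopJ_def first_by_def induced_def)
  ultimately show ?thesis by auto
qed

text \<open>Under a strict linear order the number of predecessors is an injective rank, and it
  stays below \<open>k\<close> on the output.\<close>

lemma card_first_by:
  assumes "finite A" and irr: "\<And>x. x \<in> A \<Longrightarrow> \<not> before x x"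
    and tr: "\<And>x y z. x \<in> A \<Longrightarrow> y \<in> A \<Longrightarrow> z \<in> A \<Longrightarrow> before x y \<Longrightarrow> before y z \<Longrightarrow> before x z"
    and lin: "\<And>x y. x \<in> A \<Longrightarrow> y \<in> A \<Longrightarrow> x \<noteq> y \<Longrightarrow> before x y \<or> before y x"
  shows "card (first_by before k A) \<le> k"
proof -
  let ?rk = "\<lambda>x. card {y \<in> A. before y x}"
  have mono: "?rk x < ?rk y" if "x \<in> A" "y \<in> A" "before x y" for x y
  proof (rule psubset_card_mono)
    show "{z \<in> A. before z x} \<subset> {z \<in> A. before z y}"
      using that tr irr by blast
  qed (use assms(1) in simp)
  have "card (first_by before k A) \<le> card {..<k}"
  proof (rule card_inj_on_le)
    show "inj_on ?rk (first_by before k A)"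
    proof (rule inj_onI)
      fix x y assume xy: "x \<in> first_by before k A" "y \<in> first_by before k A" "?rk x = ?rk y"
      then have A: "x \<in> A" "y \<in> A" by (auto simp: first_by_def)
      show "x = y"
      proof (rule ccontr)
        assume "x \<noteq> y"
        then have "?rk x < ?rk y \<or> ?rk y < ?rk x" using lin[OF A] mono[OF A] mono[OF A(2,1)] by blast
        then show False using xy(3) by simp
      qed
    qed
    show "?rk ` first_by before k A \<subseteq> {..<k}" by (auto simp: first_by_def)
  qed simp
  then show ?thesis by simp
qed

lemma card_root_set:
  assumes R: "finite_graph R" and \<rho>: "component_rule \<rho>" and \<tau>: "vertex_rule \<tau>"
  shows "finite (\<Union>C\<in>largest_components \<rho> K R. TopJ \<tau> L (induced R C))" (is ?fin)
    and "card (\<Union>C\<in>largest_components \<rho> K R. TopJ \<tau> L (induced R C)) \<le> K * L" (is ?card)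
proof -
  have comps: "finite (graph_components R)" "\<And>C. C \<in> graph_components R \<Longrightarrow> C \<subseteq> verts R"
    using R graph_components_subset[OF R] by (simp_all add: graph_components_reach finite_graph_def)
  have sub: "largest_components \<rho> K R \<subseteq> graph_components R"
    by (auto simp: largest_components_def first_by_def)
  have fin: "finite (largest_components \<rho> K R)" using sub comps(1) by (rule finite_subset)
  have K: "card (largest_components \<rho> K R) \<le> K"
    unfolding largest_components_def
  proof (rule card_first_by[OF comps(1)])
    have inj: "inj_on (\<rho> R) (graph_components R)" using \<rho> R unfolding component_rule_def by blast
    fix C D assume "C \<in> graph_components R" "D \<in> graph_components R" "C \<noteq> D"
    then have "\<rho> R C \<noteq> \<rho> R D" using inj_onD[OF inj, of C D] by blast
    then show "(card D < card C \<or> card C = card D \<and> \<rho> R C < \<rho> R D) \<or>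
      (card C < card D \<or> card D = card C \<and> \<rho> R D < \<rho> R C)" by auto
  qed auto
  have L: "finite (TopJ \<tau> L (induced R C)) \<and> card (TopJ \<tau> L (induced R C)) \<le> L"
    if "C \<in> largest_components \<rho> K R" for C
  proof
    have CV: "C \<subseteq> verts R" using sub comps(2) that by blast
    have fG: "finite_graph (induced R C)" using R CV by (rule finite_graph_induced)
    then have finC: "finite (verts (induced R C))" by (simp add: finite_graph_def)
    then show "finite (TopJ \<tau> L (induced R C))" by (auto simp: TopJ_def first_by_def)
    show "card (TopJ \<tau> L (induced R C)) \<le> L"
      unfolding TopJ_def
    proof (rule card_first_by[OF finC])
      have inj: "inj_on (\<tau> (induced R C)) (verts (induced R C))" using \<tau> fG unfolding vertex_rule_def by blast
      fix v w assume "v \<in> verts (induced R C)" "w \<in> verts (induced R C)" "v \<noteq> w"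
      then have "\<tau> (induced R C) v \<noteq> \<tau> (induced R C) w" using inj_onD[OF inj, of v w] by blast
      then show "(psi (induced R C) v < psi (induced R C) w \<or>
          psi (induced R C) v = psi (induced R C) w \<and> \<tau> (induced R C) v < \<tau> (induced R C) w) \<or>
        (psi (induced R C) w < psi (induced R C) v \<or>
          psi (induced R C) w = psi (induced R C) v \<and> \<tau> (induced R C) w < \<tau> (induced R C) v)"
        by auto
    qed auto
  qed
  show ?fin using fin L by auto
  have "card (\<Union>C\<in>largest_components \<rho> K R. TopJ \<tau> L (induced R C)) \<le>
      (\<Sum>C\<in>largest_components \<rho> K R. card (TopJ \<tau> L (induced R C)))"
    by (rule card_UN_le[OF fin])
  also have "\<dots> \<le> (\<Sum>C\<in>largest_components \<rho> K R. L)" using L by (intro sum_mono) auto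
  also have "\<dots> \<le> K * L" using K by simp
  finally show ?card .
qed

section \<open>Isomorphism invariance\<close>

lemma reach_image_subset:
  "g ` reach E {x} \<subseteq> reach ((`) g ` E) {g x}"
proof -
  have "reach E {x} \<subseteq> {y. g y \<in> reach ((`) g ` E) {g x}}"
  proof (rule reach_least)
    fix a b assume "a \<in> {y. g y \<in> reach ((`) g ` E) {g x}}" "{a, b} \<in> E"
    then have ga: "g a \<in> reach ((`) g ` E) {g x}" and "g ` {a, b} \<in> (`) g ` E" by blast+
    then have "{g a, g b} \<in> (`) g ` E" by simp
    with ga have "g b \<in> reach ((`) g ` E) {g x}" by (rule reach_step)
    then show "b \<in> {y. g y \<in> reach ((`) g ` E) {g x}}" by simp
  qed simp
  then show ?thesis by auto
qed

lemma reach_image: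
  assumes inj: "inj_on g V" and E: "E \<subseteq> Pow V" and x: "x \<in> V"
  shows "reach ((`) g ` E) {g x} = g ` reach E {x}"
proof
  let ?h = "inv_into V g"
  have "?h ` reach ((`) g ` E) {g x} \<subseteq> reach ((`) ?h ` (`) g ` E) {?h (g x)}"
    by (rule reach_image_subset)
  also have "(`) ?h ` (`) g ` E = E"
  proof -
    have "?h ` g ` e = e" if "e \<in> E" for e
      using that E inj by (intro inv_into_image_cancel) auto
    then show ?thesis by (simp add: image_image)
  qed
  also have "?h (g x) = x" using inj x by simp
  finally have "?h ` reach ((`) g ` E) {g x} \<subseteq> reach E {x}" .
  moreover have "reach ((`) g ` E) {g x} \<subseteq> g ` V"
  proof (rule reach_least)
    fix a b assume "{a, b} \<in> (`) g ` E"
    then obtain e where "{a, b} = g ` e" "e \<subseteq> V" using E by blast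
    then show "b \<in> g ` V" by blast
  qed (use x in simp)
  then have "y = g (?h y)" if "y \<in> reach ((`) g ` E) {g x}" for y
    using that by (metis f_inv_into_f subsetD)
  ultimately show "reach ((`) g ` E) {g x} \<subseteq> g ` reach E {x}" by blast
qed (rule reach_image_subset)

lemma graph_components_iso:
  assumes G: "finite_graph G" "finite_graph G'" and g: "graph_iso g G G'"
  shows "graph_components G' = (`) g ` graph_components G"
proof -
  have g': "inj_on g (verts G)" "verts G' = g ` verts G" "edges G' = (`) g ` edges G"
    using g by (auto simp: graph_iso_def bij_betw_def)
  have "reach (edges G') {g x} = g ` reach (edges G) {x}" if "x \<in> verts G" for x
    unfolding g'(3) using g'(1) G(1) that by (intro reach_image) (auto simp: finite_graph_def pairs_def)
  then show ?thesis
    unfolding graph_components_reach[OF G(1)] graph_components_reach[OF G(2)] g'(2)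
    by (auto simp: image_image)
qed

lemma graph_iso_induced:
  assumes g: "graph_iso g G G'" and G: "finite_graph G" and W: "W \<subseteq> verts G"
  shows "graph_iso g (induced G W) (induced G' (g ` W))"
proof -
  have g': "inj_on g (verts G)" "edges G' = (`) g ` edges G"
    using g by (auto simp: graph_iso_def bij_betw_def)
  have "e \<subseteq> W" if "e \<in> edges G" "g ` e \<subseteq> g ` W" for e
  proof -
    have "e \<subseteq> verts G" using G that(1) by (auto simp: finite_graph_def pairs_def)
    then show ?thesis using that(2) g'(1) W inj_on_image_subset_iff by metis
  qed
  then show ?thesis
    using g' W by (auto simp: graph_iso_def induced_def bij_betw_def intro: inj_on_subset)
qed

lemma psi_iso:
  assumes G: "finite_graph G" "finite_graph G'" and g: "graph_iso g G G'" and v: "v \<in> verts G"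
  shows "psi G' (g v) = psi G v"
proof -
  have g': "inj_on g (verts G)" "verts G' = g ` verts G"
    using g by (auto simp: graph_iso_def bij_betw_def)
  let ?W = "verts G - {v}"
  have W': "verts G' - {g v} = g ` ?W"
    using g' v by (auto simp: inj_on_def)
  have I: "finite_graph (induced G ?W)" "finite_graph (induced G' (g ` ?W))"
    using G g'(2) by (auto intro!: finite_graph_induced)
  have "graph_components (induced G' (g ` ?W)) = (`) g ` graph_components (induced G ?W)"
    using graph_iso_induced[OF g G(1)] by (intro graph_components_iso[OF I]) auto
  moreover have "card (g ` D) = card D" if "D \<in> graph_components (induced G ?W)" for D
  proof (rule card_image)
    have "D \<subseteq> ?W"
      using graph_components_subset[OF I(1) that] by (simp add: induced_def)
    then show "inj_on g D" using g'(1) by (auto intro: inj_on_subset)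
  qed
  ultimately show ?thesis
    unfolding psi_def W' by (simp add: image_image)
qed

text \<open>The algorithm sees only the representative graph, while certificates are established on
  the labeled one; this carries them over.\<close>

lemma root_certificate_iso:
  assumes G: "finite_graph G" "finite_graph G'" and g: "graph_iso g G G'" and c: "root_certificate G x S"
  shows "root_certificate G' (g x) (g ` S)"
proof -
  have g': "inj_on g (verts G)" "verts G' = g ` verts G" "edges G' = (`) g ` edges G"
    using g by (auto simp: graph_iso_def bij_betw_def)
  define C where "C = reach (edges G) {x}"
  have x: "x \<in> S" "x \<in> verts G" and SV: "S \<subseteq> verts G"
    and big: "\<And>D. D \<in> graph_components G \<Longrightarrow> card C \<le> card D \<Longrightarrow> D \<inter> S \<noteq> {}"
    and ps: "\<And>v. v \<in> C - S \<Longrightarrow> psi (induced G C) x < psi (induced G C) v"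
    using c unfolding root_certificate_def C_def[symmetric] by blast+
  note comp_sub = graph_components_subset[OF G(1)]
  have CG: "C \<in> graph_components G" using x by (auto simp: graph_components_reach[OF G(1)] C_def)
  have C': "reach (edges G') {g x} = g ` C"
    unfolding g'(3) C_def using g'(1) G(1) x(2) by (intro reach_image[of g "verts G"]) (auto simp: finite_graph_def pairs_def)
  have card: "card (g ` D) = card D" if "D \<in> graph_components G" for D
    by (rule card_image[OF inj_on_subset[OF g'(1) comp_sub[OF that]]])
  have CV: "C \<subseteq> verts G" using comp_sub[OF CG] .
  have I: "finite_graph (induced G C)" "finite_graph (induced G' (g ` C))"
    using G CV g'(2) by (auto intro!: finite_graph_induced)
  have psi: "psi (induced G' (g ` C)) (g v) = psi (induced G C) v" if "v \<in> C" for v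
    using that graph_iso_induced[OF g G(1) CV] by (intro psi_iso[OF I]) (auto simp: induced_def)
  have "D \<inter> g ` S \<noteq> {}" if D: "D \<in> graph_components G'" "card (g ` C) \<le> card D" for D
  proof -
    obtain D0 where D0: "D0 \<in> graph_components G" "D = g ` D0"
      using D(1) unfolding graph_components_iso[OF G g] by auto
    then have "card C \<le> card D0" using D(2) card CG by simp
    then show ?thesis using big[OF D0(1)] D0(2) by auto
  qed
  moreover have "psi (induced G' (g ` C)) (g x) < psi (induced G' (g ` C)) v'" if "v' \<in> g ` C - g ` S" for v'
  proof -
    obtain v where v: "v \<in> C - S" "v' = g v" using \<open>v' \<in> g ` C - g ` S\<close> by blast
    have "x \<in> C" by (simp add: C_def)
    then show ?thesis using psi[of x] psi[of v] ps[OF v(1)] v by simp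
  qed
  ultimately show ?thesis
    unfolding root_certificate_def C' using x SV g'(2) by auto
qed

section \<open>Certificates from a forest with added edges\<close>

text \<open>Parents decrease along the tree path, so it stays between \<open>m\<close> and
  \<open>x\<close>. The range is what later lets a path avoid vertex 1, or a vertex
  \<open>v > M\<close> when \<open>x \<le> M\<close>.\<close>

lemma anc_reach:
  assumes f: "forest_fun n f" and m: "m \<in> anc f x"
  shows "x \<in> reach (forest_edges f \<inter> Pow {m..x}) {m}"
  using m
proof (induction x rule: less_induct)
  case (less x)
  show ?case
  proof (cases "m = x")
    case False
    have fx: "0 < f x"
    proof (rule ccontr)
      assume "\<not> 0 < f x"
      then show False using less.prems False anc_root[of f x] by simp
    qed
    then have lt: "f x < x" using f by (rule forest_fun_less[rotated])
    have m: "m \<in> anc f (f x)" using less.prems False anc_step[of f x] fx lt by simp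
    have "f x \<in> reach (forest_edges f \<inter> Pow {m..f x}) {m}" using less.IH[OF lt m] .
    also have "\<dots> \<subseteq> reach (forest_edges f \<inter> Pow {m..x}) {m}"
      using lt by (intro reach_mono Int_mono Pow_mono) auto
    finally have "f x \<in> reach (forest_edges f \<inter> Pow {m..x}) {m}" .
    moreover have "{f x, x} \<in> forest_edges f \<inter> Pow {m..x}"
      using fx lt anc_le[OF m] by (auto simp: forest_edges_def)
    ultimately show ?thesis by (rule reach_step)
  qed simp
qed

text \<open>The level \<open>card C - s\<close> separates the root, whose \<open>psi\<close> is at
  most that, from the vertices beyond \<open>M\<close>, whose \<open>psi\<close> exceeds it.
  \<open>small\<close> serves twice: against components avoiding \<open>{1..M}\<close> and for the
  piece cut off with a late vertex. \<open>sep\<close> keeps early vertices attached to 1 through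
  early vertices, and \<open>ij\<close> keeps the two large pieces apart once 1 is deleted.\<close>

lemma root_certificate_forest:
  fixes s :: real
  assumes f: "forest_fun n f" and E: "forest_edges f \<subseteq> E" "E \<subseteq> pairs {1..n}" and M: "1 \<le> M" "M \<le> n"
    and small: "\<And>x. x \<in> {M<..n} \<Longrightarrow> real (card (reach (E \<inter> Pow {M<..n}) {x})) < s"
    and sep: "\<And>w. w \<in> {1..M} \<Longrightarrow> w \<in> reach E {1} \<Longrightarrow> top_anc f 0 w = top_anc f 0 1"
    and i: "2 \<le> i" "i \<le> n" "f i = 1" "s \<le> descs f n i"
    and j: "2 \<le> j" "j \<le> n" "f j = 1" "s \<le> descs f n j"
    and ij: "j \<notin> reach (E \<inter> Pow {1<..n}) {i}"
  shows "root_certificate ({1..n}, E) 1 {1..M}"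
proof -
  define R where "R = ({1..n}, E)"
  have R: "finite_graph R" and ER: "edges R = E" "verts R = {1..n}"
    using E by (auto simp: R_def finite_graph_def)
  define C where "C = reach E {1}"
  have CV: "C \<subseteq> {1..n}" unfolding C_def using E M by (intro reach_subset) auto
  have finC: "finite C" using CV by (rule finite_subset) simp
  have desc_C: "desc f n k \<subseteq> C" and desc_reach: "a \<in> desc f n k \<Longrightarrow> a \<in> reach (E \<inter> Pow {1<..n}) {k}"
    if k: "2 \<le> k" "f k = 1" for k a
  proof -
    show D: "a \<in> reach (E \<inter> Pow {1<..n}) {k}" if a: "a \<in> desc f n k" for a
    proof -
      have "a \<in> reach (forest_edges f \<inter> Pow {k..a}) {k}"
        using a by (intro anc_reach[OF f]) (simp add: desc_def)
      also have "\<dots> \<subseteq> reach (E \<inter> Pow {1<..n}) {k}"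
        using E(1) k a by (intro reach_mono) (auto simp: desc_def subset_eq)
      finally show ?thesis .
    qed
    have "{f k, k} \<in> forest_edges f" unfolding forest_edges_def using k by (intro imageI) simp
    then have "{1, k} \<in> E" using E(1) k by auto
    then have kC: "k \<in> C" unfolding C_def using reach_step[of 1 E "{1}" k] by simp
    show "desc f n k \<subseteq> C"
    proof
      fix a assume "a \<in> desc f n k"
      then have "a \<in> reach E {k}" using D reach_mono[of "E \<inter> Pow {1<..n}" E "{k}" "{k}"] by auto
      then show "a \<in> C" using kC unfolding C_def by (rule reach_trans[rotated])
    qed
  qed
  have "descs f n i \<le> card C"
    unfolding descs_def using desc_C[OF i(1,3)] finC by (rule card_mono[rotated])
  then have sC: "s \<le> card C" using i(4) by linarith
  have big: "D \<inter> {1..M} \<noteq> {}" if D: "D \<in> graph_components R" "card C \<le> card D" for D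
  proof
    assume e: "D \<inter> {1..M} = {}"
    obtain d where d: "D = reach E {d}" "d \<in> {1..n}"
      using D(1) unfolding graph_components_reach[OF R] ER by auto
    have "D \<subseteq> {1..n}" unfolding d(1) using E d(2) by (intro reach_subset) auto
    then have DM: "D \<subseteq> {M<..n}" using e by fastforce
    then have "D = reach (E \<inter> Pow {M<..n}) {d}" unfolding d(1) by (rule reach_within)
    moreover have "d \<in> D" by (simp add: d(1))
    then have "d \<in> {M<..n}" using DM by blast
    ultimately have "real (card D) < s" using small by auto
    then show False using D(2) sC by linarith
  qed
  have psi1: "real (psi (induced R C) 1) \<le> card C - s"
  proof (rule psi_le[OF R])
    fix u assume u: "u \<in> C - {1}"
    let ?D = "reach (E \<inter> Pow (C - {1})) {u}"
    have DC: "?D \<subseteq> C - {1}" using u by (intro reach_least) auto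
    \<comment> \<open>A piece meeting both descendant sets would connect \<open>i\<close> to
      \<open>j\<close> without vertex 1. So each piece misses a set of at least \<open>s\<close>
      vertices of \<open>C\<close>.\<close>
    have "?D \<inter> desc f n i = {} \<or> ?D \<inter> desc f n j = {}"
    proof (rule ccontr)
      assume "\<not> ?thesis"
      then obtain a b where a: "a \<in> ?D" "a \<in> desc f n i" and b: "b \<in> ?D" "b \<in> desc f n j" by auto
      have sub: "E \<inter> Pow (C - {1}) \<subseteq> E \<inter> Pow {1<..n}" using CV by fastforce
      have "b \<in> reach (E \<inter> Pow (C - {1})) {a}" using a(1) b(1) reach_sym reach_trans by metis
      then have "b \<in> reach (E \<inter> Pow {1<..n}) {a}" using reach_mono[OF sub, of "{a}" "{a}"] by auto
      moreover have "a \<in> reach (E \<inter> Pow {1<..n}) {i}" using desc_reach[OF i(1,3)] a(2) .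
      moreover have "j \<in> reach (E \<inter> Pow {1<..n}) {b}" using reach_sym[OF desc_reach[OF j(1,3) b(2)]] .
      ultimately show False using ij reach_trans by metis
    qed
    then obtain k where k: "?D \<inter> desc f n k = {}" "desc f n k \<subseteq> C" "s \<le> descs f n k"
      using desc_C[OF i(1,3)] desc_C[OF j(1,3)] i(4) j(4) by blast
    have "card ?D \<le> card (C - desc f n k)" using k(1) DC finC by (intro card_mono) auto
    also have "\<dots> = card C - descs f n k"
      unfolding descs_def using k(2) by (intro card_Diff_subset) auto
    finally have "card ?D \<le> card C - descs f n k" .
    moreover have "descs f n k \<le> card C" unfolding descs_def using k(2) finC by (intro card_mono)
    ultimately show "real (card (reach (edges R \<inter> Pow (C - {1})) {u})) \<le> card C - s"
      using k(3) unfolding ER by linarith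
  qed (use CV sC ER in auto)
  have psiv: "card C - s < real (psi (induced R C) v)" if v: "v \<in> C - {1..M}" for v
  proof -
    \<comment> \<open>\<open>D\<close> stays connected to 1 when \<open>v\<close> is deleted;
      \<open>B\<close> is \<open>v\<close> with all that is cut off. It remains to show that
      \<open>B\<close> has fewer than \<open>s\<close> vertices.\<close>
    define D where "D = reach (E \<inter> Pow (C - {v})) {1}"
    define B where "B = C - D"
    have v1: "v \<noteq> 1" "v \<in> C" "v \<in> {M<..n}" using v M CV by auto
    have 1: "1 \<in> C - {v}" using v1 by (simp add: C_def)
    have DC: "D \<subseteq> C - {v}" unfolding D_def using 1 by (intro reach_least) auto
    have vB: "v \<in> B" using DC v1 by (auto simp: B_def)
    \<comment> \<open>An early vertex of \<open>C\<close> belongs to the tree cluster of 1 by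
      \<open>sep\<close>. Its tree path to 1 uses labels at most \<open>M\<close> only, hence avoids
      \<open>v\<close>, so the vertex lies in \<open>D\<close>.\<close>
    have BM: "B \<subseteq> {M<..n}"
    proof
      fix w assume w: "w \<in> B"
      show "w \<in> {M<..n}"
      proof (rule ccontr)
        assume "w \<notin> {M<..n}"
        then have wM: "w \<in> {1..M}" using w CV by (auto simp: B_def)
        have wC: "w \<in> reach E {1}" using w by (simp add: B_def C_def)
        have "top_anc f 0 w = top_anc f 0 1" using wM wC by (rule sep)
        moreover have "top_anc f 0 1 \<in> anc f 1" by (rule IntD1[OF top_anc_in]) simp
        moreover have "anc f 1 = {1}"
        proof (rule anc_root)
          have "f 1 \<le> 1 - 1" using f unfolding forest_fun_def by blast
          then show "f 1 = 0" by simp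
        qed
        moreover have "top_anc f 0 w \<in> anc f w" using wM by (intro IntD1[OF top_anc_in]) simp
        ultimately have "1 \<in> anc f w" by simp
        then have w1: "w \<in> reach (forest_edges f \<inter> Pow {1..w}) {1}" by (rule anc_reach[OF f])
        have "reach (forest_edges f \<inter> Pow {1..w}) {1} \<subseteq> {1..w}" using wM by (intro reach_least) auto
        moreover have "reach (forest_edges f \<inter> Pow {1..w}) {1} \<subseteq> C"
          unfolding C_def using E(1) by (intro reach_mono) auto
        ultimately have "reach (forest_edges f \<inter> Pow {1..w}) {1} \<subseteq> C - {v}"
          using v1 wM by fastforce
        then have "reach (forest_edges f \<inter> Pow {1..w}) {1} =
            reach (forest_edges f \<inter> Pow {1..w} \<inter> Pow (C - {v})) {1}"
          by (rule reach_within)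
        also have "\<dots> \<subseteq> D" unfolding D_def using E(1) by (intro reach_mono) auto
        finally show False using w1 w by (auto simp: B_def)
      qed
    qed
    \<comment> \<open>All that is cut off hangs on \<open>v\<close> inside \<open>B\<close>: an edge
      leaving \<open>D\<close> within \<open>C\<close> can only end in \<open>v\<close>.\<close>
    have "C \<subseteq> D \<union> reach (E \<inter> Pow B) {v}"
      unfolding C_def
    proof (rule reach_least)
      show "{1} \<subseteq> D \<union> reach (E \<inter> Pow B) {v}" by (simp add: D_def)
      fix a b assume a: "a \<in> D \<union> reach (E \<inter> Pow B) {v}" and e: "{a, b} \<in> E"
      have RB: "reach (E \<inter> Pow B) {v} \<subseteq> B" using vB by (intro reach_least) auto
      have "a \<in> C" using a RB DC by (auto simp: B_def)
      then have bC: "b \<in> C" unfolding C_def using e by (rule reach_step)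
      show "b \<in> D \<union> reach (E \<inter> Pow B) {v}"
      proof (cases "a \<in> D")
        case True
        show ?thesis
        proof (cases "b = v")
          case False
          then have "{a, b} \<in> E \<inter> Pow (C - {v})" using e bC True DC by auto
          then have "b \<in> D" using True unfolding D_def by (rule reach_step[rotated])
          then show ?thesis by simp
        qed simp
      next
        case False
        then have aR: "a \<in> reach (E \<inter> Pow B) {v}" using a by auto
        show ?thesis
        proof (cases "b \<in> D")
          case False
          then have "{a, b} \<in> E \<inter> Pow B" using e bC aR RB by (auto simp: B_def)
          then have "b \<in> reach (E \<inter> Pow B) {v}" using aR by (rule reach_step[rotated])
          then show ?thesis by simp
        qed simp
      qed
    qed
    then have "B \<subseteq> reach (E \<inter> Pow B) {v}" by (auto simp: B_def)
    also have "\<dots> \<subseteq> reach (E \<inter> Pow {M<..n}) {v}" using BM by (intro reach_mono) auto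
    finally have "B \<subseteq> reach (E \<inter> Pow {M<..n}) {v}" .
    moreover have "finite (reach (E \<inter> Pow {M<..n}) {v})"
      by (rule finite_subset[of _ "{M<..n}"], rule reach_least) (use v1 in auto)
    ultimately have "card B \<le> card (reach (E \<inter> Pow {M<..n}) {v})" by (rule card_mono[rotated])
    then have Bs: "real (card B) < s" using small[OF v1(3)] by linarith
    have "card B = card C - card D" unfolding B_def using DC finC
      by (intro card_Diff_subset) (auto intro: finite_subset)
    moreover have "card D \<le> card C" using DC finC by (intro card_mono) auto
    moreover have "card D \<le> psi (induced R C) v"
      using card_psi_ge[OF R, of C 1 v] 1 CV unfolding ER D_def by auto
    ultimately show ?thesis using Bs by linarith
  qed
  show ?thesis
    unfolding root_certificate_def R_def[symmetric] ER C_def[symmetric]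
    using M big psi1 psiv by fastforce
qed

section \<open>The percolated graph as a forest with added edges\<close>

lemma expectation_lin2_finite:
  fixes f g :: "'a \<Rightarrow> real"
  assumes "finite (set_pmf p)"
  shows "measure_pmf.expectation p (\<lambda>x. a * f x + b * g x) =
    a * measure_pmf.expectation p f + b * measure_pmf.expectation p g"
  by (simp only: expectation_add_finite[OF assms] integral_mult_right_zero)

text \<open>Pair by pair: a pair of \<open>T\<close> is retained with probability \<open>q\<close>
  whether or not it is in \<open>H\<close>; any other pair must first be in \<open>H\<close>, which
  gives \<open>q * p\<close>. Sampling \<open>S\<close> on all of \<open>V\<close> and discarding
  its part in \<open>T\<close> keeps the noise law independent of \<open>T\<close>.\<close>

lemma expectation_thinning:
  fixes \<phi> :: "'a set \<Rightarrow> real"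
  assumes "finite V" "T \<subseteq> V" and p: "0 \<le> p" "p \<le> 1" and q: "0 \<le> q" "q \<le> 1"
  shows "measure_pmf.expectation (random_subset p V)
      (\<lambda>H. measure_pmf.expectation (random_subset q (T \<union> H)) \<phi>) =
    measure_pmf.expectation (random_subset q T)
      (\<lambda>A. measure_pmf.expectation (random_subset (q * p) V) (\<lambda>S. \<phi> (A \<union> (S - T))))"
  using assms(1,2)
proof (induction V arbitrary: T \<phi> rule: finite_induct)
  case empty
  then show ?case by simp
next
  case (insert x V)
  have qp: "0 \<le> q * p" "q * p \<le> 1" using p q by (auto intro: mult_le_one)
  have HV: "H \<subseteq> V \<and> finite H" if "H \<in> set_pmf (random_subset p V)" for H
    using that set_random_subset[OF insert(1), of p] insert(1) by (auto intro: finite_subset)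
  have SV: "S \<subseteq> V" if "S \<in> set_pmf (random_subset (q * p) V)" for S
    using that set_random_subset[OF insert(1), of "q * p"] by auto
  show ?case
  proof (cases "x \<in> T")
    case True
    define T' where "T' = T - {x}"
    have T: "T = insert x T'" "x \<notin> T'" "T' \<subseteq> V" "finite T'"
      using True insert by (auto simp: T'_def intro: finite_subset)
    have "measure_pmf.expectation (random_subset p (insert x V))
        (\<lambda>H. measure_pmf.expectation (random_subset q (T \<union> H)) \<phi>) =
      measure_pmf.expectation (random_subset p V)
        (\<lambda>H. measure_pmf.expectation (random_subset q (insert x (T' \<union> H))) \<phi>)"
      by (simp add: expectation_random_subset_insert[OF insert(1,2) p] T(1) insert_commute algebra_simps)
    also have "\<dots> = measure_pmf.expectation (random_subset p V)
        (\<lambda>H. q * measure_pmf.expectation (random_subset q (T' \<union> H)) (\<lambda>F. \<phi> (insert x F)) +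
          (1 - q) * measure_pmf.expectation (random_subset q (T' \<union> H)) \<phi>)"
      using HV T insert(2) by (intro expectation_cong_pmf expectation_random_subset_insert q) auto
    also have "\<dots> = q * measure_pmf.expectation (random_subset q T')
        (\<lambda>A. measure_pmf.expectation (random_subset (q * p) V) (\<lambda>S. \<phi> (insert x (A \<union> (S - T'))))) +
      (1 - q) * measure_pmf.expectation (random_subset q T')
        (\<lambda>A. measure_pmf.expectation (random_subset (q * p) V) (\<lambda>S. \<phi> (A \<union> (S - T'))))"
      using insert(1) by (simp add: expectation_lin2_finite insert.IH[OF T(3)])
    also have "\<dots> = measure_pmf.expectation (random_subset q T)
        (\<lambda>A. measure_pmf.expectation (random_subset (q * p) V) (\<lambda>S. \<phi> (A \<union> (S - T'))))"
      unfolding T(1) by (simp add: expectation_random_subset_insert[OF T(4,2) q])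
    also have "\<dots> = measure_pmf.expectation (random_subset q T)
        (\<lambda>A. measure_pmf.expectation (random_subset (q * p) (insert x V)) (\<lambda>S. \<phi> (A \<union> (S - T))))"
    proof (intro expectation_cong_pmf)
      fix A
      have "measure_pmf.expectation (random_subset (q * p) V) (\<lambda>S. \<phi> (A \<union> (S - T'))) =
          measure_pmf.expectation (random_subset (q * p) V) (\<lambda>S. \<phi> (A \<union> (S - T)))"
      proof (intro expectation_cong_pmf)
        fix S assume "S \<in> set_pmf (random_subset (q * p) V)"
        then have "S - T' = S - T" using SV insert(2) T by auto
        then show "\<phi> (A \<union> (S - T')) = \<phi> (A \<union> (S - T))" by simp
      qed
      then show "measure_pmf.expectation (random_subset (q * p) V) (\<lambda>S. \<phi> (A \<union> (S - T'))) =
          measure_pmf.expectation (random_subset (q * p) (insert x V)) (\<lambda>S. \<phi> (A \<union> (S - T)))"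
        using True by (simp add: expectation_random_subset_insert[OF insert(1,2) qp] left_diff_distrib)
    qed
    finally show ?thesis .
  next
    case False
    then have T: "T \<subseteq> V" "finite T" using insert by (auto intro: finite_subset)
    have "measure_pmf.expectation (random_subset p (insert x V))
        (\<lambda>H. measure_pmf.expectation (random_subset q (T \<union> H)) \<phi>) =
      p * measure_pmf.expectation (random_subset p V)
        (\<lambda>H. measure_pmf.expectation (random_subset q (insert x (T \<union> H))) \<phi>) +
      (1 - p) * measure_pmf.expectation (random_subset p V)
        (\<lambda>H. measure_pmf.expectation (random_subset q (T \<union> H)) \<phi>)"
      by (simp add: expectation_random_subset_insert[OF insert(1,2) p])
    also have "measure_pmf.expectation (random_subset p V)
        (\<lambda>H. measure_pmf.expectation (random_subset q (insert x (T \<union> H))) \<phi>) =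
      measure_pmf.expectation (random_subset p V)
        (\<lambda>H. q * measure_pmf.expectation (random_subset q (T \<union> H)) (\<lambda>F. \<phi> (insert x F)) +
          (1 - q) * measure_pmf.expectation (random_subset q (T \<union> H)) \<phi>)"
      using HV T False insert(2) by (intro expectation_cong_pmf expectation_random_subset_insert q) auto
    also have "\<dots> = q * measure_pmf.expectation (random_subset q T)
        (\<lambda>A. measure_pmf.expectation (random_subset (q * p) V) (\<lambda>S. \<phi> (insert x (A \<union> (S - T))))) +
      (1 - q) * measure_pmf.expectation (random_subset q T)
        (\<lambda>A. measure_pmf.expectation (random_subset (q * p) V) (\<lambda>S. \<phi> (A \<union> (S - T))))"
      using insert(1) by (simp add: expectation_lin2_finite insert.IH[OF T(1)])
    also have "measure_pmf.expectation (random_subset p V)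
        (\<lambda>H. measure_pmf.expectation (random_subset q (T \<union> H)) \<phi>) =
      measure_pmf.expectation (random_subset q T)
        (\<lambda>A. measure_pmf.expectation (random_subset (q * p) V) (\<lambda>S. \<phi> (A \<union> (S - T))))"
      by (rule insert.IH[OF T(1)])
    finally have "measure_pmf.expectation (random_subset p (insert x V))
        (\<lambda>H. measure_pmf.expectation (random_subset q (T \<union> H)) \<phi>) =
      q * p * measure_pmf.expectation (random_subset q T)
        (\<lambda>A. measure_pmf.expectation (random_subset (q * p) V) (\<lambda>S. \<phi> (insert x (A \<union> (S - T))))) +
      (1 - q * p) * measure_pmf.expectation (random_subset q T)
        (\<lambda>A. measure_pmf.expectation (random_subset (q * p) V) (\<lambda>S. \<phi> (A \<union> (S - T))))"
      by (simp add: algebra_simps)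
    also have "\<dots> = measure_pmf.expectation (random_subset q T)
        (\<lambda>A. q * p * measure_pmf.expectation (random_subset (q * p) V) (\<lambda>S. \<phi> (insert x (A \<union> (S - T)))) +
          (1 - q * p) * measure_pmf.expectation (random_subset (q * p) V) (\<lambda>S. \<phi> (A \<union> (S - T))))"
      using T(2) by (simp only: expectation_lin2_finite finite_set_random_subset)
    also have "\<dots> = measure_pmf.expectation (random_subset q T)
        (\<lambda>A. measure_pmf.expectation (random_subset (q * p) (insert x V)) (\<lambda>S. \<phi> (A \<union> (S - T))))"
      using False by (simp add: expectation_random_subset_insert[OF insert(1,2) qp] insert_Diff_if)
    finally show ?thesis .
  qed
qed

text \<open>Separates the choice of retained parent edges from the choice of parents, so that for a
  fixed tree the forest becomes edge percolation.\<close>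

lemma forest_altdef:
  "forest q n = random_subset q {2..n} \<bind>
    (\<lambda>B. map_pmf (\<lambda>p m. if m \<in> B then p m else 0) (Pi_pmf {2..n} 0 (\<lambda>m. pmf_of_set {1..<m})))"
proof -
  let ?U = "\<lambda>m::nat. pmf_of_set {1..<m}"
  have "forest q n = Pi_pmf {2..n} False (\<lambda>_. bernoulli_pmf q) \<bind>
      (\<lambda>g. Pi_pmf {2..n} 0 (\<lambda>m. if g m then ?U m else return_pmf 0))"
    unfolding forest_def by (rule Pi_pmf_bind) simp
  also have "\<dots> = Pi_pmf {2..n} False (\<lambda>_. bernoulli_pmf q) \<bind>
      (\<lambda>g. map_pmf (\<lambda>p m. if m \<in> {m \<in> {2..n}. g m} then p m else 0) (Pi_pmf {2..n} 0 ?U))"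
    by (intro bind_pmf_cong refl, subst Pi_pmf_if_set, simp, rule Pi_pmf_subset) auto
  also have "\<dots> = random_subset q {2..n} \<bind>
    (\<lambda>B. map_pmf (\<lambda>p m. if m \<in> B then p m else 0) (Pi_pmf {2..n} 0 ?U))"
    unfolding random_subset_def bind_map_pmf by simp
  finally show ?thesis .
qed

lemma finite_set_parents:
  "finite (set_pmf (Pi_pmf {2..n::nat} (0::nat) (\<lambda>m. pmf_of_set {1..<m})))"
  by (rule finite_subset[OF set_Pi_pmf_subset'], simp, rule finite_PiE_dflt) auto

lemma finite_graph_tree_plus_noise:
  assumes "G \<in> set_pmf (tree_plus_noise lam n)"
  shows "finite_graph G" "verts G = {1..n}"
proof -
  obtain p H where p: "p \<in> set_pmf (Pi_pmf {2..n} 0 (\<lambda>m. pmf_of_set {1..<m}))"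
    and H: "H \<in> set_pmf (random_subset (lam / n) (pairs {1..n}))"
    and G: "G = ({1..n}, (\<lambda>m. {p m, m}) ` {2..n} \<union> H)"
    using assms by (auto simp: tree_plus_noise_def recursive_tree_def erdos_renyi_def)
  have "p m \<in> {1..<m}" if "m \<in> {2..n}" for m
    using p that by (auto simp: set_Pi_pmf PiE_dflt_def)
  then have "(\<lambda>m. {p m, m}) ` {2..n} \<subseteq> pairs {1..n}" by (fastforce simp: pairs_def)
  moreover have "H \<subseteq> pairs {1..n}" using H set_random_subset[of "pairs {1..n}"] by auto
  ultimately show "finite_graph G" "verts G = {1..n}" using G by (auto simp: finite_graph_def)
qed

text \<open>All graphs between a retained forest and the forest with all added edges have to be
  considered, because a pair that is a tree edge does not get a second chance to be retained.\<close>

lemma prob_percolated_ge: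
  fixes lam q :: real
  assumes lam: "0 \<le> lam" "lam \<le> n" "1 \<le> n" and q: "0 \<le> q" "q \<le> 1"
  shows "measure_pmf.expectation (tree_plus_noise lam n)
      (\<lambda>G. measure_pmf.prob (random_subset q (edges G)) {F. P F}) \<ge>
    measure_pmf.expectation (forest q n) (\<lambda>f. measure_pmf.prob
      (random_subset (q * (lam / n)) (pairs {1..n}))
      {S. \<forall>E. forest_edges f \<subseteq> E \<longrightarrow> E \<subseteq> forest_edges f \<union> S \<longrightarrow> P E})"
proof -
  define W where "W = pairs {1..n}"
  define U where "U = Pi_pmf {2..n} 0 (\<lambda>m. pmf_of_set {1..<m})"
  define \<phi> where "\<phi> F = (indicator {F. P F} F :: real)" for F
  define X where "X f = measure_pmf.prob (random_subset (q * (lam / n)) W)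
      {S. \<forall>E. forest_edges f \<subseteq> E \<longrightarrow> E \<subseteq> forest_edges f \<union> S \<longrightarrow> P E}" for f
  have W: "finite W" by (simp add: W_def)
  have finU: "finite (set_pmf U)" unfolding U_def by (rule finite_set_parents)
  have r: "0 \<le> lam / n" "lam / n \<le> 1" using lam by auto
  have "measure_pmf.expectation (forest q n) X =
      measure_pmf.expectation (random_subset q {2..n})
        (\<lambda>B. measure_pmf.expectation U (\<lambda>p. X (\<lambda>m. if m \<in> B then p m else 0)))"
    unfolding forest_altdef U_def[symmetric]
    using finU by (subst expectation_bind_finite) auto
  also have "\<dots> = measure_pmf.expectation U (\<lambda>p. measure_pmf.expectation (random_subset q {2..n})
      (\<lambda>B. X (\<lambda>m. if m \<in> B then p m else 0)))"
  proof -
    have "measure_pmf.expectation (random_subset q {2..n} \<bind> (\<lambda>B. U \<bind> (\<lambda>p. return_pmf (B, p))))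
        (\<lambda>(B, p). X (\<lambda>m. if m \<in> B then p m else 0)) =
      measure_pmf.expectation (U \<bind> (\<lambda>p. random_subset q {2..n} \<bind> (\<lambda>B. return_pmf (B, p))))
        (\<lambda>(B, p). X (\<lambda>m. if m \<in> B then p m else 0))"
      by (subst bind_commute_pmf) (rule refl)
    then show ?thesis by (simp add: expectation_bind_finite finU)
  qed
  also have "\<dots> \<le> measure_pmf.expectation U (\<lambda>p. measure_pmf.expectation (random_subset (lam / n) W)
      (\<lambda>H. measure_pmf.expectation (random_subset q ((\<lambda>m. {p m, m}) ` {2..n} \<union> H)) \<phi>))"
  proof (intro expectation_mono_finite)
    fix p assume "p \<in> set_pmf U"
    then have p: "p m \<in> {1..<m}" if "m \<in> {2..n}" for m
      using that by (auto simp: U_def set_Pi_pmf PiE_dflt_def)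
    define h where "h m = {p m, m}" for m
    \<comment> \<open>A vertex is the larger endpoint of its parent edge. Tree edges are thus
      indexed by \<open>{2..n}\<close>, and percolating them is percolating the index set.\<close>
    have inj: "inj_on h {2..n}"
    proof (rule inj_onI)
      fix a b assume ab: "a \<in> {2..n}" "b \<in> {2..n}" "h a = h b"
      then have "Max (h a) = Max (h b)" by simp
      then show "a = b" using p[OF ab(1)] p[OF ab(2)] by (simp add: h_def max_def)
    qed
    have T: "h ` {2..n} \<subseteq> W"
    proof
      fix e assume "e \<in> h ` {2..n}"
      then obtain m where m: "m \<in> {2..n}" "e = {p m, m}" by (auto simp: h_def)
      then show "e \<in> W" using p[OF m(1)] by (auto simp: W_def pairs_def)
    qed
    have "measure_pmf.expectation (random_subset q {2..n}) (\<lambda>B. X (\<lambda>m. if m \<in> B then p m else 0)) \<le>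
      measure_pmf.expectation (random_subset q {2..n}) (\<lambda>B.
        measure_pmf.expectation (random_subset (q * (lam / n)) W) (\<lambda>S. \<phi> (h ` B \<union> (S - h ` {2..n}))))"
    proof (intro expectation_mono_finite)
      fix B assume "B \<in> set_pmf (random_subset q {2..n})"
      then have B: "B \<subseteq> {2..n}" using set_random_subset[of "{2..n}" q] by auto
      define f where "f m = (if m \<in> B then p m else 0)" for m
      have "0 < p m" if "m \<in> B" for m using p[of m] B that by auto
      then have "{m. 0 < f m} = B" by (auto simp: f_def)
      then have fB: "forest_edges f = h ` B"
        unfolding forest_edges_def by (intro image_cong) (auto simp: f_def h_def)
      have "X f \<le> measure_pmf.prob (random_subset (q * (lam / n)) W)
          {S. P (h ` B \<union> (S - h ` {2..n}))}"
        unfolding X_def fB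
      proof (rule prob_mono_pmf)
        fix S assume "S \<in> {S. \<forall>E. h ` B \<subseteq> E \<longrightarrow> E \<subseteq> h ` B \<union> S \<longrightarrow> P E}"
        then have "h ` B \<subseteq> E \<Longrightarrow> E \<subseteq> h ` B \<union> S \<Longrightarrow> P E" for E by blast
        \<comment> \<open>This instance of \<open>E\<close> is the actual percolated graph: noise
          counts only on pairs that are not tree edges.\<close>
        from this[of "h ` B \<union> (S - h ` {2..n})"]
        have "P (h ` B \<union> (S - h ` {2..n}))" by blast
        then show "S \<in> {S. P (h ` B \<union> (S - h ` {2..n}))}" by (rule CollectI)
      qed
      also have "\<dots> = measure_pmf.expectation (random_subset (q * (lam / n)) W)
          (\<lambda>S. \<phi> (h ` B \<union> (S - h ` {2..n})))"
        by (subst prob_eq_expectation, rule expectation_cong_pmf) (simp add: \<phi>_def indicator_def)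
      finally have Xf: "X f \<le>
          measure_pmf.expectation (random_subset (q * (lam / n)) W) (\<lambda>S. \<phi> (h ` B \<union> (S - h ` {2..n})))" .
      have "(\<lambda>m. if m \<in> B then p m else 0) = f" by (simp add: f_def fun_eq_iff)
      then show "X (\<lambda>m. if m \<in> B then p m else 0) \<le>
          measure_pmf.expectation (random_subset (q * (lam / n)) W) (\<lambda>S. \<phi> (h ` B \<union> (S - h ` {2..n})))"
        using Xf by (simp only:)
    qed simp
    also have "\<dots> = measure_pmf.expectation (random_subset q (h ` {2..n})) (\<lambda>A.
        measure_pmf.expectation (random_subset (q * (lam / n)) W) (\<lambda>S. \<phi> (A \<union> (S - h ` {2..n}))))"
      by (simp add: random_subset_image[OF _ inj])
    also have "\<dots> = measure_pmf.expectation (random_subset (lam / n) W)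
        (\<lambda>H. measure_pmf.expectation (random_subset q (h ` {2..n} \<union> H)) \<phi>)"
      by (rule expectation_thinning[OF W T r q, symmetric])
    finally show "measure_pmf.expectation (random_subset q {2..n}) (\<lambda>B. X (\<lambda>m. if m \<in> B then p m else 0)) \<le>
      measure_pmf.expectation (random_subset (lam / n) W)
        (\<lambda>H. measure_pmf.expectation (random_subset q ((\<lambda>m. {p m, m}) ` {2..n} \<union> H)) \<phi>)"
      unfolding h_def .
  qed (rule finU)
  also have "\<dots> = measure_pmf.expectation (tree_plus_noise lam n)
      (\<lambda>G. measure_pmf.expectation (random_subset q (edges G)) \<phi>)"
    unfolding tree_plus_noise_def recursive_tree_def erdos_renyi_def bind_map_pmf U_def[symmetric] W_def[symmetric]
    using W by (simp add: expectation_bind_finite finU)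
  finally have le: "measure_pmf.expectation (forest q n) X \<le> measure_pmf.expectation (tree_plus_noise lam n)
      (\<lambda>G. measure_pmf.expectation (random_subset q (edges G)) \<phi>)" .
  have "measure_pmf.expectation p \<phi> = measure_pmf.prob p {F. P F}" for p
    by (subst prob_eq_expectation, rule expectation_cong_pmf) (simp add: \<phi>_def)
  then show ?thesis using le unfolding X_def W_def by (simp only:)
qed

section \<open>Transfer from the labeled graph to the representative seen by the algorithm\<close>

lemma finite_edges: "finite_graph G \<Longrightarrow> finite (edges G)"
  using finite_subset finite_pairs by (metis finite_graph_def)

lemma percolate_iso:
  assumes G: "finite_graph G" and g: "graph_iso g G G'"
  shows "percolate q G' = map_pmf (\<lambda>F. (verts G', (`) g ` F)) (random_subset q (edges G))"
proof -
  have inj: "inj_on ((`) g) (edges G)"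
  proof (rule inj_on_subset[OF inj_on_image_Pow])
    show "inj_on g (verts G)" using g by (simp add: graph_iso_def bij_betw_def)
    show "edges G \<subseteq> Pow (verts G)" using G by (auto simp: finite_graph_def pairs_def)
  qed
  have "finite (edges G)" using G by (rule finite_edges)
  then have "random_subset q (edges G') = map_pmf ((`) ((`) g)) (random_subset q (edges G))"
    using g inj unfolding graph_iso_def by (simp add: random_subset_image)
  then show ?thesis by (simp add: percolate_def map_pmf_comp)
qed

lemma finite_set_percolate: "finite_graph G \<Longrightarrow> finite (set_pmf (percolate q G))"
  by (simp add: percolate_def finite_edges)

text \<open>Percolation of the representative is the image of percolation of the labeled graph, so
  certificates are transported sample by sample.\<close>

lemma prob_root_set_ge:
  assumes G: "finite_graph G" "finite_graph G'" and g: "graph_iso g G G'" and S: "card S \<le> M"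
  shows "measure_pmf.prob (random_subset q (edges G)) {F. root_certificate (verts G, F) x S}
    \<le> measure_pmf.prob (root_set \<rho> \<tau> q M M G') {A. g x \<in> A}"
proof -
  have finE: "finite (edges G)" using G(1) by (rule finite_edges)
  have "measure_pmf.prob (root_set \<rho> \<tau> q M M G') {A. g x \<in> A} =
    measure_pmf.prob (random_subset q (edges G))
      {F. g x \<in> (\<Union>C\<in>largest_components \<rho> M (verts G', (`) g ` F).
        TopJ \<tau> M (induced (verts G', (`) g ` F) C))}"
    unfolding root_set_def percolate_iso[OF G(1) g] by (simp add: vimage_def)
  moreover have "measure_pmf.prob (random_subset q (edges G)) {F. root_certificate (verts G, F) x S} \<le> \<dots>"
  proof (rule prob_mono_pmf)
    fix F assume "F \<in> set_pmf (random_subset q (edges G))" and c: "F \<in> {F. root_certificate (verts G, F) x S}"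
    then have F: "F \<subseteq> edges G" using set_random_subset[OF finE, of q] by auto
    have fG: "finite_graph (verts G, F)" using F G(1) by (auto simp: finite_graph_def)
    have E': "edges G' = (`) g ` edges G" using g by (simp add: graph_iso_def)
    have "(`) g ` F \<subseteq> pairs (verts G')"
      using image_mono[OF F, of "(`) g"] G(2) unfolding finite_graph_def E' by (metis subset_trans)
    then have fG': "finite_graph (verts G', (`) g ` F)" using G(2) by (simp add: finite_graph_def)
    have "graph_iso g (verts G, F) (verts G', (`) g ` F)" using g by (simp add: graph_iso_def)
    then have "root_certificate (verts G', (`) g ` F) (g x) (g ` S)"
      using root_certificate_iso[OF fG fG'] c by simp
    moreover have "card (g ` S) \<le> M"
    proof -
      have "S \<subseteq> verts G" using c by (simp add: root_certificate_def)
      then have "finite S" using G(1) by (auto simp: finite_graph_def intro: finite_subset)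
      then show ?thesis using S card_image_le[of S g] by linarith
    qed
    ultimately show "F \<in> {F. g x \<in> (\<Union>C\<in>largest_components \<rho> M (verts G', (`) g ` F).
        TopJ \<tau> M (induced (verts G', (`) g ` F) C))}"
      using root_certificate_found[OF fG'] by auto
  qed
  ultimately show ?thesis by simp
qed

lemma realization_finite_graph:
  assumes "realization rep pos" "finite_graph G"
  shows "graph_iso (pos G) G (rep (unlabeled G))" "finite_graph (rep (unlabeled G))"
proof -
  show g: "graph_iso (pos G) G (rep (unlabeled G))" using assms unfolding realization_def by blast
  have inj: "inj_on (pos G) (verts G)" using g by (simp add: graph_iso_def bij_betw_def)
  have "pos G ` e \<in> pairs (pos G ` verts G)" if "e \<in> edges G" for e
  proof -
    have "e \<subseteq> verts G" "card e = 2" using that assms(2) by (auto simp: finite_graph_def pairs_def)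
    then show ?thesis using inj by (auto simp: pairs_def card_image inj_on_subset)
  qed
  moreover have "verts (rep (unlabeled G)) = pos G ` verts G"
    using g by (simp add: graph_iso_def bij_betw_def)
  moreover have "edges (rep (unlabeled G)) = (`) (pos G) ` edges G"
    using g by (simp add: graph_iso_def)
  moreover have "finite (verts G)" using assms(2) by (simp add: finite_graph_def)
  ultimately show "finite_graph (rep (unlabeled G))"
    unfolding finite_graph_def by auto
qed

lemma finite_set_tree_plus_noise [simp]: "finite (set_pmf (tree_plus_noise lam n))"
  unfolding tree_plus_noise_def recursive_tree_def erdos_renyi_def
  using finite_set_parents[of n] by auto

lemma prob_root_experiment_ge:
  fixes lam q :: real
  assumes lam: "0 \<le> lam" "lam \<le> n" "1 \<le> n" and q: "0 \<le> q" "q \<le> 1" and real: "realization rep pos"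
  shows "measure_pmf.prob (root_experiment rep \<rho> \<tau> lam q M M n) {(G, S). pos G 1 \<in> S} \<ge>
    measure_pmf.expectation (forest q n) (\<lambda>f. measure_pmf.prob
      (random_subset (q * (lam / n)) (pairs {1..n}))
      {S. \<forall>E. forest_edges f \<subseteq> E \<longrightarrow> E \<subseteq> forest_edges f \<union> S \<longrightarrow> root_certificate ({1..n}, E) 1 {1..M}})"
proof -
  have "measure_pmf.expectation (tree_plus_noise lam n)
      (\<lambda>G. measure_pmf.prob (random_subset q (edges G)) {F. root_certificate ({1..n}, F) 1 {1..M}}) \<le>
    measure_pmf.expectation (tree_plus_noise lam n)
      (\<lambda>G. measure_pmf.prob (root_set \<rho> \<tau> q M M (rep (unlabeled G))) {A. pos G 1 \<in> A})"
  proof (intro expectation_mono_finite finite_set_tree_plus_noise)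
    fix G assume G: "G \<in> set_pmf (tree_plus_noise lam n)"
    note fG = finite_graph_tree_plus_noise[OF G]
    show "measure_pmf.prob (random_subset q (edges G)) {F. root_certificate ({1..n}, F) 1 {1..M}} \<le>
        measure_pmf.prob (root_set \<rho> \<tau> q M M (rep (unlabeled G))) {A. pos G 1 \<in> A}"
      using prob_root_set_ge[OF fG(1) realization_finite_graph(2)[OF real fG(1)] realization_finite_graph(1)[OF real fG(1)],
          of "{1..M}" M q 1 \<rho> \<tau>] fG(2) by simp
  qed
  also have "\<dots> = measure_pmf.expectation (tree_plus_noise lam n)
      (\<lambda>G. measure_pmf.expectation (root_set \<rho> \<tau> q M M (rep (unlabeled G)) \<bind> (\<lambda>S. return_pmf (G, S)))
        (indicator {(G, S). pos G 1 \<in> S}))"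
  proof (intro expectation_cong_pmf)
    fix G
    show "measure_pmf.prob (root_set \<rho> \<tau> q M M (rep (unlabeled G))) {A. pos G 1 \<in> A} =
      measure_pmf.expectation (root_set \<rho> \<tau> q M M (rep (unlabeled G)) \<bind> (\<lambda>S. return_pmf (G, S)))
        (indicator {(G, S). pos G 1 \<in> S})"
      by (simp add: map_pmf_def[symmetric] vimage_def)
  qed
  also have "\<dots> = measure_pmf.prob (root_experiment rep \<rho> \<tau> lam q M M n) {(G, S). pos G 1 \<in> S}"
  proof -
    have "finite (set_pmf (root_set \<rho> \<tau> q M M (rep (unlabeled G)) \<bind> (\<lambda>S. return_pmf (G, S))))"
      if "G \<in> set_pmf (tree_plus_noise lam n)" for G
      using finite_set_percolate[OF realization_finite_graph(2)[OF real finite_graph_tree_plus_noise(1)[OF that]]]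
      by (auto simp: root_set_def)
    then show ?thesis
      unfolding root_experiment_def prob_eq_expectation
      by (intro expectation_bind_finite[symmetric]) auto
  qed
  finally show ?thesis using prob_percolated_ge[OF lam q, of "\<lambda>F. root_certificate ({1..n}, F) 1 {1..M}"]
    by linarith
qed

lemma card_root_experiment:
  assumes "realization rep pos" "component_rule \<rho>" "vertex_rule \<tau>"
    and "(G, S) \<in> set_pmf (root_experiment rep \<rho> \<tau> lam q K L n)"
  shows "finite S \<and> card S \<le> K * L"
proof -
  obtain R where G: "G \<in> set_pmf (tree_plus_noise lam n)" and R: "R \<in> set_pmf (percolate q (rep (unlabeled G)))"
    and S: "S = (\<Union>C\<in>largest_components \<rho> K R. TopJ \<tau> L (induced R C))"
    using assms(4) by (auto simp: root_experiment_def root_set_def)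
  have fG: "finite_graph (rep (unlabeled G))"
    using realization_finite_graph(2)[OF assms(1) finite_graph_tree_plus_noise(1)[OF G]] .
  then have finE: "finite (edges (rep (unlabeled G)))" by (rule finite_edges)
  obtain F where F: "F \<in> set_pmf (random_subset q (edges (rep (unlabeled G))))" "R = (verts (rep (unlabeled G)), F)"
    using R by (auto simp: percolate_def)
  then have "F \<subseteq> edges (rep (unlabeled G))" using set_random_subset[OF finE, of q] by auto
  then have "finite_graph R"
    using F(2) fG by (auto simp: finite_graph_def)
  then show ?thesis unfolding S using card_root_set assms(2,3) by blast
qed

section \<open>The main estimate\<close>

lemma prob_Un_le: "measure_pmf.prob p (A \<union> B) \<le> measure_pmf.prob p A + measure_pmf.prob p B"
  by (rule measure_Un_le) auto

lemma prob_UN_le: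
  assumes "finite I" "\<And>i. i \<in> I \<Longrightarrow> measure_pmf.prob p (A i) \<le> b i"
  shows "measure_pmf.prob p (\<Union>i\<in>I. A i) \<le> sum b I"
proof -
  have "measure_pmf.prob p (\<Union>i\<in>I. A i) \<le> (\<Sum>i\<in>I. measure_pmf.prob p (A i))"
    by (rule measure_UNION_le[OF assms(1)]) auto
  also have "\<dots> \<le> sum b I" using assms(2) by (rule sum_mono)
  finally show ?thesis .
qed

text \<open>A union bound, given the forest, over three kinds of failure: a component above
  \<open>M\<close> reaches size \<open>s\<close>, a low vertex of another tree cluster is joined to
  1, or \<open>i\<close> and \<open>j\<close> are joined without vertex 1. All three are increasing
  in the edge set, so excluding them for the full noise yields the certificate for every
  intermediate graph.\<close>

lemma prob_certificate_ge:
  fixes p rho a z s h Z :: real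
  assumes f: "forest_fun n f" and p: "0 \<le> p" "p \<le> 1" and rho: "0 \<le> rho" "rho < 1" and a: "0 < a"
    and S2: "p * (cluster_sum 2 f n - n) \<le> rho"
    and S3: "p * a * cluster_sum 3 f n * exp (a * z) \<le> (1 - rho) / 2"
    and z: "\<And>m. m \<in> {M<..n} \<Longrightarrow> real (descs f n m) \<le> z"
    and h: "0 < h" "h * Z \<le> 1"
    and S3': "p * (3 * h) * cluster_sum 3 f n \<le> (1 - rho) / 2"
    and Z: "cluster_sum 3 f n \<le> Z ^ 3" "0 \<le> Z" "p * (3 * Z) \<le> (1 - rho) / 2 * h"
    and M: "M \<le> n" and ij: "2 \<le> i" "i < j" "j \<le> M" "f i = 1" "f j = 1"
      "s \<le> descs f n i" "s \<le> descs f n j"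
  shows "1 - (n * exp (a * z - (1 - rho) / 2 * a * s) + (real M + 1) * (exp (h * Z) - 1)) \<le>
    measure_pmf.prob (random_subset p (pairs {1..n}))
      {S. \<forall>E. forest_edges f \<subseteq> E \<longrightarrow> E \<subseteq> forest_edges f \<union> S \<longrightarrow> root_certificate ({1..n}, E) 1 {1..M}}"
proof -
  define F where "F = forest_edges f"
  define P where "P = random_subset p (pairs {1..n})"
  define good where "good = {S. \<forall>E. F \<subseteq> E \<longrightarrow> E \<subseteq> F \<union> S \<longrightarrow> root_certificate ({1..n}, E) 1 {1..M}}"
  define B1 where "B1 = (\<Union>x\<in>{M<..n}. {S. s \<le> real (card (reach ((F \<union> S) \<inter> Pow {M<..n}) {x}))})"
  define I where "I = {w \<in> {1..M}. top_anc f 0 1 \<noteq> top_anc f 0 w}"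
  define B2 where "B2 = (\<Union>w\<in>I. {S. w \<in> reach ((F \<union> S) \<inter> Pow {0<..n}) {1}})"
  define B3 where "B3 = {S. j \<in> reach ((F \<union> S) \<inter> Pow {1<..n}) {i}}"
  \<comment> \<open>\<open>i\<close> and \<open>j\<close> are children of 1, hence tops of distinct
    clusters once 1 is removed. So \<open>B3\<close> is \<open>prob_reach_other\<close> with cut-off
    1, while \<open>B2\<close> uses cut-off 0.\<close>
  have top: "top_anc f 1 i \<noteq> top_anc f 1 j"
    using ij top_anc_below[of f i 1] top_anc_below[of f j 1] by simp
  have e0: "0 \<le> exp (h * Z) - 1" using h Z by simp
  have b1: "measure_pmf.prob P B1 \<le> n * exp (a * z - (1 - rho) / 2 * a * s)"
  proof -
    have "measure_pmf.prob P B1 \<le> (\<Sum>x\<in>{M<..n}. exp (a * z - (1 - rho) / 2 * a * s))"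
      unfolding B1_def P_def F_def
      using prob_reach_large[OF f p rho a S2 S3 z] by (intro prob_UN_le) auto
    also have "\<dots> \<le> n * exp (a * z - (1 - rho) / 2 * a * s)" by simp
    finally show ?thesis .
  qed
  have b2: "measure_pmf.prob P B2 \<le> M * (exp (h * Z) - 1)"
  proof -
    have "measure_pmf.prob P B2 \<le> (\<Sum>w\<in>I. exp (h * Z) - 1)"
      unfolding B2_def P_def F_def
      using prob_reach_other[OF f p rho(2) h S2 S3' Z, of 1 0] M ij
      by (intro prob_UN_le) (auto simp: I_def)
    also have "\<dots> = card I * (exp (h * Z) - 1)" by simp
    also have "\<dots> \<le> M * (exp (h * Z) - 1)"
    proof (intro mult_right_mono e0)
      have "card I \<le> card {1..M}" unfolding I_def by (intro card_mono) auto
      then show "real (card I) \<le> real M" by simp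
    qed
    finally show ?thesis .
  qed
  have b3: "measure_pmf.prob P B3 \<le> exp (h * Z) - 1"
    unfolding B3_def P_def F_def
    using M ij top by (intro prob_reach_other[OF f p rho(2) h S2 S3' Z]) auto
  have "measure_pmf.prob P UNIV \<le> measure_pmf.prob P (good \<union> B1 \<union> B2 \<union> B3)"
  proof (rule prob_mono_pmf)
    fix S assume "S \<in> set_pmf P"
    then have S: "S \<subseteq> pairs {1..n}" using set_random_subset[of "pairs {1..n}" p] by (auto simp: P_def)
    have "S \<in> good" if "S \<notin> B1" "S \<notin> B2" "S \<notin> B3"
      unfolding good_def
    proof (intro CollectI allI impI)
      fix E assume E: "F \<subseteq> E" "E \<subseteq> F \<union> S"
      have Ep: "E \<subseteq> pairs {1..n}" using E S forest_edges_subset[OF f] by (auto simp: F_def)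
      have sub: "reach (E \<inter> Pow W) {x} \<subseteq> reach ((F \<union> S) \<inter> Pow W) {x}" for W x
        using E(2) by (intro reach_mono Int_mono) auto
      have fin: "finite (reach ((F \<union> S) \<inter> Pow {M<..n}) {x})" if "x \<in> {M<..n}" for x
        by (rule finite_subset[of _ "{M<..n}"], rule reach_least) (use that in auto)
      show "root_certificate ({1..n}, E) 1 {1..M}"
      proof (rule root_certificate_forest[OF f])
        show "forest_edges f \<subseteq> E" using E(1) by (simp add: F_def)
        show "E \<subseteq> pairs {1..n}" by (rule Ep)
        show "real (card (reach (E \<inter> Pow {M<..n}) {x})) < s" if x: "x \<in> {M<..n}" for x
        proof -
          have "card (reach (E \<inter> Pow {M<..n}) {x}) \<le> card (reach ((F \<union> S) \<inter> Pow {M<..n}) {x})"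
            using fin[OF x] sub by (rule card_mono)
          moreover have "real (card (reach ((F \<union> S) \<inter> Pow {M<..n}) {x})) < s"
            using \<open>S \<notin> B1\<close> x by (auto simp: B1_def not_le)
          ultimately show ?thesis by linarith
        qed
        show "top_anc f 0 w = top_anc f 0 1" if w: "w \<in> {1..M}" "w \<in> reach E {1}" for w
        proof (rule ccontr)
          assume "top_anc f 0 w \<noteq> top_anc f 0 1"
          then have "w \<in> I" using w by (auto simp: I_def)
          have "{1..n} = {0<..n}" by auto
          then have "E \<subseteq> Pow {0<..n}" using Ep unfolding pairs_def by blast
          then have "E \<inter> Pow {0<..n} = E" by (rule Int_absorb2)
          then have "w \<in> reach ((F \<union> S) \<inter> Pow {0<..n}) {1}" using sub[of "{0<..n}" 1] w by auto
          then show False using \<open>w \<in> I\<close> \<open>S \<notin> B2\<close> by (auto simp: B2_def)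
        qed
        show "j \<notin> reach (E \<inter> Pow {1<..n}) {i}"
          using \<open>S \<notin> B3\<close> sub[of "{1<..n}" i] by (auto simp: B3_def)
      qed (use M ij in auto)
    qed
    then show "S \<in> good \<union> B1 \<union> B2 \<union> B3" by blast
  qed
  also have "\<dots> \<le> measure_pmf.prob P good + measure_pmf.prob P B1 + measure_pmf.prob P B2 + measure_pmf.prob P B3"
    using prob_Un_le[of P "good \<union> B1 \<union> B2" B3] prob_Un_le[of P "good \<union> B1" B2] prob_Un_le[of P good B1]
    by linarith
  finally have "1 \<le> measure_pmf.prob P good + n * exp (a * z - (1 - rho) / 2 * a * s) + M * (exp (h * Z) - 1) + (exp (h * Z) - 1)"
    using b1 b2 b3 by simp
  then show ?thesis
    by (simp add: good_def P_def F_def distrib_right)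
qed

lemma sum_inverse_squares_le:
  assumes "1 \<le> M"
  shows "(\<Sum>m\<in>{M<..n}. 1 / (real m)\<^sup>2) \<le> 1 / real M"
proof (cases "M \<le> n")
  case True
  then have "(\<Sum>m\<in>{M<..n}. 1 / (real m)\<^sup>2) \<le> 1 / real M - 1 / real n"
  proof (induction n rule: dec_induct)
    case (step n)
    have n: "0 < real n" using step assms by simp
    have "{M<..Suc n} = insert (Suc n) {M<..n}" using step by auto
    then have "(\<Sum>m\<in>{M<..Suc n}. 1 / (real m)\<^sup>2) \<le> 1 / (real (Suc n))\<^sup>2 + (1 / real M - 1 / real n)"
      using step by simp
    also have "1 / (real (Suc n))\<^sup>2 \<le> 1 / (real n * real (Suc n))"
      unfolding power2_eq_square using n by (intro divide_left_mono mult_right_mono) auto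
    also have "1 / (real n * real (Suc n)) = 1 / real n - 1 / real (Suc n)"
      using n by (simp add: field_simps)
    finally show ?case by simp
  qed simp
  then show ?thesis by (rule order_trans) simp
qed simp

text \<open>The constants are chosen in the order: two children of the root, a time by which they have
  started to grow, a lower bound \<open>eta\<close> on their relative size, and finally \<open>M\<close>.\<close>

lemma forest_typical:
  fixes q g eps :: real
  assumes q: "0 < q" "q \<le> 1" and g: "0 < g" and eps: "0 < eps"
  shows "\<exists>M eta. 1 \<le> M \<and> 0 < eta \<and> (\<forall>n\<ge>M. 1 - eps \<le> measure_pmf.prob (forest q n)
    {f. (\<exists>i j. 2 \<le> i \<and> i < j \<and> j \<le> M \<and> f i = 1 \<and> f j = 1 \<and>
          eta * real n powr q \<le> descs f n i \<and> eta * real n powr q \<le> descs f n j) \<and>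
        (\<forall>m\<in>{M<..n}. descs f n m \<le> g * eta * real n powr q)})"
proof -
  \<comment> \<open>One \<open>e\<close> each for the first child, the second child and the late
    vertices, two for the lower bounds on descendants.\<close>
  define e where "e = eps / 5"
  have e: "0 < e" using eps by (simp add: e_def)
  have lim: "((\<lambda>b. (c / real b) powr q) \<longlongrightarrow> 0) at_top" if "0 < c" for c
    using q(1) that by real_asymp
  have ev: "\<exists>b. Q \<le> b \<and> (c / real b) powr q \<le> d" if "0 < c" "0 < d" for c d :: real and Q :: nat
  proof -
    have "eventually (\<lambda>b. (c / real b) powr q < d) at_top"
      using lim[OF that(1)] that(2) by (rule order_tendstoD)
    then have "eventually (\<lambda>b. (c / real b) powr q \<le> d \<and> Q \<le> b) at_top"
      using eventually_ge_at_top[of Q] by eventually_elim auto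
    then show ?thesis by (auto dest: eventually_happens)
  qed
  \<comment> \<open>One child of 1 is sought in \<open>{1<..b1}\<close> and another in
    \<open>{b1<..M0}\<close>; disjoint ranges make them distinct.\<close>
  obtain b1 where b1: "1 \<le> b1" "(1 / real b1) powr q \<le> e" using ev[of 1 e 1] e by auto
  obtain M0 where M0: "b1 \<le> M0" "(real b1 / real M0) powr q \<le> e" using ev[of b1 e b1] e b1 by auto
  have M0pos: "0 < real M0" using M0 b1 by simp
  \<comment> \<open>By time \<open>b\<close> each vertex up to \<open>M0\<close> has a child, with
    error at most \<open>e / M0\<close>. Then \<open>eta\<close> is chosen to make the other term of
    \<open>prob_descs_small\<close>, \<open>eta * b powr q\<close>, equal to \<open>e / M0\<close>
    too.\<close>
  obtain b where b: "M0 \<le> b" "(real M0 / real b) powr q \<le> e / M0" using ev[of M0 "e / M0" M0] e M0pos by auto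
  define eta where "eta = e / (M0 * real b powr q)"
  have bpos: "0 < real b" using b M0pos by simp
  have eta: "0 < eta" using e M0pos bpos by (simp add: eta_def)
  \<comment> \<open>The order is large enough to bound the tail at a late vertex \<open>m\<close> by
    a multiple of \<open>m powr (- 2)\<close>; the sum beyond \<open>M\<close> is then at most
    \<open>K / M\<close>.\<close>
  define k where "k = nat \<lceil>2 / q\<rceil>"
  have qk: "2 \<le> q * real k"
  proof -
    have "2 / q \<le> real k" unfolding k_def by linarith
    then show ?thesis using q by (simp add: field_simps)
  qed
  define K where "K = fact k / (g * eta) ^ k"
  have K: "0 < K" using g eta by (simp add: K_def)
  define M where "M = max b (nat \<lceil>K / e\<rceil>)"
  have M: "1 \<le> M" "b \<le> M" using b M0 b1 by (auto simp: M_def)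
  have KM: "K / M \<le> e"
  proof -
    have "K / e \<le> real M" unfolding M_def by linarith
    then show ?thesis using e M by (simp add: field_simps)
  qed
  have main: "1 - eps \<le> measure_pmf.prob (forest q n)
    {f. (\<exists>i j. 2 \<le> i \<and> i < j \<and> j \<le> M \<and> f i = 1 \<and> f j = 1 \<and>
          eta * real n powr q \<le> descs f n i \<and> eta * real n powr q \<le> descs f n j) \<and>
        (\<forall>m\<in>{M<..n}. descs f n m \<le> g * eta * real n powr q)}" if n: "M \<le> n" for n
  proof -
    let ?P = "measure_pmf.prob (forest q n)"
    define G where "G = {f. (\<exists>i j. 2 \<le> i \<and> i < j \<and> j \<le> M \<and> f i = 1 \<and> f j = 1 \<and>
          eta * real n powr q \<le> descs f n i \<and> eta * real n powr q \<le> descs f n j) \<and>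
        (\<forall>m\<in>{M<..n}. descs f n m \<le> g * eta * real n powr q)}"
    define A1 where "A1 = {f::nat \<Rightarrow> nat. \<forall>m\<in>{1<..b1}. f m \<noteq> 1}"
    define A2 where "A2 = {f::nat \<Rightarrow> nat. \<forall>m\<in>{b1<..M0}. f m \<noteq> 1}"
    define A3 where "A3 = (\<Union>i\<in>{1..M0}. {f. real (descs f n i) < eta * real n powr q})"
    define A4 where "A4 = (\<Union>m\<in>{M<..n}. {f. (g * eta) * real n powr q < real (descs f n m)})"
    have q0: "0 \<le> q" using q by simp
    have a1: "?P A1 \<le> e"
      using prob_no_child[of 1 b1 n q] b1 M0 b M n q unfolding A1_def by force
    have a2: "?P A2 \<le> e"
      using prob_no_child[of b1 M0 n q] b1 M0 b M n q unfolding A2_def by force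
    have a3: "?P A3 \<le> 2 * e"
    proof -
      have "?P A3 \<le> (\<Sum>i\<in>{1..M0}. e / M0 + e / M0)"
        unfolding A3_def
      proof (rule prob_UN_le)
        fix i assume i: "i \<in> {1..M0}"
        have "?P {f. real (descs f n i) < eta * real n powr q} \<le> (real i / real b) powr q + eta * real b powr q"
          using i b M n q eta by (intro prob_descs_small) auto
        also have "(real i / real b) powr q \<le> (real M0 / real b) powr q"
          using i q0 bpos by (intro powr_mono2 divide_right_mono) auto
        also have "\<dots> \<le> e / M0" by (rule b(2))
        also have "eta * real b powr q = e / M0" using bpos by (simp add: eta_def)
        finally show "?P {f. real (descs f n i) < eta * real n powr q} \<le> e / M0 + e / M0" by simp
      qed simp
      also have "\<dots> = 2 * e" using M0pos by simp
      finally show ?thesis .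
    qed
    have a4: "?P A4 \<le> e"
    proof -
      have "?P A4 \<le> (\<Sum>m\<in>{M<..n}. K * (1 / (real m)\<^sup>2))"
        unfolding A4_def
      proof (rule prob_UN_le)
        fix m assume m: "m \<in> {M<..n}"
        have "?P {f. (g * eta) * real n powr q < real (descs f n m)} \<le> K * real m powr (- (q * k))"
          unfolding K_def using m M q qk g eta by (intro prob_descs_ge) auto
        also have "real m powr (- (q * k)) \<le> real m powr (- 2)"
          using m M qk by (intro powr_mono) auto
        also have "real m powr (- 2) = 1 / (real m)\<^sup>2"
          using m by (simp add: powr_minus_divide)
        finally show "?P {f. (g * eta) * real n powr q < real (descs f n m)} \<le> K * (1 / (real m)\<^sup>2)"
          using K by simp
      qed simp
      also have "\<dots> = K * (\<Sum>m\<in>{M<..n}. 1 / (real m)\<^sup>2)" by (simp add: sum_distrib_left)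
      also have "\<dots> \<le> K * (1 / M)"
        using sum_inverse_squares_le[OF M(1)] K by (intro mult_left_mono) auto
      finally show ?thesis using KM by simp
    qed
    have "?P UNIV \<le> ?P (G \<union> A1 \<union> A2 \<union> A3 \<union> A4)"
    proof (rule prob_mono_pmf)
      fix f :: "nat \<Rightarrow> nat"
      have "f \<in> G" if na: "f \<notin> A1" "f \<notin> A2" "f \<notin> A3" "f \<notin> A4"
      proof -
        obtain i where i: "1 < i" "i \<le> b1" "f i = 1" using na(1) by (auto simp: A1_def)
        obtain j where j: "b1 < j" "j \<le> M0" "f j = 1" using na(2) by (auto simp: A2_def)
        have "eta * real n powr q \<le> descs f n m" if "m \<in> {1..M0}" for m
          using na(3) that by (auto simp: A3_def not_less)
        moreover have "i \<in> {1..M0}" "j \<in> {1..M0}" using i j M0(1) by auto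
        ultimately have "\<exists>i j. 2 \<le> i \<and> i < j \<and> j \<le> M \<and> f i = 1 \<and> f j = 1 \<and>
          eta * real n powr q \<le> descs f n i \<and> eta * real n powr q \<le> descs f n j"
          using i j b(1) M(2) by (intro exI[of _ i] exI[of _ j]) auto
        moreover have "\<forall>m\<in>{M<..n}. descs f n m \<le> g * eta * real n powr q"
          using na(4) by (auto simp: A4_def not_less)
        ultimately show ?thesis unfolding G_def by blast
      qed
      then show "f \<in> G \<union> A1 \<union> A2 \<union> A3 \<union> A4" by blast
    qed
    also have "\<dots> \<le> ?P G + ?P A1 + ?P A2 + ?P A3 + ?P A4"
      using prob_Un_le[of "forest q n" "G \<union> A1 \<union> A2 \<union> A3" A4] prob_Un_le[of "forest q n" "G \<union> A1 \<union> A2" A3]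
        prob_Un_le[of "forest q n" "G \<union> A1" A2] prob_Un_le[of "forest q n" G A1]
      by linarith
    finally have "1 \<le> ?P G + 5 * e" using a1 a2 a3 a4 by simp
    then show ?thesis by (simp add: G_def e_def)
  qed
  show ?thesis using M(1) eta main by blast
qed

text \<open>Chebyshev's inequality; the exponent \<open>3 / 2\<close> against 2 leaves a vanishing
  bound.\<close>

lemma prob_cluster_sum_2_large:
  fixes q t :: real
  assumes n: "1 \<le> n" and q: "0 \<le> q" "q < 1 / 3" and t: "0 < t"
  defines "C \<equiv> 2 * (1 - q) / (1 - 2 * q)"
  defines "B \<equiv> 6 * (2 * C\<^sup>2 + 24 / (1 - 3 * q))"
  shows "measure_pmf.prob (forest q n) {f. t * n < cluster_sum 2 f n - C * n} \<le> B / t\<^sup>2 * n powr (- (1 / 2))"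
proof -
  have n0: "0 < real n" using n by simp
  have "measure_pmf.prob (forest q n) {f. t * n < cluster_sum 2 f n - C * n} \<le>
    measure_pmf.expectation (forest q n) (\<lambda>f. (1 / (t * n)\<^sup>2) * (cluster_sum 2 f n - C * n)\<^sup>2)"
  proof (rule prob_le_expectation)
    fix f assume "f \<in> {f. t * n < cluster_sum 2 f n - C * n}"
    then have "(t * n)\<^sup>2 \<le> (cluster_sum 2 f n - C * n)\<^sup>2" using t n0 by (intro power_mono) auto
    then show "1 \<le> (1 / (t * n)\<^sup>2) * (cluster_sum 2 f n - C * n)\<^sup>2" using t n0 by simp
  qed auto
  also have "\<dots> = (1 / (t * n)\<^sup>2) * measure_pmf.expectation (forest q n) (\<lambda>f. (cluster_sum 2 f n - C * n)\<^sup>2)"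
    by (rule integral_mult_right_zero)
  also have "\<dots> \<le> (1 / (t * n)\<^sup>2) * (B * n powr (3 / 2))"
    unfolding B_def C_def using expectation_cluster_sum_2_deviation[OF n q] by (intro mult_left_mono) auto
  also have "\<dots> = B / t\<^sup>2 * (n powr (3 / 2) / n powr 2)"
    using n0 by (simp add: power_mult_distrib)
  also have "real n powr (3 / 2) / real n powr 2 = real n powr (- (1 / 2))"
    by (simp only: powr_diff[symmetric]) simp
  finally show ?thesis .
qed

text \<open>Markov's inequality; the factor \<open>n powr d\<close> given away buys a vanishing
  failure probability.\<close>

lemma prob_cluster_sum_3_large:
  fixes q d :: real
  assumes n: "1 \<le> n" and q: "0 \<le> q" "q < 1 / 3"
  shows "measure_pmf.prob (forest q n) {f. n powr (1 + d) < cluster_sum 3 f n} \<le> 6 / (1 - 3 * q) * n powr (- d)"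
proof -
  have n0: "0 < real n" using n by simp
  have "measure_pmf.prob (forest q n) {f. n powr (1 + d) < cluster_sum 3 f n} \<le>
    measure_pmf.expectation (forest q n) (\<lambda>f. (1 / n powr (1 + d)) * cluster_sum 3 f n)"
    using n0 by (intro prob_le_expectation) (auto simp: cluster_sum_nonneg)
  also have "\<dots> = (1 / n powr (1 + d)) * measure_pmf.expectation (forest q n) (\<lambda>f. cluster_sum 3 f n)"
    by (rule integral_mult_right_zero)
  also have "\<dots> \<le> (1 / n powr (1 + d)) * (6 / (1 - 3 * q) * n)"
    using expectation_cluster_sum_3[OF n q] by (intro mult_left_mono) auto
  also have "\<dots> = 6 / (1 - 3 * q) * n powr (- d)"
    using n0 by (simp add: powr_add powr_minus_divide)
  finally show ?thesis .
qed

theorem theorem3p2: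
  fixes lam q :: real
  assumes "0 < lam" and "0 < q" and "q < min (1 / (lam + 2)) (1 / 3)"
  shows "\<forall>\<epsilon>::real. \<epsilon> > 0 \<longrightarrow> (\<exists>K L :: nat. K \<ge> 1 \<and> L \<ge> 1 \<and>
    (\<forall>rep pos \<rho> \<tau>. realization rep pos \<longrightarrow> component_rule \<rho> \<longrightarrow> vertex_rule \<tau> \<longrightarrow>
       liminf (\<lambda>n. ereal (measure_pmf.prob (root_experiment rep \<rho> \<tau> lam q K L n)
                            {(G, S). pos G 1 \<in> S})) \<ge> ereal (1 - \<epsilon>) \<and>
       (\<forall>n. \<forall>(G, S)\<in>set_pmf (root_experiment rep \<rho> \<tau> lam q K L n).
          finite S \<and> card S \<le> K * L)))"
proof (intro allI impI)
  fix eps :: real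
  assume eps: "0 < eps"
  have q: "0 < q" "q < 1 / 3" "0 \<le> q" "q \<le> 1" and lam: "0 < lam" using assms by auto
  have "q * (lam + 2) < 1" using assms by (simp add: field_simps)
  then have qlam: "q * lam < 1 - 2 * q" by (simp add: algebra_simps)
  \<comment> \<open>\<open>1 / (1 - 2 * q)\<close> is \<open>C - 1\<close>, the limiting mean
    cluster size of a uniform vertex, so \<open>c\<close> is the limiting branching mean of the
    exploration; \<open>c < 1\<close> is equivalent to \<open>q * (lam + 2) < 1\<close>.\<close>
  define c where "c = q * lam / (1 - 2 * q)"
  have c: "0 < c" "c < 1" using qlam q lam by (auto simp: c_def)
  \<comment> \<open>Room above \<open>c\<close> for fluctuations: a deviation of
    \<open>cluster_sum 2\<close> by \<open>t * n\<close> raises the branching mean from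
    \<open>c\<close> to exactly \<open>rho\<close>.\<close>
  define rho where "rho = (1 + c) / 2"
  have rho: "0 \<le> rho" "rho < 1" "c < rho" using c by (auto simp: rho_def)
  define t where "t = (rho - c) / (q * lam)"
  have t: "0 < t" using rho q lam by (simp add: t_def)
  \<comment> \<open>With the rate \<open>a n\<close>, \<open>A\<close> makes the gain
    \<open>n powr (- 2)\<close>, which beats the union over \<open>n\<close> vertices, and
    \<open>g\<close> makes the cluster weight \<open>n powr (q / 2)\<close>; see
    \<open>as_eq\<close> and \<open>az\<close>.\<close>
  define A where "A = 4 / (1 - rho)"
  have A: "0 < A" "(1 - rho) / 2 * A = 2" using rho by (auto simp: A_def divide_simps)
  define g where "g = q / (2 * A)"
  have g: "0 < g" "A * g = q / 2" using q A by (auto simp: g_def)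
  obtain M eta where M: "1 \<le> M" and eta: "0 < eta" and typical: "\<And>n. M \<le> n \<Longrightarrow>
    1 - eps / 4 \<le> measure_pmf.prob (forest q n)
    {f. (\<exists>i j. 2 \<le> i \<and> i < j \<and> j \<le> M \<and> f i = 1 \<and> f j = 1 \<and>
          eta * real n powr q \<le> descs f n i \<and> eta * real n powr q \<le> descs f n j) \<and>
        (\<forall>m\<in>{M<..n}. descs f n m \<le> g * eta * real n powr q)}"
    using forest_typical[of q g "eps / 4"] q g eps by auto
  define p where "p n = q * (lam / real n)" for n :: nat
  define a where "a n = A * ln (real n) / (eta * real n powr q)" for n :: nat
  \<comment> \<open>The cube root of the bound imposed on \<open>cluster_sum 3\<close>, hence a
    bound on every cluster size. \<open>h n\<close> is the value that turns
    \<open>p * (3 * Z) \<le> (1 - rho) / 2 * h\<close> into an equality.\<close>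
  define Z where "Z n = real n powr ((1 + q / 4) / 3)" for n :: nat
  define h where "h n = 6 * p n * Z n / (1 - rho)" for n :: nat
  define del where "del n = real n * exp (q / 2 * ln n - 2 * ln n) + (real M + 1) * (exp (h n * Z n) - 1)" for n :: nat
  define C where "C = 2 * (1 - q) / (1 - 2 * q)"
  define B where "B = 6 * (2 * C\<^sup>2 + 24 / (1 - 3 * q))"

  \<comment> \<open>Asymptotics of the error terms\<close>
  have r0: "0 < 1 - rho" using rho by simp
  \<comment> \<open>The exponents add up to \<open>- 1 - q + (1 + q / 4) + q / 2 = - q / 4\<close>,
    which absorbs the logarithm in \<open>a\<close>.\<close>
  have "((\<lambda>n. p n * a n * real n powr (1 + q / 4) * real n powr (q / 2)) \<longlongrightarrow> 0) at_top"
    unfolding p_def a_def using q lam A eta by real_asymp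
  then have E2: "eventually (\<lambda>n. p n * a n * real n powr (1 + q / 4) * real n powr (q / 2) < (1 - rho) / 2) at_top"
    using r0 by (intro order_tendstoD) auto
  \<comment> \<open>The order is that of \<open>p\<close> times the square of \<open>Z\<close>, with
    exponent \<open>- 1 + 2 / 3 * (1 + q / 4) = - 1 / 3 + q / 6\<close>, which is negative.\<close>
  have hZ: "((\<lambda>n. h n * Z n) \<longlongrightarrow> 0) at_top"
    unfolding h_def p_def Z_def using q lam r0 by real_asymp
  then have E3: "eventually (\<lambda>n. h n * Z n < 1) at_top" by (intro order_tendstoD) auto
  have "((\<lambda>n. p n * (3 * h n) * real n powr (1 + q / 4)) \<longlongrightarrow> 0) at_top"
  proof -
    \<comment> \<open>Two factors \<open>p\<close>, one \<open>Z\<close> and the explicit power give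
      the exponent \<open>- 2 + 4 / 3 * (1 + q / 4) = - d\<close>.\<close>
    define d where "d = 2 / 3 - q / 3"
    have d: "0 < d" using q by (simp add: d_def)
    have "((\<lambda>n. 18 * (q * lam)\<^sup>2 / (1 - rho) * real n powr (- d)) \<longlongrightarrow> 0) at_top"
      using d by real_asymp
    moreover have "eventually (\<lambda>n. 18 * (q * lam)\<^sup>2 / (1 - rho) * real n powr (- d) =
        p n * (3 * h n) * real n powr (1 + q / 4)) at_top"
      using eventually_gt_at_top[of 0]
    proof eventually_elim
      case (elim n)
      have "- d = (1 + q / 4) / 3 + (1 + q / 4) + (- 2)" by (simp add: d_def add_divide_distrib)
      then have "real n powr (- d) = real n powr ((1 + q / 4) / 3 + (1 + q / 4) + (- 2))"
        by (simp only:)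
      also have "\<dots> = real n powr ((1 + q / 4) / 3) * real n powr (1 + q / 4) / (real n)\<^sup>2"
        using elim unfolding powr_add by (simp add: powr_minus_divide)
      finally show ?case
        by (simp add: p_def h_def Z_def power2_eq_square mult_ac)
    qed
    ultimately show ?thesis by (rule Lim_transform_eventually)
  qed
  then have E4: "eventually (\<lambda>n. p n * (3 * h n) * real n powr (1 + q / 4) < (1 - rho) / 2) at_top"
    using r0 by (intro order_tendstoD) auto
  have "((\<lambda>n. real n * exp (q / 2 * ln n - 2 * ln n)) \<longlongrightarrow> 0) at_top"
  proof -
    define d where "d = 1 - q / 2"
    have d: "0 < d" using q by (simp add: d_def)
    have "((\<lambda>n. real n powr (- d)) \<longlongrightarrow> 0) at_top" using d by real_asymp
    moreover have "eventually (\<lambda>n. real n powr (- d) = real n * exp (q / 2 * ln n - 2 * ln n)) at_top"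
      using eventually_gt_at_top[of 0]
    proof eventually_elim
      case (elim n)
      have "real n * exp (q / 2 * ln n - 2 * ln n) = exp (ln n) * exp (q / 2 * ln n - 2 * ln n)"
        using elim by simp
      also have "\<dots> = exp (- d * ln n)"
        by (simp add: mult_exp_exp d_def left_diff_distrib)
      finally show ?case using elim by (simp add: powr_def)
    qed
    ultimately show ?thesis by (rule Lim_transform_eventually)
  qed
  moreover have "((\<lambda>n. (real M + 1) * (exp (h n * Z n) - 1)) \<longlongrightarrow> (real M + 1) * (exp 0 - 1)) at_top"
    by (intro tendsto_intros hZ)
  ultimately have "(del \<longlongrightarrow> 0) at_top"
    unfolding del_def using tendsto_add by fastforce
  then have E5: "eventually (\<lambda>n. del n < eps / 2) at_top" using eps by (intro order_tendstoD) auto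
  have "((\<lambda>n. B / t\<^sup>2 * real n powr (- (1 / 2))) \<longlongrightarrow> 0) at_top" by real_asymp
  then have E6: "eventually (\<lambda>n. B / t\<^sup>2 * real n powr (- (1 / 2)) < eps / 8) at_top"
    using eps by (intro order_tendstoD) auto
  have "((\<lambda>n. 6 / (1 - 3 * q) * real n powr (- (q / 4))) \<longlongrightarrow> 0) at_top" using q by real_asymp
  then have E7: "eventually (\<lambda>n. 6 / (1 - 3 * q) * real n powr (- (q / 4)) < eps / 8) at_top"
    using eps by (intro order_tendstoD) auto
  have E1: "eventually (\<lambda>n. M \<le> n \<and> nat \<lceil>lam\<rceil> \<le> n \<and> 2 \<le> n) at_top"
    using eventually_ge_at_top[of M] eventually_ge_at_top[of "nat \<lceil>lam\<rceil>"] eventually_ge_at_top[of 2]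
    by eventually_elim auto

  \<comment> \<open>Certificate probability given a typical forest, then averaging over the
    forest\<close>
  define X where "X n f = measure_pmf.prob (random_subset (p n) (pairs {1..n}))
      {S. \<forall>E. forest_edges f \<subseteq> E \<longrightarrow> E \<subseteq> forest_edges f \<union> S \<longrightarrow> root_certificate ({1..n}, E) 1 {1..M}}" for n f
  have "eventually (\<lambda>n. lam \<le> n \<and> 1 \<le> n \<and> 1 - eps \<le> measure_pmf.expectation (forest q n) (X n)) at_top"
    using E1 E2 E3 E4 E5 E6 E7
  proof eventually_elim
    case (elim n)
    have n: "M \<le> n" "2 \<le> n" "0 < real n" and lamn: "lam \<le> n" using elim(1) by auto
    let ?P = "measure_pmf.prob (forest q n)"
    define G where "G = {f. (\<exists>i j. 2 \<le> i \<and> i < j \<and> j \<le> M \<and> f i = 1 \<and> f j = 1 \<and>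
          eta * real n powr q \<le> descs f n i \<and> eta * real n powr q \<le> descs f n j) \<and>
        (\<forall>m\<in>{M<..n}. descs f n m \<le> g * eta * real n powr q)}"
    define G2 where "G2 = {f. t * n < cluster_sum 2 f n - C * n}"
    define G3 where "G3 = {f. real n powr (1 + q / 4) < cluster_sum 3 f n}"
    have pn: "0 < p n" "p n \<le> 1"
    proof -
      show "0 < p n" using q lam n by (simp add: p_def)
      have "q * (lam / n) \<le> 1 * 1" using q lam lamn n by (intro mult_mono) auto
      then show "p n \<le> 1" by (simp add: p_def)
    qed
    have an: "0 < a n" using A eta n by (simp add: a_def)
    have Zn: "0 < Z n" "Z n ^ 3 = real n powr (1 + q / 4)"
    proof -
      have "(x powr (y / 3)) ^ 3 = x powr y" if "0 < x" for x y :: real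
        using that by (simp add: powr_power)
      then show "Z n ^ 3 = real n powr (1 + q / 4)" using n by (simp only: Z_def)
    qed (use n in \<open>simp add: Z_def\<close>)
    have hn: "0 < h n" "p n * (3 * Z n) \<le> (1 - rho) / 2 * h n"
      using pn Zn r0 by (auto simp: h_def)
    have az: "a n * (g * eta * real n powr q) = q / 2 * ln n"
    proof -
      have "a n * (g * eta * real n powr q) = (A * g) * ln n" using eta n by (simp add: a_def)
      then show ?thesis by (simp only: g)
    qed
    have as_eq: "(1 - rho) / 2 * a n * (eta * real n powr q) = 2 * ln n"
    proof -
      have "(1 - rho) / 2 * a n * (eta * real n powr q) = ((1 - rho) / 2 * A) * ln n"
        using eta n by (simp add: a_def)
      then show ?thesis by (simp only: A)
    qed
    have Xf: "1 - del n \<le> X n f" if f: "f \<in> set_pmf (forest q n)" "f \<in> G" "f \<notin> G2" "f \<notin> G3" for f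
    proof -
      have ff: "forest_fun n f" using f(1) by (rule set_forest)
      obtain i j where ij: "2 \<le> i" "i < j" "j \<le> M" "f i = 1" "f j = 1"
          "eta * real n powr q \<le> descs f n i" "eta * real n powr q \<le> descs f n j"
        and z: "\<And>m. m \<in> {M<..n} \<Longrightarrow> real (descs f n m) \<le> g * eta * real n powr q"
        using f(2) by (auto simp: G_def)
      have c3: "cluster_sum 3 f n \<le> real n powr (1 + q / 4)" using f(4) by (simp add: G3_def)
      have S2: "p n * (cluster_sum 2 f n - n) \<le> rho"
      proof -
        have C1: "C - 1 = 1 / (1 - 2 * q)" using q by (simp add: C_def field_simps)
        have "cluster_sum 2 f n - n \<le> t * n + (C - 1) * n"
          using f(3) by (simp add: G2_def algebra_simps)
        then have "p n * (cluster_sum 2 f n - n) \<le> p n * (t * n + (C - 1) * n)"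
          using pn by (intro mult_left_mono) auto
        also have "\<dots> = q * lam * t + q * lam * (C - 1)" using n by (simp add: p_def field_simps)
        also have "\<dots> = rho" unfolding C1 using q lam by (simp add: t_def c_def)
        finally show ?thesis .
      qed
      have S3: "p n * a n * cluster_sum 3 f n * exp (a n * (g * eta * real n powr q)) \<le> (1 - rho) / 2"
      proof -
        have "p n * a n * cluster_sum 3 f n * exp (a n * (g * eta * real n powr q)) \<le>
          p n * a n * real n powr (1 + q / 4) * real n powr (q / 2)"
          unfolding az using c3 pn an n by (intro mult_mono) (auto simp: powr_def cluster_sum_nonneg)
        then show ?thesis using elim(2) by linarith
      qed
      have S3': "p n * (3 * h n) * cluster_sum 3 f n \<le> (1 - rho) / 2"
      proof -
        have "p n * (3 * h n) * cluster_sum 3 f n \<le> p n * (3 * h n) * real n powr (1 + q / 4)"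
          using c3 pn hn by (intro mult_left_mono) auto
        then show ?thesis using elim(4) by linarith
      qed
      have "1 - (n * exp (a n * (g * eta * real n powr q) - (1 - rho) / 2 * a n * (eta * real n powr q))
          + (real M + 1) * (exp (h n * Z n) - 1)) \<le> X n f"
        unfolding X_def
        by (rule prob_certificate_ge[OF ff _ _ rho(1,2) an S2 S3 z _ _ S3' _ _ hn(2) n(1) ij])
          (use pn hn elim(3) Zn c3 in auto)
      then show ?thesis unfolding az as_eq del_def .
    qed
    have d0: "0 \<le> del n" using n hn Zn by (auto simp: del_def intro!: add_nonneg_nonneg mult_nonneg_nonneg)
    have g2: "?P G2 \<le> eps / 8"
      using prob_cluster_sum_2_large[of n q t] n q t elim(6) unfolding G2_def C_def B_def by simp
    have g3: "?P G3 \<le> eps / 8"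
      using prob_cluster_sum_3_large[of n q "q / 4"] n q elim(7) unfolding G3_def by simp
    have "?P G \<le> ?P ((G - G2 - G3) \<union> G2 \<union> G3)" by (intro prob_mono_pmf) auto
    also have "\<dots> \<le> ?P (G - G2 - G3) + ?P G2 + ?P G3"
      using prob_Un_le[of "forest q n" "(G - G2 - G3) \<union> G2" G3] prob_Un_le[of "forest q n" "G - G2 - G3" G2] by linarith
    \<comment> \<open>Half of \<open>eps\<close> goes to atypical forests,
      \<open>eps / 4 + eps / 8 + eps / 8\<close>; the other half is for \<open>del n\<close>, the
      failure of the noise on a typical forest.\<close>
    finally have GG: "1 - eps / 2 \<le> ?P (G - G2 - G3)" using typical[OF n(1)] g2 g3 by (simp add: G_def)
    have "?P (G - G2 - G3) + - del n = measure_pmf.expectation (forest q n) (\<lambda>f. indicator (G - G2 - G3) f + - del n)"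
      by (subst expectation_add_finite) auto
    also have "\<dots> \<le> measure_pmf.expectation (forest q n) (X n)"
    proof (intro expectation_mono_finite finite_set_forest)
      fix f assume f: "f \<in> set_pmf (forest q n)"
      have "0 \<le> X n f" by (simp add: X_def)
      then show "indicator (G - G2 - G3) f + - del n \<le> X n f"
        using Xf[OF f] d0 by (auto simp: indicator_def)
    qed
    finally have "1 - eps \<le> measure_pmf.expectation (forest q n) (X n)" using GG elim(5) by linarith
    then show ?case using lamn n by auto
  qed
  note ev = this
  have "ereal (1 - eps) \<le> liminf (\<lambda>n. ereal (measure_pmf.prob (root_experiment rep \<rho> \<tau> lam q M M n)
      {(G, S). pos G 1 \<in> S}))" if real: "realization rep pos" for rep pos \<rho> \<tau>
  proof (rule Liminf_bounded)
    show "eventually (\<lambda>n. ereal (1 - eps) \<le> ereal (measure_pmf.prob (root_experiment rep \<rho> \<tau> lam q M M n)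
      {(G, S). pos G 1 \<in> S})) at_top"
      using ev
    proof eventually_elim
      case (elim n)
      have "measure_pmf.expectation (forest q n) (X n) \<le>
          measure_pmf.prob (root_experiment rep \<rho> \<tau> lam q M M n) {(G, S). pos G 1 \<in> S}"
        unfolding X_def p_def using elim lam q real by (intro prob_root_experiment_ge) auto
      then show ?case using elim by simp
    qed
  qed
  \<comment> \<open>One number serves both rankings, \<open>K = L = M\<close>, because the
    certificate set \<open>{1..M}\<close> bounds the rank of the root in each.\<close>
  then show "\<exists>K L :: nat. K \<ge> 1 \<and> L \<ge> 1 \<and>
    (\<forall>rep pos \<rho> \<tau>. realization rep pos \<longrightarrow> component_rule \<rho> \<longrightarrow> vertex_rule \<tau> \<longrightarrow>
       liminf (\<lambda>n. ereal (measure_pmf.prob (root_experiment rep \<rho> \<tau> lam q K L n)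
                            {(G, S). pos G 1 \<in> S})) \<ge> ereal (1 - eps) \<and>
       (\<forall>n. \<forall>(G, S)\<in>set_pmf (root_experiment rep \<rho> \<tau> lam q K L n).
          finite S \<and> card S \<le> K * L))"
    using M card_root_experiment by (intro exI[of _ M]) blast
qed

end
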